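(* Let $d\ge 1$ and let $k$ be a positive integer with $k\le 2d$. Consider the constrained-degree percolation model on $\mathbb{L}^d$ with constraint $k$, and let $\mathcal{N}_t$ denote the number of infinite open clusters at time $t$. Then, for all $t\in[0,1)$, $$\mathcal{N}_t\in\{0,1\}\quad\text{almost surely.}$$
   Context: $\mathbb{L}^d=(\mathbb{Z}^d,\mathcal{E}^d)$ is the hypercubic lattice with nearest-neighbor edge set $\mathcal{E}^d$. Constrained-degree percolation (CDP) with constraint $k$: let $U=(U_e)_{e\in\mathcal{E}^d}$ (the collection of clocks) be i.i.d. random variables, uniform on $[0,1]$, and let $\mathbb{P}$ be the corresponding product probability measure on $[0,1]^{\mathcal{E}^d}$. At time $0$ all edges are closed. An edge $e=\langle u,v\rangle$ opens at time $U_e$ if, for all $s<U_e$, $$\max\{|\{x\in\mathbb{Z}^d:\langle x,u\rangle\text{ is open at time }s\}|,\ |\{x\in\mathbb{Z}^d:\langle x,v\rangle\text{ is open at time }s\}|\}<k;$$ otherwise it never opens. Once open, an edge remains open. For almost every $U$ this determines the state of every edge at every time. $\omega_t(U)\in\{0,1\}^{\mathcal{E}^d}$ is the configuration at time $t\in[0,1]$: $\omega_t(U,e)=1$ if $e$ is open at time $t$ and $\omega_t(U,e)=0$ if it is closed. The open clusters at time $t$ are the connected components of the subgraph of $\mathbb{L}^d$ formed by the edges open at time $t$. *)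

theory Defs
  imports "HOL-Probability.Probability" "HOL-Library.Extended_Nat"
begin

text \<open>
  The lattice \<open>\<int>\<^sup>d\<close> is rendered as \<^typ>\<open>int ^ 'd\<close>, where \<open>d = CARD('d)\<close>.
  An edge is the two-element set of its endpoints, and a configuration is identified with
  its set of open edges.
\<close>

type_synonym 'd edge = "(int ^ 'd) set"

definition lattice_edges :: "'d::finite edge set" where
  "lattice_edges = {{u, v} | u v. (\<Sum>i\<in>UNIV. \<bar>u $ i - v $ i\<bar>) = 1}"

definition clock_measure :: "('d::finite edge \<Rightarrow> real) measure" where
  "clock_measure = (\<Pi>\<^sub>M e\<in>lattice_edges. uniform_measure lborel {0..1})"

definition open_degree :: "'d::finite edge set \<Rightarrow> int ^ 'd \<Rightarrow> nat" where
  "open_degree \<omega> u = card {x. {x, u} \<in> \<omega>}"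

text \<open>
  \<open>\<omega> t\<close> is the set of edges open at time \<open>t\<close>. The second condition is imposed at every real
  \<open>t\<close>, and not only for \<open>t \<in> [0,1]\<close>, so that an evolution can be unique as a function on
  the reals.
\<close>

definition cdp_evolution :: "nat \<Rightarrow> ('d::finite edge \<Rightarrow> real) \<Rightarrow> (real \<Rightarrow> 'd edge set) \<Rightarrow> bool" where
  "cdp_evolution k U \<omega> \<longleftrightarrow>
     \<omega> 0 = {} \<and>
     (\<forall>t e. e \<in> \<omega> t \<longleftrightarrow>
        e \<in> lattice_edges \<and> U e \<le> t \<and>
        (\<forall>s. 0 \<le> s \<and> s < U e \<longrightarrow> Max (open_degree (\<omega> s) ` e) < k))"

text \<open>
  For clocks that are positive and admit no infinite chain of adjacent edges with decreasing
  clocks, which is almost every clock collection, the evolution exists and is unique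
  (lemma \<open>ex1_cdp_evolution\<close> below). On the remaining null set the value is unspecified.
\<close>

definition cdp_config :: "nat \<Rightarrow> ('d::finite edge \<Rightarrow> real) \<Rightarrow> real \<Rightarrow> 'd edge set" where
  "cdp_config k U = (THE \<omega>. cdp_evolution k U \<omega>)"

definition open_clusters :: "'d::finite edge set \<Rightarrow> (int ^ 'd) set set" where
  "open_clusters \<omega> = UNIV // {(x, y). {x, y} \<in> \<omega>}\<^sup>*"

text \<open>
  The number is extended-valued: \<^const>\<open>card\<close> alone would return \<open>0\<close> in the case of
  infinitely many infinite clusters.
\<close>

definition num_infinite_clusters :: "'d::finite edge set \<Rightarrow> enat" where
  "num_infinite_clusters \<omega> =
     (let \<C> = {C \<in> open_clusters \<omega>. infinite C}
      in if finite \<C> then enat (card \<C>) else \<infinity>)"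

lemma ex1_cdp_evolution:
  fixes U :: "'d::finite edge \<Rightarrow> real"
  assumes pos: "\<And>e. e \<in> lattice_edges \<Longrightarrow> 0 < U e"
    and wf: "wf {(f, e). f \<in> lattice_edges \<and> e \<in> lattice_edges \<and> f \<inter> e \<noteq> {} \<and> U f < U e}"
      (is "wf ?R")
  shows "\<exists>!\<omega>. cdp_evolution k U \<omega>"
proof -
  define F where "F = (\<lambda>(P :: 'd edge \<Rightarrow> bool) e.
     \<forall>s. 0 \<le> s \<and> s < U e \<longrightarrow>
       Max (open_degree {f \<in> lattice_edges. (f, e) \<in> ?R \<and> U f \<le> s \<and> P f} ` e) < k)"
  define opens where "opens = wfrec ?R F"
  have opens: "opens e \<longleftrightarrow> F opens e" for e
  proof -
    have "F (cut opens ?R e) e \<longleftrightarrow> F opens e"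
    proof -
      have "{f \<in> lattice_edges. (f, e) \<in> ?R \<and> U f \<le> s \<and> cut opens ?R e f}
          = {f \<in> lattice_edges. (f, e) \<in> ?R \<and> U f \<le> s \<and> opens f}" for s
        by (auto simp: cut_def)
      then show ?thesis unfolding F_def by presburger
    qed
    then show ?thesis
      unfolding opens_def using wfrec[OF wf, of F e] by simp
  qed
  have deg_cong: "open_degree A ` e = open_degree B ` e"
    if "\<And>f. f \<inter> e \<noteq> {} \<Longrightarrow> f \<in> A \<longleftrightarrow> f \<in> B" for A B and e :: "'d edge"
  proof (rule image_cong)
    fix u assume "u \<in> e"
    then have "{x, u} \<in> A \<longleftrightarrow> {x, u} \<in> B" for x by (intro that) auto
    then show "open_degree A u = open_degree B u" by (simp add: open_degree_def)
  qed simp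
  define W where "W = (\<lambda>t. {e \<in> lattice_edges. U e \<le> t \<and> opens e})"
  have "cdp_evolution k U W"
    unfolding cdp_evolution_def
  proof (intro conjI allI)
    show "W 0 = {}" using pos by (force simp: W_def)
  next
    fix t e
    have "opens e \<longleftrightarrow> (\<forall>s. 0 \<le> s \<and> s < U e \<longrightarrow> Max (open_degree (W s) ` e) < k)"
      if e: "e \<in> lattice_edges"
    proof -
      have "open_degree {f \<in> lattice_edges. (f, e) \<in> ?R \<and> U f \<le> s \<and> opens f} ` e
          = open_degree (W s) ` e" if "s < U e" for s
        using that e by (intro deg_cong) (auto simp: W_def)
      then show ?thesis by (subst opens) (auto simp: F_def)
    qed
    then show "e \<in> W t \<longleftrightarrow> e \<in> lattice_edges \<and> U e \<le> t \<and>
        (\<forall>s. 0 \<le> s \<and> s < U e \<longrightarrow> Max (open_degree (W s) ` e) < k)"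
      by (auto simp: W_def)
  qed
  moreover have "\<omega> = \<omega>'" if "cdp_evolution k U \<omega>" "cdp_evolution k U \<omega>'" for \<omega> \<omega>'
  proof -
    have iff: "e \<in> \<omega> t \<longleftrightarrow> e \<in> lattice_edges \<and> U e \<le> t \<and>
        (\<forall>s. 0 \<le> s \<and> s < U e \<longrightarrow> Max (open_degree (\<omega> s) ` e) < k)"
      and iff': "e \<in> \<omega>' t \<longleftrightarrow> e \<in> lattice_edges \<and> U e \<le> t \<and>
        (\<forall>s. 0 \<le> s \<and> s < U e \<longrightarrow> Max (open_degree (\<omega>' s) ` e) < k)" for e t
      using that unfolding cdp_evolution_def by blast+
    have "\<forall>t. e \<in> \<omega> t \<longleftrightarrow> e \<in> \<omega>' t" for e
      using wf
    proof (induction e rule: wf_induct_rule)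
      case (less e)
      show ?case
      proof (cases "e \<in> lattice_edges")
        case True
        have "open_degree (\<omega> s) ` e = open_degree (\<omega>' s) ` e" if "s < U e" for s
        proof (rule deg_cong)
          fix f :: "'d edge" assume f: "f \<inter> e \<noteq> {}"
          show "f \<in> \<omega> s \<longleftrightarrow> f \<in> \<omega>' s"
          proof (cases "f \<in> lattice_edges \<and> U f \<le> s")
            case True
            then show ?thesis using less f \<open>e \<in> lattice_edges\<close> that by auto
          next
            case False
            then show ?thesis using iff[of f s] iff'[of f s] by blast
          qed
        qed
        then show ?thesis by (subst iff, subst iff') auto
      next
        case False
        then show ?thesis using iff[of e] iff'[of e] by blast
      qed
    qed
    then show ?thesis by (auto intro!: ext)
  qed
  ultimately show ?thesis by blast
qed

end

theory Submission
  imports Defs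
begin

text \<open>
  The evolution up to time \<open>t\<close> is determined by a fixed-point equation for the set \<open>\<omega>\<close> of edges
  open at time \<open>t\<close>: an edge is open iff its clock has rung by time \<open>t\<close> and fewer than \<open>k\<close> open edges
  at each endpoint have earlier clocks. Since \<open>t < 1\<close>, an edge can be kept closed by moving its clock
  beyond \<open>t\<close>; hence every finite modification of \<open>\<omega>\<close> with degrees at most \<open>k\<close> is realised by moving
  finitely many clocks. So an almost sure property of \<open>\<omega>\<close> holds almost surely for all these
  modifications at once.

  If \<open>k \<le> 2\<close>, infinite clusters are paths with at most one endpoint, and a density argument shows that
  almost surely none of them has an endpoint; cutting all edges at a vertex would create one, so there
  is no infinite cluster. If \<open>k \<ge> 3\<close>, trifurcations have zero density by the Burton-Keane argument.
  Three infinite clusters could be cut off from a cube and joined in it by a tripod, which respects the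
  degree constraint and creates a trifurcation, so there are at most two. By ergodicity, having two
  would be almost sure, hence would survive the modification that joins the two by a path; but then
  only one is left.
\<close>

text \<open>So whole configurations are modified instead of single edges, and every closed edge that
  touches the modification is delayed as well; then nothing changes elsewhere. Opening edges
  requires an interval of early clocks of positive length, so t = 0 is treated apart. The centre of
  a tripod has degree 3, hence the split at k = 3. Cutting out a cube might break two infinite
  clusters into more; this is excluded by applying the bound of two to the cut configuration.
  Ergodicity enters because only almost sure properties pass to modifications: an event of mere
  positive probability gives no contradiction. The \<open>THE\<close> in \<open>cdp_config\<close>
  gives no hold on measurability. The proof works with \<open>config\<close> instead, a limit of
  explicit iterates, which is measurable and commutes with translations for every clock collection
  and agrees with \<open>cdp_config\<close> for almost every one.\<close>

section \<open>Clusters after the removal of a vertex set\<close>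

definition adj :: "'v set set \<Rightarrow> 'v set \<Rightarrow> ('v \<times> 'v) set" where
  "adj \<omega> S = {(x, y). {x, y} \<in> \<omega> \<and> x \<notin> S \<and> y \<notin> S}"

text \<open>With a set \<open>S\<close> of removed vertices one notion serves whole clusters
  (\<open>S = {}\<close>), branches at a vertex (\<open>S = {c}\<close>), the outside of a cube
  (\<open>S = \<Lambda>\<close>) and walks confined to it (\<open>S = - \<Lambda>\<close>). A
  removed vertex keeps a singleton cluster.\<close>

definition cluster :: "'v set set \<Rightarrow> 'v set \<Rightarrow> 'v \<Rightarrow> 'v set" where
  "cluster \<omega> S x = {y. (x, y) \<in> (adj \<omega> S)\<^sup>*}"

definition nbrs :: "'v set set \<Rightarrow> 'v \<Rightarrow> 'v set" where
  "nbrs \<omega> u = {x. {x, u} \<in> \<omega>}"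

lemma adj_commute: "(x, y) \<in> adj \<omega> S \<longleftrightarrow> (y, x) \<in> adj \<omega> S"
  by (auto simp: adj_def insert_commute)

lemma sym_adj: "sym (adj \<omega> S)"
  by (rule symI) (simp add: adj_commute)

lemma cluster_refl [simp]: "x \<in> cluster \<omega> S x"
  by (simp add: cluster_def)

lemma cluster_sym: "y \<in> cluster \<omega> S x \<Longrightarrow> x \<in> cluster \<omega> S y"
  unfolding cluster_def using symD[OF sym_rtrancl[OF sym_adj[of \<omega> S]], of x y] by simp

lemma cluster_trans: "y \<in> cluster \<omega> S x \<Longrightarrow> z \<in> cluster \<omega> S y \<Longrightarrow> z \<in> cluster \<omega> S x"
  by (auto simp: cluster_def)

lemma cluster_eq: "y \<in> cluster \<omega> S x \<Longrightarrow> cluster \<omega> S y = cluster \<omega> S x"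
  using cluster_sym cluster_trans by fast

lemma cluster_step: "y \<in> cluster \<omega> S x \<Longrightarrow> {y, z} \<in> \<omega> \<Longrightarrow> y \<notin> S \<Longrightarrow> z \<notin> S \<Longrightarrow> z \<in> cluster \<omega> S x"
  unfolding cluster_def by (auto simp: adj_def intro: rtrancl_into_rtrancl)

lemma cluster_eq_if_meet:
  "K \<inter> L \<noteq> {} \<Longrightarrow> K = cluster \<omega> S x \<Longrightarrow> L = cluster \<omega> S y \<Longrightarrow> K = L"
  by (metis cluster_eq disjoint_iff)

lemma cluster_edge: "{x, z} \<in> \<omega> \<Longrightarrow> x \<notin> S \<Longrightarrow> z \<notin> S \<Longrightarrow> z \<in> cluster \<omega> S x"
  by (rule cluster_step[OF cluster_refl])

lemma cluster_induct [consumes 1, case_names refl step]: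
  assumes "y \<in> cluster \<omega> S x" "P x"
    and "\<And>y z. y \<in> cluster \<omega> S x \<Longrightarrow> P y \<Longrightarrow> {y, z} \<in> \<omega> \<Longrightarrow> y \<notin> S \<Longrightarrow> z \<notin> S \<Longrightarrow> P z"
  shows "P y"
proof -
  have "(x, y) \<in> (adj \<omega> S)\<^sup>*" using assms(1) by (simp add: cluster_def)
  then show ?thesis
  proof (induction rule: rtrancl_induct)
    case (step y z)
    have "y \<in> cluster \<omega> S x" "{y, z} \<in> \<omega>" "y \<notin> S" "z \<notin> S"
      using step(1,2) by (simp_all add: cluster_def adj_def)
    with step(3) show ?case using assms(3) by blast
  qed (rule assms(2))
qed

lemma cluster_avoids: "y \<in> cluster \<omega> S x \<Longrightarrow> x \<notin> S \<Longrightarrow> y \<notin> S"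
  by (induction rule: cluster_induct) auto

lemma cluster_removed: "x \<in> S \<Longrightarrow> cluster \<omega> S x = {x}"
proof -
  assume x: "x \<in> S"
  have "y = x" if "y \<in> cluster \<omega> S x" for y
    using that by (induction rule: cluster_induct) (use x in auto)
  then show ?thesis by auto
qed

lemma cluster_mono: "\<omega> \<subseteq> \<omega>' \<Longrightarrow> S' \<subseteq> S \<Longrightarrow> cluster \<omega> S x \<subseteq> cluster \<omega>' S' x"
  unfolding cluster_def adj_def by (auto elim!: rtrancl_mono[THEN subsetD, rotated])

lemma cluster_closed:
  assumes "x \<in> Z" and "\<And>u v. u \<in> Z \<Longrightarrow> {u, v} \<in> \<omega> \<Longrightarrow> u \<notin> S \<Longrightarrow> v \<notin> S \<Longrightarrow> v \<in> Z"
  shows "cluster \<omega> S x \<subseteq> Z"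
proof
  fix y assume "y \<in> cluster \<omega> S x"
  then show "y \<in> Z" by (induction rule: cluster_induct) (use assms in auto)
qed

text \<open>No walk inside the cluster visits \<open>T\<close>, so all of them survive the
  removal.\<close>

lemma cluster_enlarge:
  assumes "S \<subseteq> T" "cluster \<omega> S a \<inter> T = {}"
  shows "cluster \<omega> T a = cluster \<omega> S a"
proof
  show "cluster \<omega> T a \<subseteq> cluster \<omega> S a" using assms(1) by (intro cluster_mono) auto
  show "cluster \<omega> S a \<subseteq> cluster \<omega> T a"
  proof
    fix y assume "y \<in> cluster \<omega> S a"
    then show "y \<in> cluster \<omega> T a"
    proof (induction rule: cluster_induct)
      case (step y z)
      have "z \<in> cluster \<omega> S a" by (rule cluster_step[OF step(1-4)])
      with step(1) have "y \<notin> T" "z \<notin> T" using assms(2) by auto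
      then show ?case by (rule cluster_step[OF step(5,2)])
    qed simp
  qed
qed

text \<open>Follow a walk from \<open>x\<close> to \<open>y\<close>: either it never meets
  \<open>P\<close>, or there is a first edge into \<open>P\<close>, whose start \<open>b\<close> is
  still connected to \<open>x\<close> outside \<open>P\<close>.\<close>

lemma cluster_first_hit:
  assumes "y \<in> cluster \<omega> S x" "x \<notin> P"
  shows "y \<in> cluster \<omega> (S \<union> P) x \<and> y \<notin> P \<or>
    (\<exists>b c. b \<in> cluster \<omega> (S \<union> P) x \<and> b \<notin> P \<and> c \<in> P \<and> {b, c} \<in> \<omega> \<and> b \<notin> S \<and> c \<notin> S)"
  using assms(1)
proof (induction rule: cluster_induct)
  case refl then show ?case using assms(2) by auto
next
  case (step y z)
  show ?case
  proof (cases "y \<in> cluster \<omega> (S \<union> P) x \<and> y \<notin> P")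
    case True
    show ?thesis
    proof (cases "z \<in> P")
      case z: True
      show ?thesis
        by (intro disjI2 exI[of _ y] exI[of _ z]) (use True z step(2-4) in simp)
    next
      case False
      then have "z \<in> cluster \<omega> (S \<union> P) x"
        using True step(2-4) cluster_step[of y \<omega> "S \<union> P" x z] by blast
      then show ?thesis using False by blast
    qed
  next
    case False
    then show ?thesis using step(5) by blast
  qed
qed

text \<open>By local finiteness only finitely many vertices are adjacent to \<open>S\<close>, and
  their clusters outside \<open>S\<close>, together with \<open>S\<close>, cover the cluster of
  \<open>x\<close>. So one of these pieces is infinite.\<close>

lemma infinite_cluster_split:
  assumes lf: "\<And>u. finite (nbrs \<omega> u)" and S: "finite S" "x \<in> S" and inf: "infinite (cluster \<omega> {} x)"
  obtains a s where "a \<notin> S" "s \<in> S" "{a, s} \<in> \<omega>" "a \<in> cluster \<omega> {} x" "infinite (cluster \<omega> S a)"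
proof -
  define N where "N = {a. a \<notin> S \<and> a \<in> cluster \<omega> {} x \<and> (\<exists>s\<in>S. {a, s} \<in> \<omega>)}"
  have "N \<subseteq> (\<Union>s\<in>S. nbrs \<omega> s)" by (auto simp: N_def nbrs_def)
  then have "finite N" using S lf by (meson finite_UN finite_subset)
  have "cluster \<omega> {} x \<subseteq> S \<union> (\<Union>a\<in>N. cluster \<omega> S a)"
  proof
    fix y assume y: "y \<in> cluster \<omega> {} x"
    show "y \<in> S \<union> (\<Union>a\<in>N. cluster \<omega> S a)"
    proof (cases "y \<in> S")
      case False
      from cluster_first_hit[OF cluster_sym[OF y] this] S
      obtain b c where b: "b \<in> cluster \<omega> S y" "b \<notin> S" "c \<in> S" "{b, c} \<in> \<omega>" by auto
      have "b \<in> cluster \<omega> {} y" using b(1) cluster_mono[of \<omega> \<omega> "{}" S] by auto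
      then have "b \<in> N" using b y cluster_trans by (fastforce simp: N_def)
      then show ?thesis using cluster_sym[OF b(1)] by auto
    qed auto
  qed
  then have "\<exists>a\<in>N. infinite (cluster \<omega> S a)"
    using inf S \<open>finite N\<close> by (meson finite_UN finite_UnI finite_subset)
  then show thesis using that by (auto simp: N_def)
qed

subsection \<open>Trifurcations\<close>

text \<open>The Burton-Keane notion, weakened: \<open>c\<close> may have further neighbours and
  further infinite branches. Since \<open>cluster \<omega> {c} c\<close> is a singleton, infinite
  branches force the three neighbours to differ from \<open>c\<close>.\<close>

definition trifurcation :: "'v set set \<Rightarrow> 'v \<Rightarrow> bool" where
  "trifurcation \<omega> c \<longleftrightarrow> (\<exists>a\<^sub>1 a\<^sub>2 a\<^sub>3.
     {c, a\<^sub>1} \<in> \<omega> \<and> {c, a\<^sub>2} \<in> \<omega> \<and> {c, a\<^sub>3} \<in> \<omega> \<and>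
     infinite (cluster \<omega> {c} a\<^sub>1) \<and> infinite (cluster \<omega> {c} a\<^sub>2) \<and> infinite (cluster \<omega> {c} a\<^sub>3) \<and>
     a\<^sub>2 \<notin> cluster \<omega> {c} a\<^sub>1 \<and> a\<^sub>3 \<notin> cluster \<omega> {c} a\<^sub>1 \<and> a\<^sub>3 \<notin> cluster \<omega> {c} a\<^sub>2)"

text \<open>Take a branch that contains as many points of \<open>T\<close> as possible: a point of \<open>T\<close> in another branch
  at the same vertex would see a branch with one more point of \<open>T\<close>.\<close>

lemma outermost_trifurcation:
  assumes T: "finite T" "T \<noteq> {}" "\<And>t. t \<in> T \<Longrightarrow> trifurcation \<omega> t"
  obtains t a\<^sub>1 a\<^sub>2 where "t \<in> T" "{t, a\<^sub>1} \<in> \<omega>" "{t, a\<^sub>2} \<in> \<omega>" "a\<^sub>2 \<notin> cluster \<omega> {t} a\<^sub>1"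
    "infinite (cluster \<omega> {t} a\<^sub>1)" "infinite (cluster \<omega> {t} a\<^sub>2)"
    "cluster \<omega> {t} a\<^sub>1 \<inter> T = {}" "cluster \<omega> {t} a\<^sub>2 \<inter> T = {}"
proof -
  define P where "P = (\<lambda>(t, a). t \<in> T \<and> a \<noteq> t \<and> {t, a} \<in> \<omega>)"
  define f where "f = (\<lambda>(t, a). card (cluster \<omega> {t} a \<inter> T))"
  have bound: "f p < Suc (card T)" for p
    using T(1) by (auto simp: f_def less_Suc_eq_le split: prod.splits intro!: card_mono)
  obtain t0 where "t0 \<in> T" using T(2) by auto
  then obtain a0 where "{t0, a0} \<in> \<omega>" "infinite (cluster \<omega> {t0} a0)"
    using T(3) unfolding trifurcation_def by blast
  then have "P (t0, a0)"
    using \<open>t0 \<in> T\<close> cluster_removed[of t0 "{t0}" \<omega>] by (auto simp: P_def)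
  then obtain p where p: "P p" "\<And>q. P q \<Longrightarrow> f q \<le> f p"
    using ex_has_greatest_nat[of P "(t0, a0)" f "Suc (card T)"] bound less_imp_le by metis
  obtain t a where ta: "p = (t, a)" by (cases p)
  have t: "t \<in> T" "a \<noteq> t" "{t, a} \<in> \<omega>" using p(1) by (auto simp: P_def ta)
  have max: "card (cluster \<omega> {s} b \<inter> T) \<le> card (cluster \<omega> {t} a \<inter> T)"
    if "s \<in> T" "b \<noteq> s" "{s, b} \<in> \<omega>" for s b
    using p(2)[of "(s, b)"] that by (auto simp: P_def f_def ta)
  have free: "cluster \<omega> {t} d \<inter> T = {}"
    if d: "{t, d} \<in> \<omega>" "infinite (cluster \<omega> {t} d)" "d \<notin> cluster \<omega> {t} a" for d
  proof (rule ccontr)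
    assume "cluster \<omega> {t} d \<inter> T \<noteq> {}"
    then obtain s where s: "s \<in> T" "s \<in> cluster \<omega> {t} d" by auto
    have "d \<noteq> t" using d(2) cluster_removed[of t "{t}" \<omega>] by auto
    then have "s \<noteq> t" using cluster_avoids[OF s(2)] by auto
    have "s \<notin> cluster \<omega> {t} a" using cluster_trans[OF _ cluster_sym[OF s(2)]] d(3) by auto
    have "d \<in> cluster \<omega> {} t" using cluster_step[of t \<omega> "{}" t d] d(1) by simp
    moreover have "s \<in> cluster \<omega> {} d" using s(2) cluster_mono[of \<omega> \<omega> "{}" "{t}"] by auto
    ultimately have "s \<in> cluster \<omega> {} t" by (rule cluster_trans)
    from cluster_first_hit[OF this, of "{s}"] \<open>s \<noteq> t\<close>
    obtain b where b: "b \<in> cluster \<omega> {s} t" "b \<noteq> s" "{b, s} \<in> \<omega>" by auto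
    have "cluster \<omega> {s} b = cluster \<omega> {s} t" using cluster_eq[OF b(1)] .
    \<comment> \<open>The branch of \<open>s\<close> through \<open>b\<close> contains
      \<open>t\<close>. As \<open>s\<close> lies outside the branch of \<open>t\<close> at
      \<open>a\<close>, that branch survives the removal of \<open>s\<close>, so the branch of
      \<open>s\<close> contains all of it and \<open>t\<close> in addition.\<close>
    moreover have "insert t (cluster \<omega> {t} a) \<subseteq> cluster \<omega> {s} t"
    proof -
      have "a \<noteq> s" using \<open>s \<notin> cluster \<omega> {t} a\<close> by (metis cluster_refl)
      then have "a \<in> cluster \<omega> {s} t" using t \<open>s \<noteq> t\<close> by (intro cluster_edge) auto
      moreover have "cluster \<omega> ({t} \<union> {s}) a = cluster \<omega> {t} a"
        using \<open>s \<notin> cluster \<omega> {t} a\<close> cluster_avoids[of _ \<omega> "{t}" a] t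
        by (intro cluster_enlarge) auto
      moreover have "cluster \<omega> ({t} \<union> {s}) a \<subseteq> cluster \<omega> {s} a" by (intro cluster_mono) auto
      ultimately show ?thesis using cluster_trans by fastforce
    qed
    ultimately have "insert t (cluster \<omega> {t} a \<inter> T) \<subseteq> cluster \<omega> {s} b \<inter> T" using t(1) by auto
    moreover have "t \<notin> cluster \<omega> {t} a" using cluster_avoids[of t \<omega> "{t}" a] t by auto
    ultimately have "card (cluster \<omega> {t} a \<inter> T) < card (cluster \<omega> {s} b \<inter> T)"
      using T(1) by (intro psubset_card_mono) auto
    moreover have "{s, b} \<in> \<omega>" using b(3) by (simp add: insert_commute)
    ultimately show False using max[OF s(1) b(2)] by simp
  qed
  obtain a\<^sub>1 a\<^sub>2 a\<^sub>3 where a: "{t, a\<^sub>1} \<in> \<omega>" "{t, a\<^sub>2} \<in> \<omega>" "{t, a\<^sub>3} \<in> \<omega>"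
     "infinite (cluster \<omega> {t} a\<^sub>1)" "infinite (cluster \<omega> {t} a\<^sub>2)" "infinite (cluster \<omega> {t} a\<^sub>3)"
     "a\<^sub>2 \<notin> cluster \<omega> {t} a\<^sub>1" "a\<^sub>3 \<notin> cluster \<omega> {t} a\<^sub>1" "a\<^sub>3 \<notin> cluster \<omega> {t} a\<^sub>2"
    using T(3)[OF t(1)] unfolding trifurcation_def by metis
  \<comment> \<open>The chosen branch contains at most one of the three neighbours, so the other two
    start branches that are free of \<open>T\<close>.\<close>
  have eq: "y \<in> cluster \<omega> {t} x" if "x \<in> cluster \<omega> {t} a" "y \<in> cluster \<omega> {t} a" for x y
    using that cluster_sym cluster_trans by metis
  consider "a\<^sub>1 \<notin> cluster \<omega> {t} a" "a\<^sub>2 \<notin> cluster \<omega> {t} a" | "a\<^sub>1 \<notin> cluster \<omega> {t} a" "a\<^sub>3 \<notin> cluster \<omega> {t} a"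
    | "a\<^sub>2 \<notin> cluster \<omega> {t} a" "a\<^sub>3 \<notin> cluster \<omega> {t} a"
    using eq a by metis
  then show thesis
  proof cases
    case 1 then show thesis by (intro that[of t a\<^sub>1 a\<^sub>2] free) (use a t in auto)
  next
    case 2 then show thesis by (intro that[of t a\<^sub>1 a\<^sub>3] free) (use a t in auto)
  next
    case 3 then show thesis by (intro that[of t a\<^sub>2 a\<^sub>3] free) (use a t in auto)
  qed
qed

text \<open>The induction puts an outermost \<open>t\<close> back last. Of the branches for
  \<open>T - {t}\<close> at most one contains \<open>t\<close> and is lost, whereas the two branches
  at \<open>t\<close> that avoid \<open>T\<close> are gained, so the count grows by at least
  one.\<close>

lemma trifurcation_branches:
  assumes "finite T" "\<And>t. t \<in> T \<Longrightarrow> trifurcation \<omega> t"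
  shows "\<exists>F. finite F \<and> card F \<ge> card T \<and>
    (\<forall>K\<in>F. infinite K \<and> (\<exists>t\<in>T. \<exists>a. a \<notin> T \<and> {t, a} \<in> \<omega> \<and> K = cluster \<omega> T a))"
  using assms
proof (induction "card T" arbitrary: T)
  case 0
  then show ?case by (intro exI[of _ "{}"]) auto
next
  case (Suc n)
  have "T \<noteq> {}" using Suc(2) by auto
  then obtain t a\<^sub>1 a\<^sub>2 where t: "t \<in> T" "{t, a\<^sub>1} \<in> \<omega>" "{t, a\<^sub>2} \<in> \<omega>" "a\<^sub>2 \<notin> cluster \<omega> {t} a\<^sub>1"
    "infinite (cluster \<omega> {t} a\<^sub>1)" "infinite (cluster \<omega> {t} a\<^sub>2)"
    "cluster \<omega> {t} a\<^sub>1 \<inter> T = {}" "cluster \<omega> {t} a\<^sub>2 \<inter> T = {}"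
    using outermost_trifurcation[OF Suc(3) _ Suc(4)] by metis
  define T' where "T' = T - {t}"
  have card: "n = card T'" "finite T'" using Suc(2,3) t(1) by (auto simp: T'_def)
  from Suc(1)[OF card] Suc(4)
  obtain F where F: "finite F" "card F \<ge> card T'"
    "\<And>K. K \<in> F \<Longrightarrow> infinite K \<and> (\<exists>t\<in>T'. \<exists>a. a \<notin> T' \<and> {t, a} \<in> \<omega> \<and> K = cluster \<omega> T' a)"
    by (metis DiffD1 T'_def)
  define D\<^sub>1 D\<^sub>2 where "D\<^sub>1 = cluster \<omega> T a\<^sub>1" and "D\<^sub>2 = cluster \<omega> T a\<^sub>2"
  have D: "D\<^sub>1 = cluster \<omega> {t} a\<^sub>1" "D\<^sub>2 = cluster \<omega> {t} a\<^sub>2"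
    unfolding D\<^sub>1_def D\<^sub>2_def using t by (auto intro!: cluster_enlarge)
  have aT: "a\<^sub>1 \<notin> T" "a\<^sub>2 \<notin> T" using t(7,8) cluster_refl by fastforce+
  have "D\<^sub>1 \<noteq> D\<^sub>2" using t(4) D by (metis cluster_refl)
  define F' where "F' = {K \<in> F. t \<notin> K}"
  have K_t: "K = cluster \<omega> T' t" if "K \<in> F" "t \<in> K" for K
  proof -
    obtain a where "K = cluster \<omega> T' a" using F(3)[OF \<open>K \<in> F\<close>] by auto
    with that show ?thesis using cluster_eq by metis
  qed
  have "F \<subseteq> insert (cluster \<omega> T' t) F'" using K_t by (auto simp: F'_def)
  then have "card F \<le> Suc (card F')"
    using F(1) card_mono[of "insert (cluster \<omega> T' t) F'" F] card_insert_if[of F' "cluster \<omega> T' t"]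
    by (auto simp: F'_def split: if_splits)
  \<comment> \<open>A cluster for \<open>T'\<close> that contains a neighbour of \<open>t\<close>
    outside \<open>T\<close> contains \<open>t\<close> too, so the gained branches are not among the
    kept ones.\<close>
  moreover have "D\<^sub>i \<notin> F'" if Di: "D\<^sub>i = cluster \<omega> T a" "{t, a} \<in> \<omega>" "a \<notin> T" for D\<^sub>i a
  proof
    assume "D\<^sub>i \<in> F'"
    then have *: "D\<^sub>i \<in> F" "t \<notin> D\<^sub>i" by (auto simp: F'_def)
    then obtain b where "D\<^sub>i = cluster \<omega> T' b" using F(3) by blast
    moreover have "a \<in> D\<^sub>i" using Di by simp
    ultimately have "t \<in> D\<^sub>i"
      using Di cluster_step[of a \<omega> T' b t] by (simp add: T'_def insert_commute)
    with * show False by simp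
  qed
  then have "D\<^sub>1 \<notin> F'" "D\<^sub>2 \<notin> F'" using D\<^sub>1_def D\<^sub>2_def t aT by blast+
  moreover have "finite F'" using F(1) by (simp add: F'_def)
  ultimately have "card (insert D\<^sub>1 (insert D\<^sub>2 F')) \<ge> card T"
    using \<open>D\<^sub>1 \<noteq> D\<^sub>2\<close> F(2) card Suc(2) by simp
  moreover have "infinite K \<and> (\<exists>t\<in>T. \<exists>a. a \<notin> T \<and> {t, a} \<in> \<omega> \<and> K = cluster \<omega> T a)" if "K \<in> F'" for K
  proof -
    have K: "K \<in> F" "t \<notin> K" using that by (auto simp: F'_def)
    then obtain s a where s: "infinite K" "s \<in> T'" "a \<notin> T'" "{s, a} \<in> \<omega>" "K = cluster \<omega> T' a"
      using F(3) by metis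
    have "cluster \<omega> T a = cluster \<omega> T' a"
      using s K cluster_avoids[of _ \<omega> T' a] by (intro cluster_enlarge) (auto simp: T'_def)
    moreover have "a \<noteq> t" using K(2) s(5) by auto
    ultimately show ?thesis using s by (auto simp: T'_def)
  qed
  moreover have "infinite D\<^sub>1 \<and> (\<exists>t\<in>T. \<exists>a. a \<notin> T \<and> {t, a} \<in> \<omega> \<and> D\<^sub>1 = cluster \<omega> T a)"
    using t aT D(1) D\<^sub>1_def by metis
  moreover have "infinite D\<^sub>2 \<and> (\<exists>t\<in>T. \<exists>a. a \<notin> T \<and> {t, a} \<in> \<omega> \<and> D\<^sub>2 = cluster \<omega> T a)"
    using t aT D(2) D\<^sub>2_def by metis
  ultimately show ?case
    using \<open>finite F'\<close> by (intro exI[of _ "insert D\<^sub>1 (insert D\<^sub>2 F')"]) simp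
qed

text \<open>An infinite connected set that starts in \<open>B\<close> has to leave this finite set,
  and its first vertex outside is a neighbour of \<open>B\<close>, hence in \<open>B'\<close>. In
  the applications \<open>B\<close> is a cube and \<open>B'\<close> the next larger one.\<close>

lemma cluster_meets_boundary:
  assumes "infinite (cluster \<omega> S a)" "a \<in> B'" "finite B"
    and nb: "\<And>u v. u \<in> B \<Longrightarrow> {u, v} \<in> \<omega> \<Longrightarrow> v \<in> B'"
  shows "cluster \<omega> S a \<inter> (B' - B) \<noteq> {}"
proof (cases "a \<in> B")
  case True
  show ?thesis
  proof (rule ccontr)
    assume *: "\<not> ?thesis"
    have "cluster \<omega> S a \<subseteq> B"
    proof
      fix y assume "y \<in> cluster \<omega> S a"
      then show "y \<in> B"
      proof (induction rule: cluster_induct)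
        case (step y z)
        have "z \<in> cluster \<omega> S a" by (rule cluster_step[OF step(1-4)])
        with nb[OF step(5,2)] * show ?case by auto
      qed (rule True)
    qed
    with assms show False using finite_subset by blast
  qed
next
  case False with assms show ?thesis using cluster_refl by fastforce
qed

lemma disjoint_card_le:
  assumes "finite B" "\<And>K. K \<in> F \<Longrightarrow> K \<inter> B \<noteq> {}" "\<And>K L. K \<in> F \<Longrightarrow> L \<in> F \<Longrightarrow> K \<inter> L \<noteq> {} \<Longrightarrow> K = L"
  shows "card F \<le> card B"
proof -
  have "\<forall>K\<in>F. \<exists>b. b \<in> K \<inter> B" using assms(2) by blast
  then obtain g where g: "\<And>K. K \<in> F \<Longrightarrow> g K \<in> K \<inter> B" by metis
  have "inj_on g F" using g assms(3) by (intro inj_onI) (metis IntD1 IntI empty_iff)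
  then show ?thesis using g assms(1) by (intro card_inj_on_le[of g]) auto
qed

text \<open>Removing \<open>T\<close> leaves at least \<open>card T\<close> disjoint infinite
  branches that start next to \<open>T\<close>, and each takes a vertex of its own from the layer
  \<open>B' - B\<close>.\<close>

lemma card_trifurcations_le:
  assumes "T \<subseteq> B" "finite B" "finite B'" "\<And>t. t \<in> T \<Longrightarrow> trifurcation \<omega> t"
    and nb: "\<And>u v. u \<in> B \<Longrightarrow> {u, v} \<in> \<omega> \<Longrightarrow> v \<in> B'"
  shows "card T \<le> card (B' - B)"
proof -
  have "finite T" using assms(1,2) finite_subset by auto
  from trifurcation_branches[OF this assms(4)]
  obtain F where F: "finite F" "card F \<ge> card T"
    "\<And>K. K \<in> F \<Longrightarrow> infinite K \<and> (\<exists>t\<in>T. \<exists>a. a \<notin> T \<and> {t, a} \<in> \<omega> \<and> K = cluster \<omega> T a)"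
    by blast
  have "card F \<le> card (B' - B)"
  proof (rule disjoint_card_le)
    show "finite (B' - B)" using assms by auto
    show "K \<inter> (B' - B) \<noteq> {}" if "K \<in> F" for K
    proof -
      obtain t a where "infinite K" "t \<in> T" "{t, a} \<in> \<omega>" "K = cluster \<omega> T a" using F(3)[OF \<open>K \<in> F\<close>] by auto
      then have "infinite (cluster \<omega> T a)" "a \<in> B'" using nb assms(1) by auto
      then show ?thesis
        unfolding \<open>K = _\<close> by (rule cluster_meets_boundary[OF _ _ assms(2)]) (rule nb)
    qed
    show "K = L" if "K \<in> F" "L \<in> F" "K \<inter> L \<noteq> {}" for K L
    proof -
      obtain a b where "K = cluster \<omega> T a" "L = cluster \<omega> T b" using F(3) \<open>K \<in> F\<close> \<open>L \<in> F\<close> by meson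
      with that(3) show ?thesis by (rule cluster_eq_if_meet)
    qed
  qed
  with F(2) show ?thesis by simp
qed

subsection \<open>Paths\<close>

text \<open>Loop erasure: if the vertex to be prepended already lies on the path, the part before it
  is dropped.\<close>

lemma rtrancl_distinct_path:
  assumes "(x, y) \<in> R\<^sup>*"
  obtains xs where "xs \<noteq> []" "hd xs = x" "last xs = y" "distinct xs"
    "successively (\<lambda>u v. (u, v) \<in> R) xs" "set xs \<subseteq> R\<^sup>* `` {x}"
proof -
  have "\<exists>xs. xs \<noteq> [] \<and> hd xs = x \<and> last xs = y \<and> distinct xs \<and>
      successively (\<lambda>u v. (u, v) \<in> R) xs \<and> set xs \<subseteq> R\<^sup>* `` {x}"
    using assms
  proof (induction rule: converse_rtrancl_induct)
    case base then show ?case by (intro exI[of _ "[y]"]) auto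
  next
    case (step x z)
    then obtain xs where xs: "xs \<noteq> []" "hd xs = z" "last xs = y" "distinct xs"
      "successively (\<lambda>u v. (u, v) \<in> R) xs" "set xs \<subseteq> R\<^sup>* `` {z}" by blast
    have sub: "insert x (set xs) \<subseteq> R\<^sup>* `` {x}"
      using xs(6) step(1) by (auto intro: converse_rtrancl_into_rtrancl)
    show ?case
    proof (cases "x \<in> set xs")
      case True
      then obtain ys zs where "xs = ys @ x # zs" by (auto dest: split_list)
      then show ?thesis using xs sub by (intro exI[of _ "x # zs"]) (auto simp: successively_append_iff)
    next
      case False
      then show ?thesis using xs step(1) sub by (intro exI[of _ "x # xs"]) (auto simp: successively_Cons)
    qed
  qed
  then show thesis using that by blast
qed

text \<open>On a simple path from \<open>x\<close> to \<open>y\<close> the path edges already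
  exhaust the degree of every vertex: two at inner vertices, one at the ends. So the path is closed
  under open edges and is the whole cluster.\<close>

lemma two_leaves_finite:
  assumes deg: "\<And>u. finite (nbrs \<omega> u) \<and> card (nbrs \<omega> u) \<le> 2"
    and leaf: "card (nbrs \<omega> x) \<le> 1" "card (nbrs \<omega> y) \<le> 1" and xy: "x \<noteq> y" "y \<in> cluster \<omega> {} x"
  shows "finite (cluster \<omega> {} x)"
proof -
  have "(x, y) \<in> (adj \<omega> {})\<^sup>*" using xy by (simp add: cluster_def)
  then obtain xs where xs: "xs \<noteq> []" "hd xs = x" "last xs = y" "distinct xs"
    "successively (\<lambda>u v. (u, v) \<in> adj \<omega> {}) xs"
    by (rule rtrancl_distinct_path)
  have edge: "{xs ! i, xs ! Suc i} \<in> \<omega>" if "Suc i < length xs" for i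
    using xs(5) that by (auto simp: successively_conv_nth adj_def)
  have hd: "xs ! 0 = x" using xs by (simp add: hd_conv_nth)
  have la: "xs ! (length xs - 1) = y" using xs by (simp add: last_conv_nth)
  have len: "length xs > 1" using hd la xy xs(1) by (cases "length xs = 1") (auto simp: nat_neq_iff)
  have closed: "nbrs \<omega> (xs ! i) \<subseteq> set xs" if i: "i < length xs" for i
  proof -
    consider "i = 0" | "i = length xs - 1" "i \<noteq> 0" | "0 < i" "Suc i < length xs" using i by linarith
    then show ?thesis
    proof cases
      case 1
      have "{xs ! 1} \<subseteq> nbrs \<omega> x" using edge[of 0] len hd by (auto simp: nbrs_def insert_commute)
      then have "nbrs \<omega> x = {xs ! 1}" using card_seteq[of "nbrs \<omega> x" "{xs ! 1}"] deg leaf by auto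
      then show ?thesis using 1 hd len by auto
    next
      case 2
      have "Suc (i - 1) = i" using 2 by simp
      then have "{xs ! (i - 1)} \<subseteq> nbrs \<omega> y" using edge[of "i - 1"] i 2 la by (auto simp: nbrs_def insert_commute)
      then have "nbrs \<omega> y = {xs ! (i - 1)}" using card_seteq[of "nbrs \<omega> y" "{xs ! (i - 1)}"] deg leaf by auto
      then show ?thesis using 2 la len by auto
    next
      case 3
      let ?A = "{xs ! (i - 1), xs ! Suc i}"
      have "?A \<subseteq> nbrs \<omega> (xs ! i)" using edge[of "i - 1"] edge[of i] 3 by (auto simp: nbrs_def insert_commute)
      moreover have "xs ! (i - 1) \<noteq> xs ! Suc i" using xs(4) 3 by (subst nth_eq_iff_index_eq) auto
      then have "card ?A = 2" by simp
      ultimately have "nbrs \<omega> (xs ! i) = ?A" using card_seteq[of "nbrs \<omega> (xs ! i)" ?A] deg by auto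
      then show ?thesis using 3 by auto
    qed
  qed
  have "cluster \<omega> {} x \<subseteq> set xs"
  proof (rule cluster_closed)
    show "x \<in> set xs" using xs by auto
    fix u v assume "u \<in> set xs" "{u, v} \<in> \<omega>"
    then obtain i where "i < length xs" "u = xs ! i" by (auto simp: in_set_conv_nth)
    then show "v \<in> set xs"
      using closed[of i] \<open>{u, v} \<in> \<omega>\<close> by (auto simp: nbrs_def insert_commute)
  qed
  then show ?thesis using finite_subset by blast
qed

text \<open>An infinite cluster contains at most one vertex of \<open>T\<close>, so these vertices
  have disjoint infinite clusters, each of which crosses the layer around \<open>B\<close>.\<close>

lemma card_leaves_le:
  assumes "T \<subseteq> B" "finite B" "finite B'" "B \<subseteq> B'"
    and deg: "\<And>u. finite (nbrs \<omega> u) \<and> card (nbrs \<omega> u) \<le> 2"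
    and leaf: "\<And>t. t \<in> T \<Longrightarrow> card (nbrs \<omega> t) \<le> 1 \<and> infinite (cluster \<omega> {} t)"
    and nb: "\<And>u v. u \<in> B \<Longrightarrow> {u, v} \<in> \<omega> \<Longrightarrow> v \<in> B'"
  shows "card T \<le> card (B' - B)"
proof -
  have inj: "inj_on (cluster \<omega> {}) T"
  proof (rule inj_onI, rule ccontr)
    fix x y assume "x \<in> T" "y \<in> T" "cluster \<omega> {} x = cluster \<omega> {} y" "x \<noteq> y"
    then have "y \<in> cluster \<omega> {} x" by simp
    then have "finite (cluster \<omega> {} x)"
      using \<open>x \<in> T\<close> \<open>y \<in> T\<close> \<open>x \<noteq> y\<close> leaf by (intro two_leaves_finite[OF deg]) auto
    then show False using leaf \<open>x \<in> T\<close> by blast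
  qed
  have "card (cluster \<omega> {} ` T) \<le> card (B' - B)"
  proof (rule disjoint_card_le)
    show "finite (B' - B)" using assms by auto
    show "K \<inter> (B' - B) \<noteq> {}" if "K \<in> cluster \<omega> {} ` T" for K
    proof -
      obtain t where "t \<in> T" "K = cluster \<omega> {} t" using \<open>K \<in> _\<close> by auto
      then have "infinite (cluster \<omega> {} t)" "t \<in> B'" using leaf assms(1,4) by auto
      then show ?thesis
        unfolding \<open>K = _\<close> by (rule cluster_meets_boundary[OF _ _ assms(2)]) (rule nb)
    qed
    show "K = L" if "K \<in> cluster \<omega> {} ` T" "L \<in> cluster \<omega> {} ` T" "K \<inter> L \<noteq> {}" for K L
      using that cluster_eq_if_meet[OF that(3)] by (elim imageE) simp
  qed
  then show ?thesis by (simp add: card_image inj)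
qed

lemma cluster_path:
  assumes "y \<in> cluster \<omega> S x"
  obtains xs where "xs \<noteq> []" "hd xs = x" "last xs = y" "distinct xs"
    "successively (\<lambda>u v. {u, v} \<in> \<omega>) xs" "set xs \<subseteq> cluster \<omega> S x"
proof -
  have "(x, y) \<in> (adj \<omega> S)\<^sup>*" using assms by (simp add: cluster_def)
  then obtain xs where "xs \<noteq> []" "hd xs = x" "last xs = y" "distinct xs"
    "successively (\<lambda>u v. (u, v) \<in> adj \<omega> S) xs" "set xs \<subseteq> (adj \<omega> S)\<^sup>* `` {x}"
    by (rule rtrancl_distinct_path)
  moreover from this(5) have "successively (\<lambda>u v. {u, v} \<in> \<omega>) xs"
    by (rule successively_mono) (auto simp: adj_def)
  ultimately show thesis using that by (auto simp: cluster_def Image_singleton)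
qed

definition path_edges :: "'v list \<Rightarrow> 'v set set" where
  "path_edges xs = {{xs ! i, xs ! Suc i} | i. Suc i < length xs}"

lemma in_path_edges:
  "{u, v} \<in> path_edges xs \<longleftrightarrow> (\<exists>i. Suc i < length xs \<and>
     (u = xs ! i \<and> v = xs ! Suc i \<or> u = xs ! Suc i \<and> v = xs ! i))"
  by (auto simp: path_edges_def doubleton_eq_iff)

lemma path_edges_subset_iff:
  "path_edges xs \<subseteq> E \<longleftrightarrow> successively (\<lambda>u v. {u, v} \<in> E) xs"
  by (auto simp: path_edges_def successively_conv_nth)

lemma finite_path_edges: "finite (path_edges xs)"
proof -
  have "path_edges xs \<subseteq> (\<lambda>i. {xs ! i, xs ! Suc i}) ` {..<length xs}"
    by (auto simp: path_edges_def)
  then show ?thesis using finite_subset by blast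
qed

lemma path_edges_subset_Pow: "e \<in> path_edges xs \<Longrightarrow> e \<subseteq> set xs"
  by (auto simp: path_edges_def)

lemma nbrs_path_edges:
  assumes "distinct xs" "i < length xs"
  shows "nbrs (path_edges xs) (xs ! i) \<subseteq>
    (if i = 0 then {} else {xs ! (i - 1)}) \<union> (if Suc i < length xs then {xs ! Suc i} else {})"
proof
  fix v assume "v \<in> nbrs (path_edges xs) (xs ! i)"
  then have "{v, xs ! i} \<in> path_edges xs" by (simp add: nbrs_def)
  then obtain j where j: "Suc j < length xs"
    "v = xs ! j \<and> xs ! i = xs ! Suc j \<or> v = xs ! Suc j \<and> xs ! i = xs ! j"
    using in_path_edges by metis
  from j(2) show "v \<in> (if i = 0 then {} else {xs ! (i - 1)}) \<union> (if Suc i < length xs then {xs ! Suc i} else {})"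
  proof
    assume "v = xs ! j \<and> xs ! i = xs ! Suc j"
    moreover from this have "i = Suc j" using assms j(1) by (simp add: nth_eq_iff_index_eq)
    ultimately show ?thesis by simp
  next
    assume "v = xs ! Suc j \<and> xs ! i = xs ! j"
    moreover from this have "i = j" using assms j(1) by (simp add: nth_eq_iff_index_eq)
    ultimately show ?thesis using j(1) by simp
  qed
qed

lemma nbrs_path_edges_outside: "v \<notin> set xs \<Longrightarrow> nbrs (path_edges xs) v = {}"
  using path_edges_subset_Pow by (fastforce simp: nbrs_def)

lemma path_in_cluster:
  assumes "path_edges xs \<subseteq> \<omega>" "set xs \<inter> S = {}" "j < length xs"
  shows "xs ! j \<in> cluster \<omega> S (xs ! 0)"
  using assms(3)
proof (induction j)
  case (Suc j)
  then have "xs ! j \<in> cluster \<omega> S (xs ! 0)" by simp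
  moreover have "{xs ! j, xs ! Suc j} \<in> \<omega>" using assms(1) Suc.prems by (auto simp: path_edges_def)
  moreover have "xs ! j \<in> set xs" "xs ! Suc j \<in> set xs" using Suc.prems by simp_all
  then have "xs ! j \<notin> S" "xs ! Suc j \<notin> S" using assms(2) by auto
  ultimately show ?case by (rule cluster_step)
qed simp

text \<open>A simple path joins the first two ends, and a path from the third is stopped at its
  first vertex \<open>c\<close> on it. Arms are listed without \<open>c\<close>, so an arm is empty
  if its end is \<open>c\<close>; this admits coinciding ends.\<close>

lemma tripod_exists:
  assumes conn: "\<And>x y. x \<in> \<Lambda> \<Longrightarrow> y \<in> \<Lambda> \<Longrightarrow> y \<in> cluster E (- \<Lambda>) x"
    and y: "y\<^sub>1 \<in> \<Lambda>" "y\<^sub>2 \<in> \<Lambda>" "y\<^sub>3 \<in> \<Lambda>"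
  obtains c M\<^sub>1 M\<^sub>2 M\<^sub>3 where "c \<in> \<Lambda>"
    "set M\<^sub>1 \<union> set M\<^sub>2 \<union> set M\<^sub>3 \<subseteq> \<Lambda> - {c}" "distinct (M\<^sub>1 @ M\<^sub>2 @ M\<^sub>3)"
    "hd (M\<^sub>1 @ [c]) = y\<^sub>1" "hd (M\<^sub>2 @ [c]) = y\<^sub>2" "hd (M\<^sub>3 @ [c]) = y\<^sub>3"
    "successively (\<lambda>u v. {u, v} \<in> E) (M\<^sub>1 @ [c])" "successively (\<lambda>u v. {u, v} \<in> E) (M\<^sub>2 @ [c])"
    "successively (\<lambda>u v. {u, v} \<in> E) (M\<^sub>3 @ [c])"
proof -
  obtain zs where zs: "zs \<noteq> []" "hd zs = y\<^sub>1" "last zs = y\<^sub>2" "distinct zs"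
    "successively (\<lambda>u v. {u, v} \<in> E) zs" "set zs \<subseteq> cluster E (- \<Lambda>) y\<^sub>1"
    using cluster_path[OF conn[OF y(1,2)]] .
  have "cluster E (- \<Lambda>) y\<^sub>1 \<subseteq> \<Lambda>" using cluster_avoids[of _ E "- \<Lambda>" y\<^sub>1] y(1) by auto
  with zs(6) have zs\<Lambda>: "set zs \<subseteq> \<Lambda>" by auto
  have "\<exists>M c. c \<in> set zs \<and> set M \<subseteq> \<Lambda> - set zs \<and> distinct M \<and> hd (M @ [c]) = y\<^sub>3 \<and>
    successively (\<lambda>u v. {u, v} \<in> E) (M @ [c])"
  proof (cases "y\<^sub>3 \<in> set zs")
    case True then show ?thesis by (intro exI[of _ "[]"] exI[of _ y\<^sub>3]) auto
  next
    case False
    have "y\<^sub>1 \<in> set zs" using zs(1,2) by auto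
    with cluster_first_hit[OF conn[OF y(3,1)] False]
    obtain b c where b: "b \<in> cluster E (- \<Lambda> \<union> set zs) y\<^sub>3" "c \<in> set zs" "{b, c} \<in> E" by blast
    obtain ws where ws: "ws \<noteq> []" "hd ws = y\<^sub>3" "last ws = b" "distinct ws"
      "successively (\<lambda>u v. {u, v} \<in> E) ws" "set ws \<subseteq> cluster E (- \<Lambda> \<union> set zs) y\<^sub>3"
      using cluster_path[OF b(1)] .
    have "set ws \<subseteq> \<Lambda> - set zs"
      using ws(6) cluster_avoids[of _ E "- \<Lambda> \<union> set zs" y\<^sub>3] y(3) False by blast
    then show ?thesis using ws b
      by (intro exI[of _ ws] exI[of _ c]) (auto simp: successively_append_iff)
  qed
  then obtain M\<^sub>3 c where M3: "c \<in> set zs" "set M\<^sub>3 \<subseteq> \<Lambda> - set zs" "distinct M\<^sub>3" "hd (M\<^sub>3 @ [c]) = y\<^sub>3"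
    "successively (\<lambda>u v. {u, v} \<in> E) (M\<^sub>3 @ [c])" by blast
  obtain A B where AB: "zs = A @ c # B" using M3(1) by (auto dest: split_list)
  show thesis
  proof (rule that[of c A "rev B" M\<^sub>3])
    show "hd (A @ [c]) = y\<^sub>1" using zs(2) AB by (cases A) auto
    show "hd (rev B @ [c]) = y\<^sub>2" using zs(3) AB by (cases B rule: rev_cases) auto
    show "successively (\<lambda>u v. {u, v} \<in> E) (A @ [c])"
      using zs(5) AB by (auto simp: successively_append_iff)
    have "successively (\<lambda>u v. {u, v} \<in> E) (c # B)"
      using zs(5) AB by (auto simp: successively_append_iff)
    then have "successively (\<lambda>u v. {v, u} \<in> E) (c # B)" by (simp add: insert_commute)
    then have "successively (\<lambda>u v. {u, v} \<in> E) (rev (c # B))" by (simp only: successively_rev)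
    then show "successively (\<lambda>u v. {u, v} \<in> E) (rev B @ [c])" by simp
  qed (use M3 AB zs zs\<Lambda> in auto)
qed

subsection \<open>Joining clusters inside a finite region\<close>

text \<open>The region \<Lambda> is cut out of \<omega>, and the feet \<open>a i\<close>, which lie
  in different clusters outside, are joined to a centre \<open>c\<close> by arms through \<Lambda>.
  \<open>card_I\<close> bounds the degree at \<open>c\<close> and \<open>k2\<close> that at inner
  vertices of arms; by \<open>attached\<close> the cut frees a slot at each foot, which its arm then
  takes. \<open>I\<close> has two elements when clusters are merged, three when a trifurcation is
  made.\<close>

locale star =
  fixes \<omega> :: "'v set set" and \<Lambda> :: "'v set" and k :: nat and I :: "nat set"
    and a :: "nat \<Rightarrow> 'v" and M :: "nat \<Rightarrow> 'v list" and c :: 'v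
  assumes finite_I: "finite I" and card_I: "card I \<le> k" and k2: "2 \<le> k"
    and c: "c \<in> \<Lambda>" and a: "i \<in> I \<Longrightarrow> a i \<notin> \<Lambda>"
    and M: "i \<in> I \<Longrightarrow> set (M i) \<subseteq> \<Lambda> - {c}" and distinct_M: "i \<in> I \<Longrightarrow> distinct (M i)"
    and disjoint_M: "i \<in> I \<Longrightarrow> j \<in> I \<Longrightarrow> i \<noteq> j \<Longrightarrow> set (M i) \<inter> set (M j) = {}"
    and deg: "finite (nbrs \<omega> u)" "card (nbrs \<omega> u) \<le> k"
    and attached: "i \<in> I \<Longrightarrow> \<exists>s\<in>\<Lambda>. {a i, s} \<in> \<omega>"
    and separated: "i \<in> I \<Longrightarrow> j \<in> I \<Longrightarrow> i \<noteq> j \<Longrightarrow> a j \<notin> cluster \<omega> \<Lambda> (a i)"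
    and fin_\<Lambda>: "finite \<Lambda>"
begin

definition arm :: "nat \<Rightarrow> 'v list" where
  "arm i = a i # M i @ [c]"

definition base :: "'v set set" where
  "base = {e \<in> \<omega>. e \<inter> \<Lambda> = {}}"

definition joined :: "'v set set" where
  "joined = base \<union> (\<Union>i\<in>I. path_edges (arm i))"

lemma distinct_arm: "i \<in> I \<Longrightarrow> distinct (arm i)"
  using M[of i] a[of i] distinct_M[of i] c by (auto simp: arm_def)

lemma a_inj: "i \<in> I \<Longrightarrow> j \<in> I \<Longrightarrow> a i = a j \<Longrightarrow> i = j"
  using separated[of i j] cluster_refl[of "a i" \<omega> \<Lambda>] by auto

text \<open>Removal of the vertices of \<Lambda> is realised by a configuration, so statements on
  \<open>cluster \<omega> \<Lambda>\<close> become statements on a local modification of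
  \<omega>.\<close>

lemma cluster_base: "cluster base {} x = cluster \<omega> \<Lambda> x"
  by (auto simp: cluster_def adj_def base_def intro!: arg_cong[where f = "\<lambda>R. R\<^sup>*"])

lemma base_joined: "base \<subseteq> joined" and path_joined: "i \<in> I \<Longrightarrow> path_edges (arm i) \<subseteq> joined"
  by (auto simp: joined_def)

lemma nbrs_joined: "nbrs joined u = nbrs base u \<union> (\<Union>i\<in>I. nbrs (path_edges (arm i)) u)"
  by (auto simp: joined_def nbrs_def)

lemma nbrs_base: "nbrs base u \<subseteq> nbrs \<omega> u" "u \<in> \<Lambda> \<Longrightarrow> nbrs base u = {}"
  by (auto simp: base_def nbrs_def)

lemma card_nbrs_joined: "card (nbrs joined u) \<le> k"
proof -
  consider (centre) "u = c" | (inner) i where "i \<in> I" "u \<in> set (M i)" | (foot) i where "i \<in> I" "u = a i"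
    | (other) "\<And>i. i \<in> I \<Longrightarrow> u \<notin> set (arm i)"
    by (auto simp: arm_def)
  then show ?thesis
  proof cases
    case centre
    \<comment> \<open>In \<open>arm i\<close> the centre has the last index,
      \<open>Suc (length (M i))\<close>, so its only neighbour there is the entry before.\<close>
    have "nbrs (path_edges (arm i)) u \<subseteq> {arm i ! length (M i)}" if "i \<in> I" for i
      using nbrs_path_edges[OF distinct_arm[OF that], of "Suc (length (M i))"] centre
      by (simp add: arm_def nth_append)
    then have "nbrs joined u \<subseteq> (\<lambda>i. arm i ! length (M i)) ` I"
      using nbrs_base(2)[of u] c centre unfolding nbrs_joined by auto
    then have "card (nbrs joined u) \<le> card I" using finite_I surj_card_le by blast
    then show ?thesis using card_I by simp
  next
    case (inner i)
    have "u \<notin> set (arm j)" if "j \<in> I" "j \<noteq> i" for j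
      using inner that disjoint_M[of i j] M[of i] a[of j]
      by (auto simp: arm_def)
    then have "nbrs (path_edges (arm j)) u = {}" if "j \<in> I" "j \<noteq> i" for j
      using that nbrs_path_edges_outside by metis
    moreover have "u \<in> \<Lambda>" using inner M[of i] by auto
    ultimately have *: "nbrs joined u \<subseteq> nbrs (path_edges (arm i)) u"
      unfolding nbrs_joined using nbrs_base(2)[of u] by blast
    obtain j where j: "j < length (arm i)" "u = arm i ! j"
      using inner by (metis arm_def in_set_conv_nth list.set_intros(2) Un_iff set_append)
    from nbrs_path_edges[OF distinct_arm[OF inner(1)] j(1)] *
    have "nbrs joined u \<subseteq> {arm i ! (j - 1), arm i ! Suc j}" using j(2) by (auto split: if_splits)
    then have "card (nbrs joined u) \<le> card {arm i ! (j - 1), arm i ! Suc j}" by (intro card_mono) auto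
    also have "\<dots> \<le> 2" by (simp add: card_insert_if)
    finally show ?thesis using k2 by simp
  next
    case (foot i)
    have "u \<notin> set (arm j)" if "j \<in> I" "j \<noteq> i" for j
      using foot that a_inj[of i j] M[of j] a[of i] c by (auto simp: arm_def)
    then have "nbrs (path_edges (arm j)) u = {}" if "j \<in> I" "j \<noteq> i" for j
      using that nbrs_path_edges_outside by metis
    moreover have "nbrs (path_edges (arm i)) u \<subseteq> {arm i ! 1}"
      using nbrs_path_edges[OF distinct_arm[OF foot(1)], of 0] foot(2) by (simp add: arm_def)
    ultimately have *: "nbrs joined u \<subseteq> insert (arm i ! 1) (nbrs base u)"
      unfolding nbrs_joined by auto
    \<comment> \<open>The open edge from the foot into \<Lambda> is lost in \<open>base\<close>,
      which makes room for the first edge of the arm.\<close>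
    obtain s where s: "s \<in> \<Lambda>" "{u, s} \<in> \<omega>" using attached foot by metis
    then have "nbrs base u \<subset> nbrs \<omega> u"
      using nbrs_base(1)[of u] by (auto simp: base_def nbrs_def insert_commute)
    then have "card (nbrs base u) < k" using deg psubset_card_mono by (metis order_less_le_trans)
    moreover have "finite (nbrs base u)" using deg(1) nbrs_base(1) finite_subset by metis
    ultimately show ?thesis
      using card_mono[OF _ *] card_insert_if[of "nbrs base u" "arm i ! 1"] by (auto split: if_splits)
  next
    case other
    then have "nbrs joined u = nbrs base u" by (auto simp: nbrs_joined nbrs_path_edges_outside)
    then show ?thesis using card_mono[OF deg(1) nbrs_base(1)] deg(2) order_trans by metis
  qed
qed

text \<open>Without \<open>c\<close> the arms fall apart: each meets the outside of \<Lambda> only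
  in its own foot, and no edge of \<open>base\<close> touches \<Lambda>.\<close>

lemma branch_subset:
  assumes i: "i \<in> I"
  shows "cluster joined {c} (a i) \<subseteq> cluster \<omega> \<Lambda> (a i) \<union> set (M i)"
proof (rule cluster_closed)
  fix u v
  assume u: "u \<in> cluster \<omega> \<Lambda> (a i) \<union> set (M i)" and uv: "{u, v} \<in> joined" "u \<notin> {c}" "v \<notin> {c}"
  have out: "x \<notin> \<Lambda>" if "x \<in> cluster \<omega> \<Lambda> (a i)" for x
    using that cluster_avoids[of x \<omega> \<Lambda> "a i"] a[OF i] by simp
  show "v \<in> cluster \<omega> \<Lambda> (a i) \<union> set (M i)"
  proof (cases "{u, v} \<in> base")
    case True
    then have "{u, v} \<in> \<omega>" "u \<notin> \<Lambda>" "v \<notin> \<Lambda>" by (auto simp: base_def)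
    moreover from this have "u \<in> cluster \<omega> \<Lambda> (a i)" using u M[OF i] by auto
    ultimately show ?thesis using cluster_step[of u \<omega> \<Lambda> "a i" v] by simp
  next
    case False
    then obtain j where j: "j \<in> I" "{u, v} \<in> path_edges (arm j)" using uv(1) by (auto simp: joined_def)
    then have "u \<in> set (arm j)" "v \<in> set (arm j)" using path_edges_subset_Pow by blast+
    then have *: "u = a j \<or> u \<in> set (M j)" "v = a j \<or> v \<in> set (M j)" using uv by (auto simp: arm_def)
    have "j = i"
    proof (rule ccontr)
      assume "j \<noteq> i"
      then show False
        using u *(1) separated[OF i j(1)] disjoint_M[OF i j(1)] out[of u] a[OF j(1)] M[OF j(1)] M[OF i]
        by blast
    qed
    then show ?thesis using *(2) by auto
  qed
qed simp

lemma branch_supset: "i \<in> I \<Longrightarrow> cluster \<omega> \<Lambda> (a i) \<subseteq> cluster joined {c} (a i)"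
proof -
  assume i: "i \<in> I"
  have "cluster \<omega> \<Lambda> (a i) \<inter> {c} = {}" using cluster_avoids[of c \<omega> \<Lambda> "a i"] a[OF i] c by auto
  then have "cluster base {c} (a i) = cluster \<omega> \<Lambda> (a i)"
    using cluster_enlarge[of "{}" "{c}" base "a i"] cluster_base[of "a i"] by simp
  then show ?thesis using cluster_mono[OF base_joined, of "{c}" "{c}" "a i"] by simp
qed

lemma branch_separated: "i \<in> I \<Longrightarrow> j \<in> I \<Longrightarrow> i \<noteq> j \<Longrightarrow> a j \<notin> cluster joined {c} (a i)"
  using branch_subset[of i] separated[of i j] a[of j] M[of i] by blast

text \<open>The neighbour of \<open>c\<close> on the arm, which is the foot itself if
  \<open>M i\<close> is empty. Trifurcations are phrased with neighbours of \<open>c\<close>,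
  separation with feet.\<close>

definition "tip i = last (a i # M i)"

lemma tip_edge: "i \<in> I \<Longrightarrow> {c, tip i} \<in> joined"
proof -
  assume "i \<in> I"
  moreover have "{arm i ! length (M i), arm i ! Suc (length (M i))} \<in> path_edges (arm i)"
    by (auto simp: path_edges_def arm_def)
  moreover have "arm i ! length (M i) = tip i"
    by (cases "M i" rule: rev_cases) (auto simp: arm_def tip_def nth_append)
  moreover have "arm i ! Suc (length (M i)) = c" by (simp add: arm_def nth_append)
  ultimately show ?thesis using path_joined by (auto simp: insert_commute)
qed

lemma path_edges_take: "path_edges xs \<subseteq> path_edges (xs @ ys)"
  unfolding path_edges_def by (force simp: nth_append)

lemma arm_cluster: "i \<in> I \<Longrightarrow> x \<in> set (a i # M i) \<Longrightarrow> x \<in> cluster joined {c} (a i)"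
proof -
  assume i: "i \<in> I" and x: "x \<in> set (a i # M i)"
  obtain j where "j < length (a i # M i)" "x = (a i # M i) ! j" using x by (metis in_set_conv_nth)
  moreover have "path_edges (a i # M i) \<subseteq> joined"
    using path_edges_take[of "a i # M i" "[c]"] path_joined[OF i] by (simp add: arm_def)
  moreover have "set (a i # M i) \<inter> {c} = {}" using M[OF i] a[OF i] c by auto
  ultimately show ?thesis using path_in_cluster[of "a i # M i" joined "{c}" j] by simp
qed

lemma tip_cluster: "i \<in> I \<Longrightarrow> cluster joined {c} (tip i) = cluster joined {c} (a i)"
  by (intro cluster_eq arm_cluster) (auto simp: tip_def)

lemma center_cluster:
  assumes "i \<in> I" "x \<in> set (arm i)"
  shows "c \<in> cluster joined {} x"
proof -
  have *: "y \<in> cluster joined {} (a i)" if y: "y \<in> set (arm i)" for y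
  proof -
    obtain j where "j < length (arm i)" "y = arm i ! j" using y by (auto simp: in_set_conv_nth)
    then show ?thesis
      using path_in_cluster[of "arm i" joined "{}" j] path_joined[OF assms(1)] by (simp add: arm_def)
  qed
  have "c \<in> set (arm i)" by (simp add: arm_def)
  from *[OF this] *[OF assms(2)] show ?thesis using cluster_sym cluster_trans by metis
qed

lemma trifurcation_joined:
  assumes "I = {..<3}" and inf: "\<And>i. i \<in> I \<Longrightarrow> infinite (cluster \<omega> \<Lambda> (a i))"
  shows "trifurcation joined c"
proof -
  have I: "0 \<in> I" "1 \<in> I" "2 \<in> I" using assms(1) by auto
  have inf': "infinite (cluster joined {c} (tip i))" if "i \<in> I" for i
    using inf[OF that] branch_supset[OF that] tip_cluster[OF that] finite_subset by metis
  have sep': "tip j \<notin> cluster joined {c} (tip i)" if "i \<in> I" "j \<in> I" "i \<noteq> j" for i j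
  proof
    assume "tip j \<in> cluster joined {c} (tip i)"
    then have "cluster joined {c} (a j) = cluster joined {c} (a i)"
      using cluster_eq tip_cluster that by metis
    then show False using branch_separated[OF that] cluster_refl by metis
  qed
  show ?thesis
    unfolding trifurcation_def
    by (rule exI[of _ "tip 0"], rule exI[of _ "tip 1"], rule exI[of _ "tip 2"])
      (use I in \<open>simp add: tip_edge inf' sep' del: One_nat_def\<close>)
qed

text \<open>A cluster of \<open>joined\<close> without \<open>c\<close> touches no arm, so it is
  connected within \<open>base\<close>. If it were infinite, it would contain a foot by
  \<open>only\<close>, and feet lie on arms.\<close>

lemma infinite_clusters_joined:
  assumes only: "\<And>y. infinite (cluster base {} y) \<Longrightarrow> \<exists>i\<in>I. a i \<in> cluster base {} y"
    and inf: "infinite (cluster joined {} x)"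
  shows "c \<in> cluster joined {} x"
proof (rule ccontr)
  assume *: "c \<notin> cluster joined {} x"
  have arms: "y \<notin> set (arm i)" if "i \<in> I" "y \<in> cluster joined {} x" for i y
    using center_cluster[OF that(1)] cluster_trans[OF that(2)] * by blast
  have "cluster joined {} x \<subseteq> cluster base {} x"
  proof
    fix y assume "y \<in> cluster joined {} x"
    then show "y \<in> cluster base {} x"
    proof (induction rule: cluster_induct)
      case (step y z)
      then have "{y, z} \<notin> path_edges (arm i)" if "i \<in> I" for i
        using arms[OF that] path_edges_subset_Pow[of "{y, z}" "arm i"] by auto
      with step(2) have "{y, z} \<in> base" by (auto simp: joined_def)
      then show ?case using step(5) cluster_step[of y base "{}" x z] by simp
    qed simp
  qed
  then have "infinite (cluster base {} x)" using inf finite_subset by blast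
  then obtain i where "i \<in> I" "a i \<in> cluster base {} x" using only by blast
  moreover from this have "a i \<in> cluster joined {} x"
    using cluster_mono[OF base_joined, of "{}" "{}" x] by auto
  ultimately show False using arms[of i "a i"] by (simp add: arm_def)
qed

end

subsection \<open>The lattice\<close>

lemma lattice_edge_iff: "{u, v} \<in> lattice_edges \<longleftrightarrow> (\<Sum>i\<in>UNIV. \<bar>u $ i - v $ i\<bar>) = 1"
proof
  assume "{u, v} \<in> lattice_edges"
  then obtain x y :: "int ^ 'a" where "{u, v} = {x, y}" "(\<Sum>i\<in>UNIV. \<bar>x $ i - y $ i\<bar>) = 1"
    by (auto simp: lattice_edges_def)
  then show "(\<Sum>i\<in>UNIV. \<bar>u $ i - v $ i\<bar>) = 1"
    by (auto simp: doubleton_eq_iff abs_minus_commute)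
qed (auto simp: lattice_edges_def)

lemma lattice_edgeE:
  assumes "e \<in> lattice_edges" "u \<in> e"
  obtains v where "e = {v, u}" "v \<noteq> u"
proof -
  obtain x y where xy: "e = {x, y}" "(\<Sum>i\<in>UNIV. \<bar>x $ i - y $ i\<bar>) = 1"
    using assms(1) by (auto simp: lattice_edges_def)
  then have "x \<noteq> y" by auto
  then show thesis using that[of x] that[of y] xy(1) assms(2) by auto
qed

lemma lattice_edge_finite: "e \<in> lattice_edges \<Longrightarrow> finite e \<and> e \<noteq> {}"
  by (auto simp: lattice_edges_def)

definition cube :: "nat \<Rightarrow> (int ^ 'd) set" where
  "cube n = {v. \<forall>i. \<bar>v $ i\<bar> \<le> int n}"

lemma bij_betw_cube: "bij_betw vec_nth (cube n :: (int ^ 'd::finite) set) (UNIV \<rightarrow>\<^sub>E {- int n..int n})"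
proof (rule bij_betwI[where g = vec_lambda])
  show "vec_nth \<in> (cube n :: (int ^ 'd) set) \<rightarrow> (UNIV \<rightarrow>\<^sub>E {- int n..int n})"
    unfolding cube_def by (rule Pi_I, rule PiE_I) (simp_all add: abs_le_iff minus_le_iff)
  show "vec_lambda \<in> (UNIV \<rightarrow>\<^sub>E {- int n..int n}) \<rightarrow> (cube n :: (int ^ 'd) set)"
    unfolding cube_def by (rule Pi_I) (simp add: PiE_iff abs_le_iff minus_le_iff)
qed (simp_all add: fun_eq_iff)

lemma finite_cube [simp]: "finite (cube n :: (int ^ 'd::finite) set)"
  using bij_betw_finite[OF bij_betw_cube[of n, where 'd = 'd]] by (simp add: finite_PiE)

lemma card_cube: "card (cube n :: (int ^ 'd::finite) set) = (2 * n + 1) ^ CARD('d)"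
proof -
  have "nat (2 * int n + 1) = 2 * n + 1" by simp
  then show ?thesis
    using bij_betw_same_card[OF bij_betw_cube[of n, where 'd = 'd]] by (simp add: card_PiE)
qed

lemma cube_mono: "m \<le> n \<Longrightarrow> cube m \<subseteq> cube n"
  unfolding cube_def by (intro Collect_mono impI allI) (meson of_nat_mono order_trans)

lemma in_some_cube: "\<exists>n. v \<in> (cube n :: (int ^ 'd::finite) set)"
proof -
  have "\<bar>v $ i\<bar> \<le> int (nat (\<Sum>j\<in>UNIV. \<bar>v $ j\<bar>))" for i
    using member_le_sum[of i UNIV "\<lambda>j. \<bar>v $ j\<bar>"] by simp
  then show ?thesis unfolding cube_def by blast
qed

lemma finite_subset_cube:
  fixes W :: "(int ^ 'd::finite) set"
  assumes "finite W"
  obtains n where "W \<subseteq> cube n"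
  using assms
proof (induction W arbitrary: thesis)
  case (insert v W)
  obtain n m where "W \<subseteq> cube n" "v \<in> cube m" using insert.IH in_some_cube by metis
  then have "insert v W \<subseteq> cube (max m n)"
    using cube_mono[of n "max m n"] cube_mono[of m "max m n"] by auto
  then show ?case by (rule insert.prems)
qed auto

lemma cube_boundary:
  assumes "u \<in> cube n" "{u, v} \<in> lattice_edges"
  shows "v \<in> cube (Suc n)"
proof -
  have "\<bar>u $ i - v $ i\<bar> \<le> 1" for i
    using assms(2) member_le_sum[of i UNIV "\<lambda>j. \<bar>u $ j - v $ j\<bar>"] by (simp add: lattice_edge_iff)

  then have "\<bar>v $ i\<bar> \<le> int (Suc n)" for i
  proof -
    have "\<bar>u $ i\<bar> \<le> int n" using assms(1) by (simp add: cube_def)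
    with \<open>\<And>i. \<bar>u $ i - v $ i\<bar> \<le> 1\<close>[of i] show ?thesis by simp
  qed
  then show ?thesis by (simp add: cube_def)
qed

lemma finite_nbrs_lattice: "finite (nbrs lattice_edges (u :: int ^ 'd::finite))"
proof -
  obtain n where "u \<in> cube n" using in_some_cube by blast
  then have "nbrs lattice_edges u \<subseteq> cube (Suc n)"
    using cube_boundary[of u n] by (auto simp: nbrs_def insert_commute)
  then show ?thesis using finite_cube by (rule finite_subset)
qed

lemma finite_nbrs: "\<omega> \<subseteq> lattice_edges \<Longrightarrow> finite (nbrs \<omega> (u :: int ^ 'd::finite))"
  using finite_subset[OF _ finite_nbrs_lattice[of u], of "nbrs \<omega> u"] by (auto simp: nbrs_def)

lemma finite_lattice_edges_meeting:
  assumes "finite W"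
  shows "finite {e \<in> lattice_edges. e \<inter> W \<noteq> {}}"
proof -
  have "{e \<in> lattice_edges. e \<inter> W \<noteq> {}} \<subseteq> (\<Union>u\<in>W. (\<lambda>v. {v, u}) ` nbrs lattice_edges u)"
  proof
    fix e assume "e \<in> {e \<in> lattice_edges. e \<inter> W \<noteq> {}}"
    then obtain u where u: "e \<in> lattice_edges" "u \<in> e" "u \<in> W" by auto
    from lattice_edgeE[OF u(1,2)] obtain v where "e = {v, u}" by metis
    then show "e \<in> (\<Union>u\<in>W. (\<lambda>v. {v, u}) ` nbrs lattice_edges u)" using u by (auto simp: nbrs_def)
  qed
  then show ?thesis by (rule finite_subset) (use assms finite_nbrs_lattice in auto)
qed

text \<open>Moving a nonzero coordinate one step towards 0 lowers the l1-norm and stays in the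
  cube.\<close>

lemma cluster_cube:
  assumes "x \<in> (cube n :: (int ^ 'd::finite) set)"
  shows "x \<in> cluster lattice_edges (- cube n) 0"
  using assms
proof (induction "nat (\<Sum>i\<in>UNIV. \<bar>x $ i\<bar>)" arbitrary: x rule: less_induct)
  case less
  show ?case
  proof (cases "x = 0")
    case False
    then obtain j where j: "x $ j \<noteq> 0" by (auto simp: vec_eq_iff)
    define y where "y = (\<chi> i. if i = j then x $ i - sgn (x $ i) else x $ i)"
    have abs_y: "\<bar>y $ i\<bar> = (if i = j then \<bar>x $ i\<bar> - 1 else \<bar>x $ i\<bar>)" for i
      using j by (auto simp: y_def sgn_if)
    have "(\<Sum>i\<in>UNIV. \<bar>y $ i\<bar>) = (\<Sum>i\<in>UNIV. \<bar>x $ i\<bar> + (if i = j then - 1 else 0))"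
      by (intro sum.cong) (auto simp: abs_y)
    also have "\<dots> = (\<Sum>i\<in>UNIV. \<bar>x $ i\<bar>) - 1" by (simp add: sum.distrib sum.delta)
    finally have "(\<Sum>i\<in>UNIV. \<bar>y $ i\<bar>) = (\<Sum>i\<in>UNIV. \<bar>x $ i\<bar>) - 1" .
    moreover have "(\<Sum>i\<in>UNIV. \<bar>y $ i\<bar>) \<ge> 0" by (intro sum_nonneg) auto
    ultimately have lt: "nat (\<Sum>i\<in>UNIV. \<bar>y $ i\<bar>) < nat (\<Sum>i\<in>UNIV. \<bar>x $ i\<bar>)" by linarith
    have "\<bar>y $ i\<bar> \<le> int n" for i
      using less.prems abs_y[of i] unfolding cube_def by (auto split: if_splits dest: spec[of _ i])
    then have y: "y \<in> cube n" by (simp add: cube_def)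
    have "(\<Sum>i\<in>UNIV. \<bar>y $ i - x $ i\<bar>) = (\<Sum>i\<in>UNIV. if i = j then 1 else 0)"
      using j by (intro sum.cong) (auto simp: y_def sgn_if)
    then have "{y, x} \<in> lattice_edges" by (simp add: lattice_edge_iff)
    then show ?thesis using less.hyps[OF lt y] y less.prems cluster_step[of y lattice_edges "- cube n" 0 x] by simp
  qed simp
qed

lemma cube_connected:
  "x \<in> (cube n :: (int ^ 'd::finite) set) \<Longrightarrow> y \<in> cube n \<Longrightarrow> y \<in> cluster lattice_edges (- cube n) x"
  using cluster_cube cluster_sym cluster_trans by metis

subsection \<open>The configuration as the solution of a fixed-point equation\<close>

text \<open>Counting strictly earlier open edges gives the degree just before \<open>U e\<close>, so
  the conditions at all earlier times become a single one.\<close>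

definition admits :: "nat \<Rightarrow> ('d edge \<Rightarrow> real) \<Rightarrow> 'd::finite edge set \<Rightarrow> 'd edge \<Rightarrow> bool" where
  "admits k U A e \<longleftrightarrow> (\<forall>u\<in>e. card {x. {x, u} \<in> A \<and> U {x, u} < U e} < k)"

definition stable :: "nat \<Rightarrow> real \<Rightarrow> ('d edge \<Rightarrow> real) \<Rightarrow> 'd::finite edge set \<Rightarrow> bool" where
  "stable k t U A \<longleftrightarrow> (\<forall>e. e \<in> A \<longleftrightarrow> e \<in> lattice_edges \<and> U e \<le> t \<and> admits k U A e)"

text \<open>\<open>admits\<close> is antitone in \<open>A\<close>, so the iterates lie alternately
  above and below a solution instead of converging monotonically. Hence \<open>config\<close> takes
  the edges that are eventually in.\<close>

primrec approx :: "nat \<Rightarrow> real \<Rightarrow> ('d edge \<Rightarrow> real) \<Rightarrow> nat \<Rightarrow> 'd::finite edge set" where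
  "approx k t U 0 = lattice_edges"
| "approx k t U (Suc n) = {e \<in> lattice_edges. U e \<le> t \<and> admits k U (approx k t U n) e}"

definition config :: "nat \<Rightarrow> real \<Rightarrow> ('d edge \<Rightarrow> real) \<Rightarrow> 'd::finite edge set" where
  "config k t U = {e. \<exists>N. \<forall>n\<ge>N. e \<in> approx k t U n}"

text \<open>Well-foundedness makes the recursion along earlier adjacent edges terminate. Injectivity
  serves the degree bound: \<open>admits\<close> does not count equal clocks, so ties at a vertex
  could push its degree beyond \<open>k\<close>.\<close>

definition regular :: "('d::finite edge \<Rightarrow> real) \<Rightarrow> bool" where
  "regular U \<longleftrightarrow> (\<forall>e\<in>lattice_edges. 0 < U e) \<and> inj_on U lattice_edges \<and>
     wf {(f, e). f \<in> lattice_edges \<and> e \<in> lattice_edges \<and> f \<inter> e \<noteq> {} \<and> U f < U e}"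

lemma approx_subset: "approx k t U n \<subseteq> lattice_edges"
  by (cases n) auto

lemma config_subset: "config k t U \<subseteq> lattice_edges"
  using approx_subset by (fastforce simp: config_def)

lemma stable_subset: "stable k t U A \<Longrightarrow> A \<subseteq> lattice_edges"
  by (auto simp: stable_def)

lemma admits_cong:
  assumes "\<And>f. f \<inter> e \<noteq> {} \<Longrightarrow> U f < U e \<Longrightarrow> f \<in> A \<longleftrightarrow> f \<in> B"
  shows "admits k U A e \<longleftrightarrow> admits k U B e"
proof -
  have "{x. {x, u} \<in> A \<and> U {x, u} < U e} = {x. {x, u} \<in> B \<and> U {x, u} < U e}" if "u \<in> e" for u
  proof -
    have "{x, u} \<inter> e \<noteq> {}" for x using that by simp
    then have "{x, u} \<in> A \<and> U {x, u} < U e \<longleftrightarrow> {x, u} \<in> B \<and> U {x, u} < U e" for x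
      using assms[of "{x, u}"] by (simp only: not_False_eq_True) metis
    then show ?thesis by simp
  qed
  then show ?thesis by (simp add: admits_def)
qed

text \<open>Well-founded recursion: once the finitely many adjacent edges with earlier clocks have
  settled, \<open>e\<close> settles one iterate later.\<close>

lemma stable_config:
  assumes "regular U"
  shows "stable k t U (config k t U)"
proof -
  let ?R = "{(f, e). f \<in> lattice_edges \<and> e \<in> lattice_edges \<and> f \<inter> e \<noteq> {} \<and> U f < U e}"
  have wf: "wf ?R" using assms by (simp add: regular_def)
  have "\<exists>N. \<forall>n\<ge>N. e \<in> approx k t U n \<longleftrightarrow> e \<in> config k t U" if "e \<in> lattice_edges" for e
    using wf that
  proof (induction e rule: wf_induct_rule)
    case (less e)
    define D where "D = {f \<in> lattice_edges. f \<inter> e \<noteq> {}}"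
    have "finite D" unfolding D_def using lattice_edge_finite less.prems by (intro finite_lattice_edges_meeting) auto
    have "\<forall>f\<in>{f\<in>D. U f < U e}. \<exists>N. \<forall>n\<ge>N. f \<in> approx k t U n \<longleftrightarrow> f \<in> config k t U"
      using less by (auto simp: D_def)
    then obtain N where N: "\<And>f n. f \<in> D \<Longrightarrow> U f < U e \<Longrightarrow> N f \<le> n \<Longrightarrow>
        f \<in> approx k t U n \<longleftrightarrow> f \<in> config k t U"
      by (metis (mono_tags, lifting) mem_Collect_eq)
    define m where "m = Max (insert 0 (N ` D))"
    have m: "N f \<le> m" if "f \<in> D" for f using that \<open>finite D\<close> by (simp add: m_def)
    have adm: "admits k U (approx k t U n) e \<longleftrightarrow> admits k U (config k t U) e" if "m \<le> n" for n
    proof (rule admits_cong)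
      fix f assume f: "f \<inter> e \<noteq> {}" "U f < U e"
      show "f \<in> approx k t U n \<longleftrightarrow> f \<in> config k t U"
      proof (cases "f \<in> lattice_edges")
        case True
        then have "f \<in> D" using f by (simp add: D_def)
        then show ?thesis using N[of f n] f m[of f] that by simp
      next
        case False then show ?thesis using approx_subset config_subset by blast
      qed
    qed
    have *: "e \<in> approx k t U n \<longleftrightarrow> U e \<le> t \<and> admits k U (config k t U) e" if n: "Suc m \<le> n" for n
    proof -
      obtain n' where "n = Suc n'" "m \<le> n'" using n by (cases n) auto
      then show ?thesis using adm[of n'] less.prems by simp
    qed
    have "(\<exists>N. \<forall>n\<ge>N. e \<in> approx k t U n) \<longleftrightarrow> U e \<le> t \<and> admits k U (config k t U) e"
    proof
      assume "\<exists>N. \<forall>n\<ge>N. e \<in> approx k t U n"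
      then obtain N where "\<forall>n\<ge>N. e \<in> approx k t U n" ..
      then have "e \<in> approx k t U (max N (Suc m))" by simp
      then show "U e \<le> t \<and> admits k U (config k t U) e" using *[of "max N (Suc m)"] by simp
    qed (use * in blast)
    then have "e \<in> config k t U \<longleftrightarrow> U e \<le> t \<and> admits k U (config k t U) e"
      by (subst config_def) simp
    with * show ?case by blast
  qed note eventually = this
  show ?thesis
    unfolding stable_def
  proof (intro allI)
    fix e
    show "e \<in> config k t U \<longleftrightarrow> e \<in> lattice_edges \<and> U e \<le> t \<and> admits k U (config k t U) e"
    proof (cases "e \<in> lattice_edges")
      case True
      define D where "D = {f \<in> lattice_edges. f \<inter> e \<noteq> {}}"
      have "finite D" unfolding D_def using lattice_edge_finite True by (intro finite_lattice_edges_meeting) auto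
      obtain N where N: "\<And>f n. f \<in> lattice_edges \<Longrightarrow> N f \<le> n \<Longrightarrow> f \<in> approx k t U n \<longleftrightarrow> f \<in> config k t U"
        using eventually by metis
      define m where "m = Max (insert (N e) (N ` D))"
      have m: "N f \<le> m" if "f \<in> D" for f using that \<open>finite D\<close> by (simp add: m_def)
      have "N e \<le> m" using \<open>finite D\<close> by (simp add: m_def)
      have "f \<in> approx k t U m \<longleftrightarrow> f \<in> config k t U" if "f \<inter> e \<noteq> {}" for f
      proof (cases "f \<in> lattice_edges")
        case True then show ?thesis using N m that by (simp add: D_def)
      next
        case False then show ?thesis using approx_subset config_subset by blast
      qed
      then have "admits k U (approx k t U m) e \<longleftrightarrow> admits k U (config k t U) e" by (intro admits_cong)
      moreover have "e \<in> approx k t U (Suc m) \<longleftrightarrow> e \<in> config k t U"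
        using N[OF True, of "Suc m"] \<open>N e \<le> m\<close> by simp
      ultimately show ?thesis by auto
    next
      case False then show ?thesis using config_subset by blast
    qed
  qed
qed

lemma stable_unique:
  assumes "regular U" "stable k t U A" "stable k t U B"
  shows "A = B"
proof -
  let ?R = "{(f, e). f \<in> lattice_edges \<and> e \<in> lattice_edges \<and> f \<inter> e \<noteq> {} \<and> U f < U e}"
  have wf: "wf ?R" using assms by (simp add: regular_def)
  have "e \<in> A \<longleftrightarrow> e \<in> B" for e
    using wf
  proof (induction e rule: wf_induct_rule)
    case (less e)
    show ?case
    proof (cases "e \<in> lattice_edges")
      case True
      have "admits k U A e \<longleftrightarrow> admits k U B e"
      proof (rule admits_cong)
        fix f assume "f \<inter> e \<noteq> {}" "U f < U e"
        then show "f \<in> A \<longleftrightarrow> f \<in> B"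
          using less[of f] True assms(2,3)[THEN stable_subset] by (cases "f \<in> lattice_edges") auto
      qed
      then show ?thesis using assms(2,3) unfolding stable_def by blast
    next
      case False
      then show ?thesis using assms(2,3)[THEN stable_subset] by blast
    qed
  qed
  then show ?thesis by auto
qed

text \<open>The edges open at \<open>s \<le> t\<close> are those open at \<open>t\<close> with clock
  at most \<open>s\<close>. So the degrees before time \<open>U e\<close> never exceed the count in
  \<open>admits\<close>, and they reach it.\<close>

lemma cdp_config_eq:
  assumes U: "regular U" and "1 \<le> k" "0 \<le> t"
  shows "cdp_config k U t = config k t U"
proof -
  have "\<exists>!\<omega>. cdp_evolution k U \<omega>"
    using U by (intro ex1_cdp_evolution) (auto simp: regular_def)
  then have evo: "cdp_evolution k U (cdp_config k U)"
    unfolding cdp_config_def by (rule theI')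
  define \<omega> where "\<omega> = cdp_config k U"
  have iff: "e \<in> \<omega> s \<longleftrightarrow> e \<in> lattice_edges \<and> U e \<le> s \<and>
      (\<forall>s. 0 \<le> s \<and> s < U e \<longrightarrow> Max (open_degree (\<omega> s) ` e) < k)" for e s
    using evo unfolding \<omega>_def cdp_evolution_def by blast
  have sub: "\<omega> s \<subseteq> lattice_edges" for s using iff by blast
  have before: "f \<in> \<omega> s \<longleftrightarrow> f \<in> \<omega> t \<and> U f \<le> s" if "s \<le> t" for f s
    using iff[of f s] iff[of f t] that by auto
  have "(\<forall>s. 0 \<le> s \<and> s < U e \<longrightarrow> Max (open_degree (\<omega> s) ` e) < k) \<longleftrightarrow> admits k U (\<omega> t) e"
    if e: "e \<in> lattice_edges" "U e \<le> t" for e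
  proof
    assume *: "\<forall>s. 0 \<le> s \<and> s < U e \<longrightarrow> Max (open_degree (\<omega> s) ` e) < k"
    show "admits k U (\<omega> t) e"
      unfolding admits_def
    proof
      fix u assume u: "u \<in> e"
      define X where "X = {x. {x, u} \<in> \<omega> t \<and> U {x, u} < U e}"
      have "finite X"
        using finite_nbrs[OF sub, of t u] by (rule rev_finite_subset) (auto simp: X_def nbrs_def)
      \<comment> \<open>By the last of the finitely many earlier clocks at \<open>u\<close> all
        counted edges are open, and this is still before \<open>U e\<close>. The 0 covers the case
        of no such edge and keeps \<open>s\<close> nonnegative.\<close>
      define s where "s = Max (insert 0 ((\<lambda>x. U {x, u}) ` X))"
      have "0 \<le> s" using \<open>finite X\<close> by (simp add: s_def)
      have "s \<in> insert 0 ((\<lambda>x. U {x, u}) ` X)" unfolding s_def using \<open>finite X\<close> by (intro Max_in) auto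
      then have "s < U e" using U e by (auto simp: X_def regular_def)
      have "U {x, u} \<le> s" if "x \<in> X" for x using that \<open>finite X\<close> by (simp add: s_def)
      then have "X \<subseteq> {x. {x, u} \<in> \<omega> s}"
        using before[of s] \<open>s < U e\<close> e by (auto simp: X_def)
      moreover have "finite {x. {x, u} \<in> \<omega> s}" using finite_nbrs[OF sub, of s u] by (simp add: nbrs_def)
      ultimately have "card X \<le> open_degree (\<omega> s) u" unfolding open_degree_def by (rule card_mono[rotated])
      also have "\<dots> \<le> Max (open_degree (\<omega> s) ` e)"
        using lattice_edge_finite[OF e(1)] u by (intro Max_ge) auto
      also have "\<dots> < k" using * \<open>0 \<le> s\<close> \<open>s < U e\<close> by blast
      finally show "card {x. {x, u} \<in> \<omega> t \<and> U {x, u} < U e} < k" by (simp add: X_def)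
    qed
  next
    assume adm: "admits k U (\<omega> t) e"
    show "\<forall>s. 0 \<le> s \<and> s < U e \<longrightarrow> Max (open_degree (\<omega> s) ` e) < k"
    proof (intro allI impI)
      fix s assume s: "0 \<le> s \<and> s < U e"
      have "open_degree (\<omega> s) u < k" if u: "u \<in> e" for u
      proof -
        have "{x. {x, u} \<in> \<omega> s} \<subseteq> {x. {x, u} \<in> \<omega> t \<and> U {x, u} < U e}"
          using before[of s] s e by auto
        moreover have "finite {x. {x, u} \<in> \<omega> t \<and> U {x, u} < U e}"
          using finite_nbrs[OF sub, of t u] by (rule rev_finite_subset) (auto simp: nbrs_def)
        ultimately have "open_degree (\<omega> s) u \<le> card {x. {x, u} \<in> \<omega> t \<and> U {x, u} < U e}"
          unfolding open_degree_def by (rule card_mono[rotated])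
        also have "\<dots> < k" using adm u unfolding admits_def by blast
        finally show ?thesis .
      qed
      then show "Max (open_degree (\<omega> s) ` e) < k"
        using lattice_edge_finite[OF e(1)] by (subst Max_less_iff) auto
    qed
  qed
  then have "stable k t U (\<omega> t)" unfolding stable_def using iff by blast
  then show ?thesis using stable_unique[OF U _ stable_config[OF U]] \<omega>_def by blast
qed

text \<open>The last edge to open at \<open>u\<close> found fewer than \<open>k\<close> open ones
  there, and as clocks are distinct, all the others are earlier.\<close>

lemma stable_degree:
  assumes U: "regular U" and A: "stable k t U A"
  shows "finite (nbrs A u)" "card (nbrs A u) \<le> k"
proof -
  show fin: "finite (nbrs A u)" using finite_nbrs stable_subset[OF A] by metis
  show "card (nbrs A u) \<le> k"
  proof (cases "nbrs A u = {}")
    case False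
    let ?f = "\<lambda>x. U {x, u}"
    have "Max (?f ` nbrs A u) \<in> ?f ` nbrs A u" using fin False by (intro Max_in) auto
    then obtain y where y: "y \<in> nbrs A u" "U {y, u} = Max (?f ` nbrs A u)" by auto
    then have e: "{y, u} \<in> A" by (simp add: nbrs_def)
    have "nbrs A u - {y} \<subseteq> {x. {x, u} \<in> A \<and> U {x, u} < U {y, u}}"
    proof
      fix x assume x: "x \<in> nbrs A u - {y}"
      then have "U {x, u} \<le> U {y, u}" using y fin by simp
      moreover have "{x, u} \<noteq> {y, u}" using x by (auto simp: doubleton_eq_iff)
      then have "U {x, u} \<noteq> U {y, u}"
        using U x e stable_subset[OF A] unfolding regular_def nbrs_def by (auto dest!: inj_onD)
      ultimately show "x \<in> {x. {x, u} \<in> A \<and> U {x, u} < U {y, u}}" using x by (auto simp: nbrs_def)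
    qed
    moreover have "finite {x. {x, u} \<in> A \<and> U {x, u} < U {y, u}}"
      using fin by (rule rev_finite_subset) (auto simp: nbrs_def)
    ultimately have "card (nbrs A u - {y}) \<le> card {x. {x, u} \<in> A \<and> U {x, u} < U {y, u}}"
      by (rule card_mono[rotated])
    also have "\<dots> < k" using A e unfolding stable_def admits_def by blast
    finally show ?thesis using y(1) fin by simp
  qed simp
qed

text \<open>An edge whose clock rings after time \<open>t\<close> is closed whatever its neighbours do, and no edge of a
  configuration with degrees at most \<open>k\<close> is ever blocked. So every such finite modification of a
  configuration is realised by moving finitely many clocks.\<close>

lemma stable_modify:
  assumes \<omega>: "stable k t U \<omega>" and \<omega>': "\<omega>' \<subseteq> lattice_edges" "\<And>u. card (nbrs \<omega>' u) \<le> k"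
    and late: "\<And>e. e \<in> lattice_edges - \<omega>' \<Longrightarrow> \<exists>f\<in>(\<omega> - \<omega>') \<union> (\<omega>' - \<omega>). e \<inter> f \<noteq> {} \<Longrightarrow> t < V e"
    and early: "\<And>e. e \<in> \<omega>' - \<omega> \<Longrightarrow> V e \<le> t"
    and same: "\<And>e. e \<in> lattice_edges \<Longrightarrow> e \<notin> \<omega>' - \<omega> \<Longrightarrow>
      e \<in> \<omega>' \<or> \<not> (\<exists>f\<in>(\<omega> - \<omega>') \<union> (\<omega>' - \<omega>). e \<inter> f \<noteq> {}) \<Longrightarrow> V e = U e"
  shows "stable k t V \<omega>'"
  unfolding stable_def
proof (intro allI)
  fix e
  let ?D = "(\<omega> - \<omega>') \<union> (\<omega>' - \<omega>)"
  have iff: "f \<in> \<omega> \<longleftrightarrow> f \<in> lattice_edges \<and> U f \<le> t \<and> admits k U \<omega> f" for f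
    using \<omega> unfolding stable_def by blast
  show "e \<in> \<omega>' \<longleftrightarrow> e \<in> lattice_edges \<and> V e \<le> t \<and> admits k V \<omega>' e"
  proof (cases "e \<in> \<omega>'")
    case True
    then have e: "e \<in> lattice_edges" using \<omega>' by auto
    have "V e \<le> t"
    proof (cases "e \<in> \<omega>")
      case True then show ?thesis using same[OF e] iff[of e] \<open>e \<in> \<omega>'\<close> by auto
    next
      case False then show ?thesis using early \<open>e \<in> \<omega>'\<close> by simp
    qed
    \<comment> \<open>\<open>e\<close> is one of the at most \<open>k\<close> edges at
      \<open>u\<close>, but not earlier than itself.\<close>
    moreover have "card {x. {x, u} \<in> \<omega>' \<and> V {x, u} < V e} < k" if u: "u \<in> e" for u
    proof -
      obtain v where v: "e = {v, u}" using lattice_edgeE[OF e u] by metis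
      have "{x. {x, u} \<in> \<omega>' \<and> V {x, u} < V e} \<subset> nbrs \<omega>' u"
        using v True by (auto simp: nbrs_def)
      then have "card {x. {x, u} \<in> \<omega>' \<and> V {x, u} < V e} < card (nbrs \<omega>' u)"
        using finite_nbrs[OF \<omega>'(1)] by (intro psubset_card_mono)
      also have "\<dots> \<le> k" by (rule \<omega>')
      finally show ?thesis .
    qed
    ultimately show ?thesis using True e by (simp add: admits_def)
  next
    case False
    have "\<not> admits k V \<omega>' e" if e: "e \<in> lattice_edges" "V e \<le> t"
    proof -
      have far: "e \<inter> f = {}" if "f \<in> ?D" for f
        using late[of e] e False that by force
      then have Ve: "V e = U e" using same[of e] e False by blast
      have "e \<inter> e \<noteq> {}" using lattice_edge_finite[OF e(1)] by simp
      then have "e \<notin> \<omega>" using far[of e] False by blast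
      then have "\<not> admits k U \<omega> e" using iff[of e] e Ve by auto
      then obtain u where u: "u \<in> e" "\<not> card {x. {x, u} \<in> \<omega> \<and> U {x, u} < U e} < k"
        unfolding admits_def by blast
      \<comment> \<open>\<open>e\<close> touches no changed edge, so the edges that blocked it are
        still open and have their old clocks.\<close>
      have "{x. {x, u} \<in> \<omega> \<and> U {x, u} < U e} \<subseteq> {x. {x, u} \<in> \<omega>' \<and> V {x, u} < V e}"
      proof
        fix x assume "x \<in> {x. {x, u} \<in> \<omega> \<and> U {x, u} < U e}"
        then have x: "{x, u} \<in> \<omega>" "U {x, u} < U e" by auto
        have "{x, u} \<in> \<omega>'" using far[of "{x, u}"] x u by auto
        moreover from this have "V {x, u} = U {x, u}" using same[of "{x, u}"] x \<omega>' by auto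
        ultimately show "x \<in> {x. {x, u} \<in> \<omega>' \<and> V {x, u} < V e}" using x Ve by simp
      qed
      moreover have "finite {x. {x, u} \<in> \<omega>' \<and> V {x, u} < V e}"
        using finite_nbrs[OF \<omega>'(1), of u] by (rule rev_finite_subset) (auto simp: nbrs_def)
      ultimately have "card {x. {x, u} \<in> \<omega> \<and> U {x, u} < U e} \<le> card {x. {x, u} \<in> \<omega>' \<and> V {x, u} < V e}"
        by (rule card_mono[rotated])
      with u show ?thesis unfolding admits_def by force
    qed
    with False show ?thesis by blast
  qed
qed

subsection \<open>Moving finitely many clocks\<close>

abbreviation unif :: "real measure" where
  "unif \<equiv> uniform_measure lborel {0..1}"

lemma prob_space_unif: "prob_space unif"
  by (rule prob_space_uniform_measure) auto

lemma emeasure_unif: "0 \<le> a \<Longrightarrow> a \<le> b \<Longrightarrow> b \<le> 1 \<Longrightarrow> emeasure unif {a<..b} = ennreal (b - a)"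
proof -
  assume "0 \<le> a" "a \<le> b" "b \<le> 1"
  moreover from this have "{0..1} \<inter> {a<..b} = {a<..b}" by auto
  ultimately show ?thesis by (simp add: divide_ennreal_def)
qed

lemma prob_space_clock: "prob_space clock_measure"
  unfolding clock_measure_def by (intro prob_space_PiM prob_space_unif)

lemma countable_lattice_edges: "countable lattice_edges"
proof -
  have "lattice_edges \<subseteq> range (\<lambda>(u, v). {u, v} :: 'a edge)" by (auto simp: lattice_edges_def)
  then show ?thesis by (rule countable_subset) simp
qed

lemma space_clock: "space clock_measure = PiE lattice_edges (\<lambda>_. UNIV)"
  by (simp add: clock_measure_def space_PiM)

lemma measurable_clock_component [measurable]:
  "e \<in> lattice_edges \<Longrightarrow> (\<lambda>U. U e) \<in> borel_measurable clock_measure"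
  using measurable_component_singleton[of e lattice_edges "\<lambda>_. unif"]
  by (simp add: clock_measure_def measurable_def)

lemma measurable_into_clock:
  assumes "\<And>e. e \<in> lattice_edges \<Longrightarrow> (\<lambda>x. f x e) \<in> borel_measurable N"
    and "\<And>x. x \<in> space N \<Longrightarrow> f x \<in> extensional lattice_edges"
  shows "f \<in> measurable N clock_measure"
  unfolding clock_measure_def
proof (rule measurable_PiM_single')
  show "(\<lambda>x. f x e) \<in> measurable N unif" if "e \<in> lattice_edges" for e
    using assms(1)[OF that] by (simp add: measurable_def)
  show "f \<in> space N \<rightarrow> (\<Pi>\<^sub>E i\<in>lattice_edges. space unif)"
    using assms(2) by (auto simp: PiE_def)
qed

lemma clock_rectangle:
  assumes "finite J" "J \<subseteq> lattice_edges" "\<And>e. e \<in> J \<Longrightarrow> A e \<in> sets borel"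
  shows "{U \<in> space clock_measure. \<forall>e\<in>J. U e \<in> A e} \<in> sets clock_measure"
    and "emeasure clock_measure {U \<in> space clock_measure. \<forall>e\<in>J. U e \<in> A e} = (\<Prod>e\<in>J. emeasure unif (A e))"
proof -
  have eq: "{U \<in> space clock_measure. \<forall>e\<in>J. U e \<in> A e} = prod_emb lattice_edges (\<lambda>_. unif) J (Pi\<^sub>E J A)"
    using assms(2) by (auto simp: prod_emb_def space_clock PiE_iff extensional_def)
  show "{U \<in> space clock_measure. \<forall>e\<in>J. U e \<in> A e} \<in> sets clock_measure"
    unfolding eq unfolding clock_measure_def using assms by (intro sets_PiM_I) auto
  show "emeasure clock_measure {U \<in> space clock_measure. \<forall>e\<in>J. U e \<in> A e} = (\<Prod>e\<in>J. emeasure unif (A e))"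
    unfolding eq unfolding clock_measure_def using assms
    by (intro emeasure_PiM_emb prob_space_unif) auto
qed

lemma measurable_resample:
  fixes e :: "'d::finite edge"
  assumes e: "e \<in> lattice_edges"
  shows "(\<lambda>(U, s). U(e := s)) \<in> measurable (clock_measure \<Otimes>\<^sub>M unif) clock_measure"
proof (rule measurable_into_clock)
  fix f :: "'d edge" assume f: "f \<in> lattice_edges"
  show "(\<lambda>x. (case x of (U, s) \<Rightarrow> U(e := s)) f) \<in> borel_measurable (clock_measure \<Otimes>\<^sub>M unif)"
  proof (cases "f = e")
    case True
    have "snd \<in> borel_measurable (clock_measure \<Otimes>\<^sub>M unif)"
      using measurable_snd[of clock_measure unif] by (simp add: measurable_def)
    with True show ?thesis by (simp add: case_prod_beta')
  next
    case False
    have "(\<lambda>x. fst x f) \<in> borel_measurable (clock_measure \<Otimes>\<^sub>M unif)"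
      using measurable_compose[OF measurable_fst measurable_clock_component[OF f]] .
    with False show ?thesis by (simp add: case_prod_beta')
  qed
qed (use e in \<open>auto simp: space_pair_measure space_clock PiE_def extensional_def\<close>)

text \<open>Checked on rectangles: the factor of the coordinate \<open>e\<close>, or 1 if it is
  unconstrained, now comes from the fresh variable.\<close>

lemma distr_resample:
  fixes e :: "'d::finite edge"
  assumes e: "e \<in> lattice_edges"
  shows "distr (clock_measure \<Otimes>\<^sub>M unif) clock_measure (\<lambda>(U, s). U(e := s)) = clock_measure"
proof -
  interpret C: prob_space "clock_measure :: ('d edge \<Rightarrow> real) measure" by (rule prob_space_clock)
  interpret unif: prob_space unif by (rule prob_space_unif)
  interpret P: pair_prob_space "clock_measure :: ('d edge \<Rightarrow> real) measure" unif ..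
  let ?f = "\<lambda>(U, s). U(e := s)"
  note f = measurable_resample[OF e]
  show ?thesis
    unfolding clock_measure_def
  proof (rule measure_eqI_PiM_infinite[symmetric, OF refl])
    show "finite_measure (\<Pi>\<^sub>M i\<in>(lattice_edges :: 'd edge set). unif)"
      using C.finite_measure_axioms by (simp add: clock_measure_def)
    fix A :: "'d edge \<Rightarrow> real set" and J :: "'d edge set"
    assume J: "finite J" "J \<subseteq> lattice_edges" "\<And>i. i \<in> J \<Longrightarrow> A i \<in> sets unif"
    let ?R = "\<lambda>J. {U \<in> space clock_measure. \<forall>e\<in>J. U e \<in> A e}"
    define B where "B = (if e \<in> J then A e else UNIV)"
    have eq: "prod_emb lattice_edges (\<lambda>_. unif) J (Pi\<^sub>E J A) = ?R J"
      using J(2) by (auto simp: prod_emb_def space_clock PiE_iff extensional_def)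
    have vim: "?f -` ?R J \<inter> space (clock_measure \<Otimes>\<^sub>M unif) = ?R (J - {e}) \<times> B"
      using e by (auto simp: space_pair_measure space_clock B_def PiE_iff extensional_def split: if_splits)
    have B: "B \<in> sets unif" using J(3) by (auto simp: B_def)
    have "?R J \<in> sets clock_measure" using J by (intro clock_rectangle(1)) auto
    then have "emeasure (distr (clock_measure \<Otimes>\<^sub>M unif) clock_measure ?f) (?R J) =
        emeasure (clock_measure \<Otimes>\<^sub>M unif) (?R (J - {e}) \<times> B)"
      using f by (simp only: emeasure_distr vim)
    also have "\<dots> = emeasure clock_measure (?R (J - {e})) * emeasure unif B"
      using J B by (intro unif.emeasure_pair_measure_Times clock_rectangle(1)) auto
    also have "emeasure clock_measure (?R (J - {e})) = (\<Prod>f\<in>J - {e}. emeasure unif (A f))"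
      using J by (intro clock_rectangle(2)) auto
    also have "\<dots> * emeasure unif B = (\<Prod>f\<in>J. emeasure unif (A f))"
      using J(1) unif.emeasure_space_1
      by (cases "e \<in> J") (auto simp: B_def prod.remove mult.commute)
    also have "\<dots> = emeasure clock_measure (?R J)" using J by (intro clock_rectangle(2)[symmetric]) auto
    finally show "emeasure (\<Pi>\<^sub>M i\<in>lattice_edges. unif) (prod_emb lattice_edges (\<lambda>_. unif) J (Pi\<^sub>E J A)) =
      emeasure (distr ((\<Pi>\<^sub>M i\<in>lattice_edges. unif) \<Otimes>\<^sub>M unif) (\<Pi>\<^sub>M i\<in>lattice_edges. unif) ?f)
        (prod_emb lattice_edges (\<lambda>_. unif) J (Pi\<^sub>E J A))"
      by (simp only: eq clock_measure_def)
  qed simp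
qed

lemma AE_resample:
  fixes e :: "'d::finite edge"
  assumes e: "e \<in> lattice_edges" and Q: "AE U in clock_measure. Q U"
  shows "AE U in clock_measure. AE s in unif. Q (U(e := s))"
proof -
  interpret C: prob_space "clock_measure :: ('d edge \<Rightarrow> real) measure" by (rule prob_space_clock)
  interpret unif: prob_space unif by (rule prob_space_unif)
  interpret P: pair_prob_space "clock_measure :: ('d edge \<Rightarrow> real) measure" unif ..
  have "AE U in distr (clock_measure \<Otimes>\<^sub>M unif) clock_measure (\<lambda>(U, s). U(e := s)). Q U"
    using Q by (simp only: distr_resample[OF e])
  then have "AE x in clock_measure \<Otimes>\<^sub>M unif. Q (case x of (U, s) \<Rightarrow> U(e := s))"
    by (rule AE_distrD[OF measurable_resample[OF e]])
  from P.AE_pair[OF this] show ?thesis by simp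
qed

text \<open>An interval of positive length cannot consist of exceptional values only. From here on
  just the existence of a good clock value is kept.\<close>

lemma AE_resample_in:
  fixes e :: "'d::finite edge"
  assumes e: "e \<in> lattice_edges" and Q: "AE U in clock_measure. Q U"
    and "0 \<le> a" "a < b" "b \<le> 1"
  shows "AE U in clock_measure. \<exists>s\<in>{a<..b}. Q (U(e := s))"
  using AE_resample[OF e Q]
proof (rule AE_mp, intro AE_I2 impI)
  fix U assume U: "AE s in unif. Q (U(e := s))"
  show "\<exists>s\<in>{a<..b}. Q (U(e := s))"
  proof (rule ccontr)
    assume "\<not> ?thesis"
    with U have "AE s in unif. s \<notin> {a<..b}" by (auto elim: eventually_mono)
    then have "emeasure unif {a<..b} = 0"
      by (subst (asm) AE_iff_measurable[of "{a<..b}"]) (auto simp del: emeasure_uniform_measure)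
    then show False using assms emeasure_unif[of a b] by (simp add: ennreal_eq_0_iff)
  qed
qed

text \<open>The induction hypothesis is itself an almost sure property of \<open>U\<close>, so it
  can be applied to \<open>U(e := s)\<close>. Clocks in \<open>L\<close> go to
  \<open>{0<..t}\<close>, the others to \<open>{t<..1}\<close>; both intervals have positive
  length.\<close>

lemma AE_resample_finite:
  fixes F :: "'d::finite edge set"
  assumes Q: "AE U in clock_measure. Q U" and t: "0 < t" "t < 1"
    and "finite F" "F \<subseteq> lattice_edges"
  shows "AE U in clock_measure. \<exists>V. Q V \<and> (\<forall>e\<in>F. if e \<in> L then V e \<le> t else t < V e) \<and>
    (\<forall>e. e \<notin> F \<longrightarrow> V e = U e)"
  using assms(4,5)
proof (induction F rule: finite_induct)
  case empty
  then show ?case using Q by (auto elim: eventually_mono)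
next
  case (insert e F)
  let ?P = "\<lambda>U. \<exists>V. Q V \<and> (\<forall>e\<in>F. if e \<in> L then V e \<le> t else t < V e) \<and> (\<forall>e. e \<notin> F \<longrightarrow> V e = U e)"
  let ?P' = "\<lambda>U. \<exists>V. Q V \<and> (\<forall>f\<in>insert e F. if f \<in> L then V f \<le> t else t < V f) \<and>
    (\<forall>f. f \<notin> insert e F \<longrightarrow> V f = U f)"
  have e: "e \<in> lattice_edges" and IH: "AE U in clock_measure. ?P U" using insert by auto
  define a b where "a = (if e \<in> L then 0 else t)" and "b = (if e \<in> L then t else 1)"
  have "AE U in clock_measure. \<exists>s\<in>{a<..b}. ?P (U(e := s))"
    using t by (intro AE_resample_in[OF e IH]) (auto simp: a_def b_def)
  then show ?case
  proof (rule AE_mp, intro AE_I2 impI)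
    fix U assume "\<exists>s\<in>{a<..b}. ?P (U(e := s))"
    then obtain s V where s: "s \<in> {a<..b}" and V: "Q V" "\<forall>f\<in>F. if f \<in> L then V f \<le> t else t < V f"
      "\<forall>f. f \<notin> F \<longrightarrow> V f = (U(e := s)) f" by blast
    have "V e = s" using V(3) insert.hyps by simp
    then have "if e \<in> L then V e \<le> t else t < V e" using s by (auto simp: a_def b_def split: if_splits)
    then show "?P' U" using V by (intro exI[of _ V]) auto
  qed
qed

text \<open>There are only countably many pairs of finite edge sets, so the exceptional null sets
  can be united. This lets \<open>L\<close> and \<open>H\<close> depend on \<open>U\<close>.\<close>

lemma AE_resample_all:
  fixes Q :: "('d::finite edge \<Rightarrow> real) \<Rightarrow> bool"
  assumes Q: "AE U in clock_measure. Q U" and t: "0 < t" "t < 1"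
  shows "AE U in clock_measure. \<forall>L H. finite L \<and> finite H \<and> L \<subseteq> lattice_edges \<and> H \<subseteq> lattice_edges \<and> L \<inter> H = {} \<longrightarrow>
    (\<exists>V. Q V \<and> (\<forall>e\<in>L. V e \<le> t) \<and> (\<forall>e\<in>H. t < V e) \<and> (\<forall>e. e \<notin> L \<union> H \<longrightarrow> V e = U e))"
proof -
  define X where "X = {F. finite F \<and> F \<subseteq> (lattice_edges :: 'd edge set)}"
  have X: "countable X" unfolding X_def by (intro countable_Collect_finite_subset countable_lattice_edges)
  have "AE U in clock_measure. \<forall>L\<in>X. \<forall>F\<in>X. \<exists>V. Q V \<and> (\<forall>e\<in>F. if e \<in> L then V e \<le> t else t < V e) \<and>
    (\<forall>e. e \<notin> F \<longrightarrow> V e = U e)"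
    unfolding AE_ball_countable[OF X] using AE_resample_finite[OF Q t] by (simp add: X_def)
  then show ?thesis
  proof (rule AE_mp, intro AE_I2 impI allI)
    fix U and L H :: "'d edge set"
    assume *: "\<forall>L\<in>X. \<forall>F\<in>X. \<exists>V. Q V \<and> (\<forall>e\<in>F. if e \<in> L then V e \<le> t else t < V e) \<and>
        (\<forall>e. e \<notin> F \<longrightarrow> V e = U e)"
      and LH: "finite L \<and> finite H \<and> L \<subseteq> lattice_edges \<and> H \<subseteq> lattice_edges \<and> L \<inter> H = {}"
    have "L \<in> X" "L \<union> H \<in> X" using LH by (auto simp: X_def)
    with *[rule_format, of L "L \<union> H"]
    obtain V where V: "Q V" "\<forall>e\<in>L \<union> H. if e \<in> L then V e \<le> t else t < V e"
      "\<forall>e. e \<notin> L \<union> H \<longrightarrow> V e = U e" by metis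
    have "t < V e" if "e \<in> H" for e using V(2) that LH by (auto split: if_splits)
    then show "\<exists>V. Q V \<and> (\<forall>e\<in>L. V e \<le> t) \<and> (\<forall>e\<in>H. t < V e) \<and> (\<forall>e. e \<notin> L \<union> H \<longrightarrow> V e = U e)"
      using V by (intro exI[of _ V]) auto
  qed
qed

definition local_variant :: "nat \<Rightarrow> 'd::finite edge set \<Rightarrow> 'd edge set \<Rightarrow> bool" where
  "local_variant k \<omega> \<omega>' \<longleftrightarrow> \<omega>' \<subseteq> lattice_edges \<and> (\<forall>u. card (nbrs \<omega>' u) \<le> k) \<and>
     finite (\<omega> - \<omega>') \<and> finite (\<omega>' - \<omega>)"

lemma AE_local_variant:
  assumes reg: "AE U in clock_measure. regular (U :: 'd::finite edge \<Rightarrow> real)"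
    and Q: "AE U in clock_measure. Q (config k t U :: 'd edge set)" and t: "0 < t" "t < 1"
  shows "AE U in clock_measure. \<forall>\<omega>'. local_variant k (config k t U) \<omega>' \<longrightarrow> Q \<omega>'"
proof -
  \<comment> \<open>Regularity is carried along so that the moved clocks \<open>V\<close> have only
    one stable configuration.\<close>
  have "AE U in clock_measure. regular U \<and> Q (config k t U)" using reg Q by auto
  from AE_resample_all[OF this t] reg
  show ?thesis
  proof (eventually_elim, intro allI impI)
    fix U :: "'d edge \<Rightarrow> real" and \<omega>'
    assume *: "\<forall>L H. finite L \<and> finite H \<and> L \<subseteq> lattice_edges \<and> H \<subseteq> lattice_edges \<and> L \<inter> H = {} \<longrightarrow>
      (\<exists>V. (regular V \<and> Q (config k t V)) \<and> (\<forall>e\<in>L. V e \<le> t) \<and> (\<forall>e\<in>H. t < V e) \<and>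
        (\<forall>e. e \<notin> L \<union> H \<longrightarrow> V e = U e))"
      and U: "regular U" and var: "local_variant k (config k t U) \<omega>'"
    let ?\<omega> = "config k t U"
    let ?D = "(?\<omega> - \<omega>') \<union> (\<omega>' - ?\<omega>)"
    have \<omega>': "\<omega>' \<subseteq> lattice_edges" "\<And>u. card (nbrs \<omega>' u) \<le> k" "finite ?D"
      using var by (auto simp: local_variant_def)
    \<comment> \<open>The edges to be delayed: the removed ones, which meet themselves, and the
      closed neighbours of the change, which might otherwise open.\<close>
    define H where "H = {e \<in> lattice_edges - \<omega>'. \<exists>f\<in>?D. e \<inter> f \<noteq> {}}"
    have "?D \<subseteq> lattice_edges" using \<omega>'(1) config_subset[of k t U] by auto
    then have "finite (\<Union>?D)" using \<omega>'(3) lattice_edge_finite by (intro finite_Union) auto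
    then have "finite {e \<in> lattice_edges. e \<inter> \<Union>?D \<noteq> {}}" by (rule finite_lattice_edges_meeting)
    then have "finite H" by (rule rev_finite_subset) (auto simp: H_def)
    then have "finite (\<omega>' - ?\<omega>) \<and> finite H \<and> \<omega>' - ?\<omega> \<subseteq> lattice_edges \<and> H \<subseteq> lattice_edges \<and> (\<omega>' - ?\<omega>) \<inter> H = {}"
      using \<omega>' by (auto simp: H_def)
    from *[rule_format, OF this] obtain V where V: "regular V" "Q (config k t V)"
      "\<forall>e\<in>\<omega>' - ?\<omega>. V e \<le> t" "\<forall>e\<in>H. t < V e"
      "\<forall>e. e \<notin> (\<omega>' - ?\<omega>) \<union> H \<longrightarrow> V e = U e" by metis
    have "stable k t V \<omega>'"
      using V(3-5) by (intro stable_modify[OF stable_config[OF U] \<omega>'(1,2)]) (auto simp: H_def)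
    then have "config k t V = \<omega>'" using stable_unique[OF V(1) _ stable_config[OF V(1)]] by metis
    with V(2) show "Q \<omega>'" by simp
  qed
qed

subsection \<open>Almost every clock collection is regular\<close>

lemma AE_unif_range: "AE s in unif. s \<in> {0<..1}"
proof (rule AE_uniform_measureI)
  show "AE s in lborel. s \<in> {0..1} \<longrightarrow> s \<in> {0<..1::real}"
    using AE_lborel_singleton[of "0::real"] by eventually_elim auto
qed simp

lemma AE_clock_range:
  "AE U in clock_measure. \<forall>e\<in>(lattice_edges :: 'd::finite edge set). U e \<in> {0<..1}"
  unfolding AE_ball_countable[OF countable_lattice_edges]
  unfolding clock_measure_def using AE_unif_range
  by (intro ballI AE_PiM_component prob_space_unif)

text \<open>A fresh clock for \<open>e\<close> almost surely misses the single value
  \<open>U f\<close>.\<close>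

lemma AE_clock_neq:
  fixes e f :: "'d::finite edge"
  assumes "e \<in> lattice_edges" "f \<in> lattice_edges" "e \<noteq> f"
  shows "AE U in clock_measure. U e \<noteq> U f"
proof -
  interpret C: prob_space "clock_measure :: ('d edge \<Rightarrow> real) measure" by (rule prob_space_clock)
  interpret unif: prob_space unif by (rule prob_space_unif)
  interpret P: pair_prob_space "clock_measure :: ('d edge \<Rightarrow> real) measure" unif ..

  have snd: "snd \<in> borel_measurable (clock_measure \<Otimes>\<^sub>M unif)"
    using measurable_snd[of clock_measure unif] by (simp add: measurable_def)
  have fst: "(\<lambda>x. fst x f) \<in> borel_measurable (clock_measure \<Otimes>\<^sub>M unif)"
    using measurable_compose[OF measurable_fst measurable_clock_component[OF assms(2)]] .
  have "AE x in clock_measure \<Otimes>\<^sub>M unif. snd x \<noteq> fst x f"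
  proof (rule P.AE_pair_measure)
    show "{x \<in> space (clock_measure \<Otimes>\<^sub>M unif). snd x \<noteq> fst x f} \<in> sets (clock_measure \<Otimes>\<^sub>M unif)"
      using snd fst by measurable
    have "AE s in unif. s \<noteq> a" for a
      using AE_lborel_singleton[of a] by (intro AE_uniform_measureI) auto
    then show "AE U in clock_measure. AE s in unif. snd (U, s) \<noteq> fst (U, s) f" by simp
  qed
  then have "AE x in clock_measure \<Otimes>\<^sub>M unif. (\<lambda>(U, s). U(e := s)) x e \<noteq> (\<lambda>(U, s). U(e := s)) x f"
    using assms(3) by (auto simp: case_prod_beta')
  moreover have "{U \<in> space clock_measure. U e \<noteq> U f} \<in> sets clock_measure"
    using measurable_clock_component[OF assms(1)] measurable_clock_component[OF assms(2)]
    by (rule borel_measurable_neq)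
  ultimately have "AE U in distr (clock_measure \<Otimes>\<^sub>M unif) clock_measure (\<lambda>(U, s). U(e := s)). U e \<noteq> U f"
    using AE_distr_iff[OF measurable_resample[OF assms(1)], of "\<lambda>U. U e \<noteq> U f"] by simp
  then show ?thesis by (simp only: distr_resample[OF assms(1)])
qed

lemma nbrs_lattice_translate:
  "nbrs lattice_edges (u :: int ^ 'd::finite) = (+) u ` nbrs lattice_edges 0"
proof -
  have "v \<in> nbrs lattice_edges u \<longleftrightarrow> v - u \<in> nbrs lattice_edges 0" for v
    by (simp add: nbrs_def lattice_edge_iff)
  then show ?thesis by (force simp: image_iff intro: bexI[of _ "_ - u"])
qed

definition adjacent_edges :: "'d::finite edge \<Rightarrow> 'd edge set" where
  "adjacent_edges e = {f \<in> lattice_edges. f \<inter> e \<noteq> {}}"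

lemma adjacent_edges_finite:
  fixes e :: "'d::finite edge"
  assumes "e \<in> lattice_edges"
  shows "finite (adjacent_edges e)"
    and "card (adjacent_edges e) \<le> 2 * card (nbrs lattice_edges (0 :: int ^ 'd))"
proof -
  let ?n = "card (nbrs lattice_edges (0 :: int ^ 'd))"
  show "finite (adjacent_edges e)"
    unfolding adjacent_edges_def using lattice_edge_finite[OF assms]
    by (intro finite_lattice_edges_meeting) auto
  have e: "finite e" "card e \<le> 2"
    using assms by (auto simp: lattice_edges_def card_insert_if)
  have "adjacent_edges e \<subseteq> (\<Union>u\<in>e. (\<lambda>v. {v, u}) ` nbrs lattice_edges u)"
  proof
    fix f assume "f \<in> adjacent_edges e"
    then obtain u where u: "f \<in> lattice_edges" "u \<in> f" "u \<in> e" by (auto simp: adjacent_edges_def)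
    from lattice_edgeE[OF u(1,2)] obtain v where "f = {v, u}" by metis
    then show "f \<in> (\<Union>u\<in>e. (\<lambda>v. {v, u}) ` nbrs lattice_edges u)" using u by (auto simp: nbrs_def)
  qed
  then have "card (adjacent_edges e) \<le> card (\<Union>u\<in>e. (\<lambda>v. {v, u}) ` nbrs lattice_edges u)"
    using e(1) finite_nbrs_lattice by (intro card_mono) auto
  also have "\<dots> \<le> (\<Sum>u\<in>e. card ((\<lambda>v. {v, u}) ` nbrs lattice_edges u))"
    by (rule card_UN_le[OF e(1)])
  also have "\<dots> \<le> (\<Sum>u\<in>e. ?n)"
  proof (rule sum_mono)
    fix u :: "int ^ 'd"
    have "card ((\<lambda>v. {v, u}) ` nbrs lattice_edges u) \<le> card (nbrs lattice_edges u)"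
      by (rule card_image_le[OF finite_nbrs_lattice])
    also have "\<dots> = ?n" by (subst nbrs_lattice_translate) (simp add: card_image)
    finally show "card ((\<lambda>v. {v, u}) ` nbrs lattice_edges u) \<le> ?n" .
  qed
  also have "\<dots> \<le> 2 * ?n" using e(2) by simp
  finally show "card (adjacent_edges e) \<le> 2 * ?n" .
qed

text \<open>Lists of n + 1 edges in which consecutive ones meet. An edge counts as adjacent to
  itself; repetitions are excluded by \<open>distinct\<close> where chains are used, so that their
  clocks are independent.\<close>

primrec edge_chains :: "nat \<Rightarrow> 'd::finite edge \<Rightarrow> 'd edge list set" where
  "edge_chains 0 e = {[e]}"
| "edge_chains (Suc n) e = (\<Union>f\<in>adjacent_edges e. (#) e ` edge_chains n f)"

lemma edge_chains_finite:
  fixes e :: "'d::finite edge"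
  assumes "e \<in> lattice_edges"
  shows "finite (edge_chains n e) \<and> card (edge_chains n e) \<le> (2 * card (nbrs lattice_edges (0 :: int ^ 'd))) ^ n"
  using assms
proof (induction n arbitrary: e)
  case (Suc n)
  let ?C = "2 * card (nbrs lattice_edges (0 :: int ^ 'd))"
  have IH: "finite (edge_chains n f)" "card (edge_chains n f) \<le> ?C ^ n" if "f \<in> adjacent_edges e" for f
    using Suc.IH[of f] that by (auto simp: adjacent_edges_def)
  have "card (edge_chains (Suc n) e) \<le> (\<Sum>f\<in>adjacent_edges e. card ((#) e ` edge_chains n f))"
    using card_UN_le[OF adjacent_edges_finite(1)[OF Suc.prems]] by simp
  also have "\<dots> \<le> (\<Sum>f\<in>adjacent_edges e. ?C ^ n)"
    using IH by (intro sum_mono) (simp add: card_image)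
  also have "\<dots> \<le> ?C * ?C ^ n"
    using adjacent_edges_finite(2)[OF Suc.prems] by simp
  finally show ?case using IH adjacent_edges_finite(1)[OF Suc.prems] by simp
qed simp

lemma edge_chains_props: "es \<in> edge_chains n e \<Longrightarrow> e \<in> lattice_edges \<Longrightarrow> length es = Suc n \<and> set es \<subseteq> lattice_edges"
proof (induction n arbitrary: e es)
  case (Suc n)
  then obtain f fs where f: "f \<in> adjacent_edges e" "fs \<in> edge_chains n f" "es = e # fs" by auto
  then show ?case using Suc.IH[of fs f] Suc.prems by (simp add: adjacent_edges_def)
qed simp

lemma map_in_edge_chains:
  assumes "\<And>i. g i \<in> lattice_edges" "\<And>i. g (Suc i) \<inter> g i \<noteq> {}"
  shows "map g [N..<N + Suc n] \<in> edge_chains n (g N)"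
proof (induction n arbitrary: N)
  case (Suc n)
  have "map g [N..<N + Suc (Suc n)] = g N # map g [Suc N..<Suc N + Suc n]"
    by (subst upt_conv_Cons) auto
  moreover have "g (Suc N) \<in> adjacent_edges (g N)" using assms by (auto simp: adjacent_edges_def)
  ultimately show ?case using Suc[of "Suc N"] by (simp only: edge_chains.simps) blast
qed simp

text \<open>Edges with clocks in a short interval form a subcritical percolation, so chains of such edges
  are finite.\<close>

lemma AE_no_long_chain:
  fixes e :: "'d::finite edge"
  assumes e: "e \<in> lattice_edges" and ab: "0 \<le> a" "a \<le> b" "b \<le> 1"
    and small: "2 * real (card (nbrs lattice_edges (0 :: int ^ 'd))) * (b - a) < 1"
  shows "AE U in clock_measure. \<exists>n. \<not> (\<exists>es\<in>edge_chains n e. distinct es \<and> (\<forall>f\<in>set es. U f \<in> {a<..b}))"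
proof -
  interpret C: prob_space "clock_measure :: ('d edge \<Rightarrow> real) measure" by (rule prob_space_clock)
  let ?C = "2 * card (nbrs lattice_edges (0 :: int ^ 'd))"
  define R where "R = (\<lambda>es. {U \<in> space clock_measure. \<forall>f\<in>set es. U f \<in> {a<..b}} :: ('d edge \<Rightarrow> real) set)"
  define B where "B n = (\<Union>es\<in>{es \<in> edge_chains n e. distinct es}. R es)" for n
  have R: "R es \<in> sets clock_measure" "C.prob (R es) = (b - a) ^ Suc n"
    if "es \<in> edge_chains n e" "distinct es" for es n
  proof -
    have es: "length es = Suc n" "set es \<subseteq> lattice_edges" using edge_chains_props[OF that(1) e] by auto
    show "R es \<in> sets clock_measure"
      unfolding R_def using es by (intro clock_rectangle(1)) auto
    have "emeasure clock_measure (R es) = (\<Prod>f\<in>set es. emeasure unif {a<..b})"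
      unfolding R_def using es by (intro clock_rectangle(2)) auto
    also have "\<dots> = ennreal (b - a) ^ Suc n"
      using ab that(2) es(1) by (simp only: emeasure_unif prod_constant distinct_card)
    finally show "C.prob (R es) = (b - a) ^ Suc n"
      using ab by (simp add: C.emeasure_eq_measure ennreal_power del: power_Suc)
  qed
  have fin: "finite {es \<in> edge_chains n e. distinct es}" for n using edge_chains_finite[OF e, of n] by simp
  have B: "B n \<in> sets clock_measure" for n
    unfolding B_def using fin R(1) by (intro sets.finite_UN) auto
  have bound: "C.prob (B n) \<le> (?C * (b - a)) ^ n" for n
  proof -
    have "C.prob (B n) \<le> (\<Sum>es\<in>{es \<in> edge_chains n e. distinct es}. C.prob (R es))"
      unfolding B_def using R(1) fin by (intro C.finite_measure_subadditive_finite) auto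
    also have "\<dots> = real (card {es \<in> edge_chains n e. distinct es}) * (b - a) ^ Suc n"
    proof -
      have "(\<Sum>es\<in>{es \<in> edge_chains n e. distinct es}. C.prob (R es)) =
          (\<Sum>es\<in>{es \<in> edge_chains n e. distinct es}. (b - a) ^ Suc n)"
        by (intro sum.cong R(2)) auto
      then show ?thesis by simp
    qed
    also have "\<dots> \<le> real (?C ^ n) * (b - a) ^ Suc n"
    proof (rule mult_right_mono)
      have "card {es \<in> edge_chains n e. distinct es} \<le> card (edge_chains n e)"
        using edge_chains_finite[OF e, of n] by (intro card_mono) auto
      then show "real (card {es \<in> edge_chains n e. distinct es}) \<le> real (?C ^ n)"
        using edge_chains_finite[OF e, of n] by (simp only: of_nat_le_iff) linarith
    qed (use ab in auto)
    also have "\<dots> \<le> real (?C ^ n) * (b - a) ^ n"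
      using ab by (intro mult_left_mono power_decreasing) auto
    finally show ?thesis by (simp add: power_mult_distrib)
  qed
  have "C.prob (\<Inter>n. B n) \<le> (?C * (b - a)) ^ n" for n
    using bound[of n] C.finite_measure_mono[of "\<Inter>n. B n" "B n"] B by (meson INT_lower UNIV_I order_trans)
  moreover have "(\<lambda>n. (?C * (b - a)) ^ n) \<longlonglongrightarrow> 0"
    using small ab by (intro LIMSEQ_realpow_zero) auto
  ultimately have "C.prob (\<Inter>n. B n) \<le> 0" by (intro LIMSEQ_le_const) auto
  then have "C.prob (\<Inter>n. B n) = 0" using measure_nonneg[of clock_measure] by (intro antisym)
  then have "(\<Inter>n. B n) \<in> null_sets clock_measure"
    using B by (intro null_setsI) (auto simp: C.emeasure_eq_measure)
  then show ?thesis
    by (rule AE_I') (auto simp: B_def R_def)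
qed

text \<open>Divide the range of the clocks into short intervals. Along an infinite chain with
  decreasing clocks the interval is eventually constant, so it would contain chains of every
  length.\<close>

lemma AE_regular: "AE U in clock_measure. regular (U :: 'd::finite edge \<Rightarrow> real)"
proof -
  \<comment> \<open>A chain has at most m - 1 continuations, and a clock falls into a given interval
    with probability 1/m; the product is below 1.\<close>
  define m where "m = Suc (2 * card (nbrs lattice_edges (0 :: int ^ 'd)))"
  have m: "0 < m" by (simp add: m_def)
  define J where "J j = {real j / m<..real (Suc j) / m}" for j
  have "AE U in clock_measure. \<forall>e\<in>(lattice_edges :: 'd edge set). \<forall>j\<in>{..<m}. \<exists>n.
      \<not> (\<exists>es\<in>edge_chains n e. distinct es \<and> (\<forall>f\<in>set es. U f \<in> J j))"
    unfolding AE_ball_countable[OF countable_lattice_edges] AE_ball_countable[OF countable_finite[OF finite_lessThan]]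
    unfolding J_def using m
    by (intro ballI AE_no_long_chain) (auto simp: m_def field_simps)
  moreover have "AE U in clock_measure. \<forall>e\<in>(lattice_edges :: 'd edge set). \<forall>f\<in>lattice_edges - {e}. U e \<noteq> U f"
    unfolding AE_ball_countable[OF countable_lattice_edges]
      AE_ball_countable[OF countable_subset[OF Diff_subset countable_lattice_edges]]
    by (auto intro!: AE_clock_neq)
  ultimately show ?thesis
    using AE_clock_range
  proof eventually_elim
    fix U :: "'d edge \<Rightarrow> real"
    assume chain: "\<forall>e\<in>lattice_edges. \<forall>j\<in>{..<m}. \<exists>n. \<not> (\<exists>es\<in>edge_chains n e. distinct es \<and> (\<forall>f\<in>set es. U f \<in> J j))"
      and neq: "\<forall>e\<in>lattice_edges. \<forall>f\<in>lattice_edges - {e}. U e \<noteq> U f"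
      and range: "\<forall>e\<in>lattice_edges. U e \<in> {0<..1}"
    let ?R = "{(f, e). f \<in> lattice_edges \<and> e \<in> lattice_edges \<and> f \<inter> e \<noteq> {} \<and> U f < U e}"
    have "wf ?R"
      unfolding wf_iff_no_infinite_down_chain
    proof
      assume "\<exists>g. \<forall>i. (g (Suc i), g i) \<in> ?R"
      then obtain g where g: "\<And>i. (g (Suc i), g i) \<in> ?R" by blast
      have dec: "U (g j) < U (g i)" if "i < j" for i j
        using that by (rule lift_Suc_mono_less_iff[of "\<lambda>i. - U (g i)", simplified, THEN iffD2, rotated])
          (use g in auto)
      \<comment> \<open>The index of the interval that contains the clock. Intervals are closed on
        the right, whence the ceiling and the -1.\<close>
      define h where "h i = nat (\<lceil>m * U (g i)\<rceil> - 1)" for i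
      have Ug: "U (g i) \<in> {0<..1}" "g i \<in> lattice_edges" for i using g range by blast+
      have h: "U (g i) \<in> J (h i)" "h i < m" for i
      proof -
        have "0 < m * U (g i)" "m * U (g i) \<le> m" using Ug m by auto
        then have ceil: "1 \<le> \<lceil>m * U (g i)\<rceil>" "\<lceil>m * U (g i)\<rceil> \<le> m" by (auto simp: ceiling_le_iff)
        then have hi: "real (h i) = \<lceil>m * U (g i)\<rceil> - 1" by (simp add: h_def)
        show "h i < m" using ceil m by (simp add: h_def nat_less_iff)
        have "real (h i) < m * U (g i)" "m * U (g i) \<le> real (h i) + 1" unfolding hi by linarith+
        then show "U (g i) \<in> J (h i)" using m by (simp add: J_def field_simps)
      qed
      \<comment> \<open>The index \<open>h\<close> does not increase along the chain, so it is
        constant once its minimum is attained.\<close>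
      obtain N where N: "\<And>i. h N \<le> h i" using ex_has_least_nat[of "\<lambda>_. True" _ h] by auto
      have hN: "h i = h N" if "N \<le> i" for i
      proof (rule antisym)
        have "U (g i) \<le> U (g N)" using dec[of N i] that by (cases "N = i") auto
        then have "\<lceil>m * U (g i)\<rceil> \<le> \<lceil>m * U (g N)\<rceil>" by (intro ceiling_mono mult_left_mono) auto
        then show "h i \<le> h N" by (simp add: h_def)
      qed (rule N)
      have "\<exists>es\<in>edge_chains n (g N). distinct es \<and> (\<forall>f\<in>set es. U f \<in> J (h N))" for n
      proof (intro bexI[of _ "map g [N..<N + Suc n]"] conjI ballI)
        show "map g [N..<N + Suc n] \<in> edge_chains n (g N)" using g by (intro map_in_edge_chains) auto
        have "inj g"
        proof (rule injI)
          fix i j assume "g i = g j" then show "i = j" using dec[of i j] dec[of j i] by (metis less_irrefl nat_neq_iff)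
        qed
        then show "distinct (map g [N..<N + Suc n])" by (simp add: distinct_map inj_on_subset[OF _ subset_UNIV] del: upt_Suc)
        fix f assume "f \<in> set (map g [N..<N + Suc n])"
        then obtain i where "f = g i" "N \<le> i" by (auto simp del: upt_Suc)
        then show "U f \<in> J (h N)" using h(1)[of i] hN[of i] by simp
      qed
      with chain h(2) Ug(2) show False by blast
    qed
    moreover have "inj_on U lattice_edges" using neq by (intro inj_onI) blast
    ultimately show "regular U" using range by (auto simp: regular_def)
  qed
qed

subsection \<open>Translations\<close>

text \<open>The restriction keeps the result in the product space, whose elements are
  \<open>undefined\<close> off the lattice edges.\<close>

definition shift_clocks :: "int ^ 'd::finite \<Rightarrow> ('d edge \<Rightarrow> real) \<Rightarrow> 'd edge \<Rightarrow> real" where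
  "shift_clocks x U = (\<lambda>e\<in>lattice_edges. U ((+) x ` e))"

text \<open>A preimage, so the vertex y of the translate corresponds to x + y in \<omega>.\<close>

definition translate :: "'v::ab_group_add \<Rightarrow> 'v set set \<Rightarrow> 'v set set" where
  "translate x \<omega> = {e. (+) x ` e \<in> \<omega>}"

lemma translate_lattice_edge: "(+) x ` e \<in> lattice_edges \<longleftrightarrow> e \<in> lattice_edges"
proof -
  have *: "(+) x ` e \<in> lattice_edges" if "e \<in> lattice_edges" for x and e :: "'a edge"
    using that by (force simp: lattice_edges_def)
  have "(+) (- x) ` (+) x ` e = e" by (simp add: image_image)
  then show ?thesis using *[of e x] *[of "(+) x ` e" "- x"] by metis
qed

lemma distr_shift: "distr clock_measure clock_measure (shift_clocks x) = clock_measure"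
proof -
  have "distr (\<Pi>\<^sub>M e\<in>lattice_edges. unif) (\<Pi>\<^sub>M e\<in>lattice_edges. unif) (\<lambda>U. \<lambda>e\<in>lattice_edges. U ((+) x ` e)) =
    (\<Pi>\<^sub>M e\<in>lattice_edges. unif)"
    by (rule distr_PiM_reindex[of lattice_edges "\<lambda>_. unif" "(`) ((+) x)" lattice_edges])
      (auto simp: prob_space_unif translate_lattice_edge inj_image_eq_iff intro!: inj_onI)
  then show ?thesis by (simp add: clock_measure_def shift_clocks_def[abs_def])
qed

lemma measurable_shift_clocks [measurable]: "shift_clocks x \<in> measurable clock_measure clock_measure"
  by (rule measurable_into_clock)
    (auto simp: shift_clocks_def translate_lattice_edge intro!: measurable_clock_component)

lemma admits_shift:
  assumes "A \<subseteq> lattice_edges" "e \<in> lattice_edges"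
  shows "admits k (shift_clocks x U) (translate x A) e \<longleftrightarrow> admits k U A ((+) x ` e)"
proof -
  have "card {y. {y, u} \<in> translate x A \<and> shift_clocks x U {y, u} < shift_clocks x U e} =
      card {y. {y, x + u} \<in> A \<and> U {y, x + u} < U ((+) x ` e)}" for u
  proof -
    have "shift_clocks x U {y, u} = U {x + y, x + u}" if "{x + y, x + u} \<in> A" for y
      using that assms(1) translate_lattice_edge[of x "{y, u}"] by (auto simp: shift_clocks_def)
    moreover have "shift_clocks x U e = U ((+) x ` e)" using assms(2) by (simp add: shift_clocks_def)
    ultimately have "{y. {y, u} \<in> translate x A \<and> shift_clocks x U {y, u} < shift_clocks x U e} =
        {y. {x + y, x + u} \<in> A \<and> U {x + y, x + u} < U ((+) x ` e)}"
      by (auto simp: translate_def)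
    moreover have "(+) x ` \<dots> = {y. {y, x + u} \<in> A \<and> U {y, x + u} < U ((+) x ` e)}"
    proof -
      have "v \<in> (+) x ` {y. {x + y, x + u} \<in> A \<and> U {x + y, x + u} < U ((+) x ` e)}"
        if "{v, x + u} \<in> A" "U {v, x + u} < U ((+) x ` e)" for v
        using that by (intro image_eqI[of _ _ "v - x"]) auto
      then show ?thesis by auto
    qed
    ultimately show ?thesis using card_image[OF inj_on_add[of x "{y. {x + y, x + u} \<in> A \<and> U {x + y, x + u} < U ((+) x ` e)}"]] by simp
  qed
  then show ?thesis by (simp add: admits_def)
qed

lemma approx_shift: "approx k t (shift_clocks x U) n = translate x (approx k t U n)"
proof (induction n)
  case 0 show ?case by (simp add: translate_def translate_lattice_edge)
next
  case (Suc n)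
  have "e \<in> approx k t (shift_clocks x U) (Suc n) \<longleftrightarrow> e \<in> translate x (approx k t U (Suc n))" for e
  proof (cases "e \<in> lattice_edges")
    case True
    then show ?thesis using admits_shift[OF approx_subset True, of k x U k t U n] Suc
      by (simp add: translate_def translate_lattice_edge) (simp add: shift_clocks_def)
  next
    case False then show ?thesis by (simp add: translate_def translate_lattice_edge)
  qed
  then show ?case by blast
qed

text \<open>This holds for every \<open>U\<close>, regular or not, because the iterates commute with
  shifts; so events are translation invariant without an exceptional set.\<close>

lemma config_shift: "config k t (shift_clocks x U) = translate x (config k t U)"
  by (auto simp: config_def approx_shift) (auto simp: translate_def)

lemma cluster_translate:
  "y \<in> cluster (translate x \<omega>) S z \<longleftrightarrow> x + y \<in> cluster \<omega> ((+) x ` S) (x + z)"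
proof
  assume "y \<in> cluster (translate x \<omega>) S z"
  then show "x + y \<in> cluster \<omega> ((+) x ` S) (x + z)"
  proof (induction rule: cluster_induct)
    case (step y w)
    then show ?case using cluster_step[of "x + y" \<omega> "(+) x ` S" "x + z" "x + w"]
      by (auto simp: translate_def inj_image_mem_iff)
  qed simp
next
  have "v - x \<in> cluster (translate x \<omega>) S z" if "v \<in> cluster \<omega> ((+) x ` S) (x + z)" for v
    using that
  proof (induction rule: cluster_induct)
    case (step v w)
    have "v - x \<notin> S" "w - x \<notin> S" using step(3,4) by (force simp: image_iff)+
    moreover have "{v - x, w - x} \<in> translate x \<omega>" using step(2) by (simp add: translate_def)
    ultimately show ?case using step(5) cluster_step by metis
  qed simp
  from this[of "x + y"] show "x + y \<in> cluster \<omega> ((+) x ` S) (x + z) \<Longrightarrow> y \<in> cluster (translate x \<omega>) S z"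
    by simp
qed

lemma infinite_cluster_translate:
  "infinite (cluster (translate x \<omega>) S z) \<longleftrightarrow> infinite (cluster \<omega> ((+) x ` S) (x + z))"
proof -
  have "y \<in> (+) x ` cluster (translate x \<omega>) S z" if "y \<in> cluster \<omega> ((+) x ` S) (x + z)" for y
    using cluster_translate[of "y - x" x \<omega> S z] that by (force simp: image_iff intro: bexI[of _ "y - x"])
  then have "(+) x ` cluster (translate x \<omega>) S z = cluster \<omega> ((+) x ` S) (x + z)"
    using cluster_translate[of _ x \<omega> S z] by auto
  then show ?thesis by (metis finite_image_iff inj_on_add)
qed

lemma nbrs_translate: "card (nbrs (translate x \<omega>) u) = card (nbrs \<omega> (x + u))"
proof -
  have "y \<in> (+) x ` nbrs (translate x \<omega>) u" if "y \<in> nbrs \<omega> (x + u)" for y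
    using that by (intro image_eqI[of _ _ "y - x"]) (auto simp: nbrs_def translate_def)
  then have "(+) x ` nbrs (translate x \<omega>) u = nbrs \<omega> (x + u)" by (auto simp: nbrs_def translate_def)
  then show ?thesis by (metis card_image inj_on_add)
qed

subsection \<open>Measurability\<close>

text \<open>The cardinality condition is turned into finite quantifiers: every set of at least
  \<open>k\<close> lattice neighbours has a member whose edge is not open with an earlier
  clock.\<close>

lemma pred_approx [measurable]:
  fixes e :: "'d::finite edge"
  shows "Measurable.pred clock_measure (\<lambda>U. e \<in> approx k t U n)"
proof (induction n arbitrary: e)
  case (Suc n)
  show ?case
  proof (cases "e \<in> lattice_edges")
    case True
    define F where "F u = {S. S \<subseteq> nbrs lattice_edges u \<and> k \<le> card S}" for u :: "int ^ 'd"
    have fin: "finite (F u)" "S \<in> F u \<Longrightarrow> finite S" for u S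
      using finite_nbrs_lattice[of u] by (auto simp: F_def intro: finite_subset)
    have *: "card {x. {x, u} \<in> approx k t U n \<and> U {x, u} < U e} < k \<longleftrightarrow>
      (\<forall>S\<in>F u. \<exists>x\<in>S. \<not> ({x, u} \<in> approx k t U n \<and> U {x, u} < U e))" for u U
    proof -
      let ?X = "{x. {x, u} \<in> approx k t U n \<and> U {x, u} < U e}"
      have X: "?X \<subseteq> nbrs lattice_edges u" using approx_subset[of k t U n] by (auto simp: nbrs_def)
      then have "finite ?X" using finite_nbrs_lattice by (rule finite_subset)
      show ?thesis
      proof
        assume "card ?X < k"
        then have "\<not> S \<subseteq> ?X" if "S \<in> F u" for S
          using that card_mono[OF \<open>finite ?X\<close>, of S] by (auto simp: F_def)
        then show "\<forall>S\<in>F u. \<exists>x\<in>S. \<not> ({x, u} \<in> approx k t U n \<and> U {x, u} < U e)" by blast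
      next
        assume *: "\<forall>S\<in>F u. \<exists>x\<in>S. \<not> ({x, u} \<in> approx k t U n \<and> U {x, u} < U e)"
        have "?X \<notin> F u" using bspec[OF *, of ?X] by auto
        then show "card ?X < k" using X by (auto simp: F_def)
      qed
    qed
    have "Measurable.pred clock_measure (\<lambda>U. {x, u} \<in> approx k t U n \<and> U {x, u} < U e)"
      if "S \<in> F u" "x \<in> S" for S u x
    proof -
      have [measurable]: "(\<lambda>U. U {x, u}) \<in> borel_measurable clock_measure"
        "(\<lambda>U. U e) \<in> borel_measurable clock_measure"
        "Measurable.pred clock_measure (\<lambda>U. {x, u} \<in> approx k t U n)"
        using that True Suc by (auto simp: F_def nbrs_def)
      show ?thesis by measurable
    qed
    then have "Measurable.pred clock_measure (\<lambda>U. \<forall>u\<in>e. \<forall>S\<in>F u. \<exists>x\<in>S. \<not> ({x, u} \<in> approx k t U n \<and> U {x, u} < U e))"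
      using fin lattice_edge_finite[OF True]
      by (intro pred_intros_finite pred_intros_logic(2)) auto
    moreover have "Measurable.pred clock_measure (\<lambda>U. U e \<le> t)" using True by measurable
    ultimately show ?thesis using True by (simp add: admits_def *)
  qed simp
qed simp

lemma pred_config [measurable]: "Measurable.pred clock_measure (\<lambda>U. e \<in> config k t U)"
  unfolding config_def mem_Collect_eq by measurable

text \<open>A vertex of the cluster is reached in some number of steps through countably many
  possible vertices, so countable unions suffice.\<close>

lemma pred_cluster [measurable (raw)]:
  fixes \<omega> :: "'a \<Rightarrow> 'v::countable set set"
  assumes [measurable]: "\<And>e. Measurable.pred N (\<lambda>U. e \<in> \<omega> U)"
  shows "Measurable.pred N (\<lambda>U. y \<in> cluster (\<omega> U) S x)"
proof -
  have "Measurable.pred N (\<lambda>U. (x, y) \<in> adj (\<omega> U) S ^^ n)" for n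
  proof (induction n arbitrary: y)
    case (Suc n)
    have "(x, y) \<in> adj (\<omega> U) S ^^ Suc n \<longleftrightarrow>
      (\<exists>z. (x, z) \<in> adj (\<omega> U) S ^^ n \<and> {z, y} \<in> \<omega> U \<and> z \<notin> S \<and> y \<notin> S)" for U
      by (auto simp: adj_def)
    with Suc show ?case by simp
  qed simp
  then show ?thesis by (simp add: cluster_def rtrancl_power)
qed

lemma infinite_iff_cubes: "infinite (A :: (int ^ 'd::finite) set) \<longleftrightarrow> (\<forall>n. \<exists>y. y \<in> A \<and> y \<notin> cube n)"
  by (metis finite_cube finite_subset finite_subset_cube subset_iff)

lemma pred_infinite_cluster [measurable (raw)]:
  fixes \<omega> :: "'a \<Rightarrow> 'd::finite edge set"
  assumes [measurable]: "\<And>e. Measurable.pred N (\<lambda>U. e \<in> \<omega> U)"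
  shows "Measurable.pred N (\<lambda>U. infinite (cluster (\<omega> U) S x))"
  unfolding infinite_iff_cubes by measurable

subsection \<open>Translation-covariant random sets with few points have none\<close>

lemma measure_shift:
  assumes "Measurable.pred clock_measure P"
  shows "measure clock_measure {U \<in> space clock_measure. P (shift_clocks x U)} = measure clock_measure {U \<in> space clock_measure. P U}"
proof -
  have "measure (distr clock_measure clock_measure (shift_clocks x)) {U \<in> space clock_measure. P U} =
      measure clock_measure (shift_clocks x -` {U \<in> space clock_measure. P U} \<inter> space clock_measure)"
    using assms by (intro measure_distr) auto
  moreover have "shift_clocks x -` {U \<in> space clock_measure. P U} \<inter> space clock_measure =
      {U \<in> space clock_measure. P (shift_clocks x U)}"
    using measurable_space[OF measurable_shift_clocks[of x]] by auto
  ultimately show ?thesis by (simp only: distr_shift)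
qed

text \<open>By translation invariance the mean number of points in a cube is its volume times the
  probability of a point at 0. As this number is at most the size of the boundary layer, the
  probability is at most boundary over volume, which tends to 0.\<close>

lemma AE_none_if_few:
  fixes A :: "int ^ 'd::finite \<Rightarrow> ('d edge \<Rightarrow> real) \<Rightarrow> bool"
  assumes meas: "\<And>x. Measurable.pred clock_measure (A x)"
    and shift: "\<And>x U. A x U \<longleftrightarrow> A 0 (shift_clocks x U)"
    and few: "\<And>n. AE U in clock_measure. card {x \<in> cube n. A x U} \<le> card (cube (Suc n) - cube n :: (int ^ 'd) set)"
  shows "AE U in clock_measure. \<forall>x. \<not> A x U"
proof -
  interpret C: prob_space "clock_measure :: ('d edge \<Rightarrow> real) measure" by (rule prob_space_clock)
  define E where "E x = {U \<in> space clock_measure. A x U}" for x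
  have E: "E x \<in> sets clock_measure" for x using meas by (auto simp: E_def)
  have int_E: "integrable clock_measure (indicator (E x) :: _ \<Rightarrow> real)" for x
    by (intro integrable_real_indicator E) (simp add: C.emeasure_eq_measure)
  have prob_E: "C.prob (E x) = C.prob (E 0)" for x
    unfolding E_def using measure_shift[OF meas[of 0], of x] shift[of x] by simp
  \<comment> \<open>The volumes are (2n+1)^d and (2n+3)^d; the bound is their ratio minus 1.\<close>
  have bound: "C.prob (E 0) \<le> (1 + 2 / real (2 * n + 1)) ^ CARD('d) - 1" for n
  proof -
    let ?V = "cube n :: (int ^ 'd) set" and ?W = "cube (Suc n) :: (int ^ 'd) set"
    have "(\<Sum>x\<in>?V. C.prob (E x)) = (\<Sum>x\<in>?V. C.prob (E 0))" by (intro sum.cong prob_E refl)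
    then have "real (card ?V) * C.prob (E 0) = (\<Sum>x\<in>?V. C.prob (E x))" by simp
    also have "\<dots> = C.expectation (\<lambda>U. \<Sum>x\<in>?V. indicator (E x) U)"
      using E int_E by (subst Bochner_Integration.integral_sum) auto
    also have "\<dots> \<le> C.expectation (\<lambda>_. real (card (?W - ?V)))"
    proof (rule integral_mono_AE)
      show "AE U in clock_measure. (\<Sum>x\<in>?V. indicator (E x) U) \<le> real (card (?W - ?V))"
        using few[of n] AE_space
      proof eventually_elim
        fix U :: "'d edge \<Rightarrow> real"
        assume U: "card {x \<in> ?V. A x U} \<le> card (?W - ?V)" "U \<in> space clock_measure"
        have "(\<Sum>x\<in>?V. indicator (E x) U) = (\<Sum>x\<in>?V. if A x U then 1 else 0 :: real)"
          using U(2) by (intro sum.cong) (auto simp: E_def)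
        also have "\<dots> = real (card {x \<in> ?V. A x U})" by (simp add: sum.If_cases Int_def)
        finally show "(\<Sum>x\<in>?V. indicator (E x) U) \<le> real (card (?W - ?V))" using U(1) by simp
      qed
    qed (use int_E in auto)
    also have "\<dots> = real (card ?W) - real (card ?V)"
      using cube_mono[of n "Suc n", where 'a = 'd] card_mono[OF finite_cube cube_mono[of n "Suc n", where 'a = 'd]]
      by (simp add: C.prob_space card_Diff_subset of_nat_diff)
    finally have "real (card ?V) * C.prob (E 0) \<le> real (card ?W) - real (card ?V)" .
    moreover have "real (card ?W) = (1 + 2 / real (2 * n + 1)) ^ CARD('d) * real (card ?V)"
    proof -
      have "real (card ?W) = real (2 * n + 3) ^ CARD('d)" by (simp add: card_cube add.commute)
      also have "real (2 * n + 3) = (1 + 2 / real (2 * n + 1)) * real (2 * n + 1)" by (simp add: field_simps)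
      finally show ?thesis by (simp only: power_mult_distrib card_cube of_nat_power)
    qed
    ultimately have "C.prob (E 0) * real (card ?V) \<le> ((1 + 2 / real (2 * n + 1)) ^ CARD('d) - 1) * real (card ?V)"
      by (simp add: algebra_simps)
    moreover have "0 < real (card ?V)" by (simp add: card_cube)
    ultimately show ?thesis by (rule mult_right_le_imp_le)
  qed
  have "(\<lambda>n. 2 / real (2 * n + 1)) \<longlonglongrightarrow> 0"
    using LIMSEQ_subseq_LIMSEQ[OF lim_const_over_n[of "2::real"], of "\<lambda>n. 2 * n + 1"]
    by (simp add: strict_mono_def o_def)
  then have "(\<lambda>n. (1 + 2 / real (2 * n + 1)) ^ CARD('d) - 1) \<longlonglongrightarrow> (1 + 0) ^ CARD('d) - 1"
    by (intro tendsto_intros)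
  then have "C.prob (E 0) \<le> (1 + 0) ^ CARD('d) - 1" using bound by (intro LIMSEQ_le_const) auto
  then have "C.prob (E 0) = 0" using measure_nonneg[of clock_measure "E 0"] by simp
  then have "E x \<in> null_sets clock_measure" for x
    using E prob_E[of x] by (intro null_setsI) (auto simp: C.emeasure_eq_measure)
  then have "AE U in clock_measure. \<not> A x U" for x
    by (intro AE_I'[of "E x"]) (auto simp: E_def)
  then show ?thesis by (simp add: AE_all_countable)
qed

subsection \<open>Ergodicity\<close>

text \<open>If the pairwise independent events \<open>B i\<close> all have the same covariance \<open>c\<close> with \<open>A\<close>, then
  the sum of their first \<open>n\<close> indicators has covariance \<open>n c\<close> with \<open>A\<close> but standard deviation at most \<open>sqrt n\<close>.\<close>

lemma (in prob_space) constant_covariance: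
  assumes A: "A \<in> events" and B: "\<And>i::nat. B i \<in> events" "\<And>i. prob (B i) = b"
    and BB: "\<And>i j. i \<noteq> j \<Longrightarrow> prob (B i \<inter> B j) = b * b" and AB: "\<And>i. prob (A \<inter> B i) = q"
  shows "q = prob A * b"
proof -
  define c where "c = q - prob A * b"
  have main: "real n * c\<^sup>2 \<le> 1" if "0 < n" for n
  proof -
    let ?m = "real n" and ?I = "\<lambda>X. indicator X :: 'a \<Rightarrow> real"
    have BBm: "B i \<inter> B j \<in> events" and ABm: "A \<inter> B i \<in> events" for i j using A B by auto
    \<comment> \<open>A nonnegative square does the work of Cauchy-Schwarz. With the coefficient n c
      at \<open>A\<close>, the terms that involve \<open>A\<close> have expectation (n c)^2 (P(A) -
      2), at most -(n c)^2, against a variance of at most n.\<close>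
    have eq: "(?m * c * ?I A x - ((\<Sum>i<n. ?I (B i) x) - ?m * b))\<^sup>2 =
      (?m * c)\<^sup>2 * ?I A x - 2 * ?m * c * ((\<Sum>i<n. ?I (A \<inter> B i) x) - ?m * b * ?I A x) +
      (\<Sum>i<n. \<Sum>j<n. ?I (B i \<inter> B j) x) - 2 * ?m * b * (\<Sum>i<n. ?I (B i) x) + (?m * b)\<^sup>2" for x
    proof -
      define S where "S = (\<Sum>i<n. ?I (B i) x)"
      have "(\<Sum>i<n. ?I (A \<inter> B i) x) = ?I A x * S" by (simp add: S_def sum_distrib_left indicator_inter_arith)
      moreover have "(\<Sum>i<n. \<Sum>j<n. ?I (B i \<inter> B j) x) = S * S"
        by (simp add: S_def sum_product indicator_inter_arith)
      moreover have "(?I A x)\<^sup>2 = ?I A x" by (simp add: indicator_def)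
      ultimately show ?thesis unfolding S_def[symmetric] by algebra
    qed
    have "0 \<le> expectation (\<lambda>x. (?m * c * ?I A x - ((\<Sum>i<n. ?I (B i) x) - ?m * b))\<^sup>2)"
      by (rule integral_nonneg_AE) simp
    also have "\<dots> = (?m * c)\<^sup>2 * prob A - 2 * ?m * c * ((\<Sum>i<n. prob (A \<inter> B i)) - ?m * b * prob A) +
      (\<Sum>i<n. \<Sum>j<n. prob (B i \<inter> B j)) - 2 * ?m * b * (\<Sum>i<n. prob (B i)) + (?m * b)\<^sup>2"
      unfolding eq using A B(1) BBm ABm by (simp add: prob_space emeasure_eq_measure)
    also have "(\<Sum>i<n. \<Sum>j<n. prob (B i \<inter> B j)) = (\<Sum>i<n. \<Sum>j<n. b * b + (if i = j then b - b * b else 0))"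
      using BB B(2) by (intro sum.cong) auto
    also have "\<dots> = ?m * ?m * (b * b) + ?m * (b - b * b)"
      by (simp add: sum.distrib algebra_simps)
    also have "(\<Sum>i<n. prob (A \<inter> B i)) - ?m * b * prob A = ?m * c"
      by (simp add: AB c_def algebra_simps)
    also have "(\<Sum>i<n. prob (B i)) = ?m * b" by (simp add: B(2))
    finally have "?m * ?m * c\<^sup>2 * (2 - prob A) \<le> ?m * (b - b * b)"
      by (simp add: power2_eq_square algebra_simps)
    moreover have "?m * ?m * c\<^sup>2 * 1 \<le> ?m * ?m * c\<^sup>2 * (2 - prob A)"
      by (intro mult_left_mono) auto
    moreover have "0 \<le> b" "b \<le> 1" using B(2)[of 0] prob_le_1 measure_nonneg by metis+
    then have "b - b * b \<le> 1" using mult_nonneg_nonneg[of b b] by linarith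
    then have "?m * (b - b * b) \<le> ?m * 1" by (intro mult_left_mono) auto
    ultimately have "?m * (?m * c\<^sup>2) \<le> ?m * 1" by (simp add: mult.assoc)
    then show ?thesis using that by (simp add: mult_le_cancel_left_pos)
  qed
  have "c\<^sup>2 \<le> 1 / real (Suc n)" for n using main[of "Suc n"] by (simp add: field_simps)
  then have "c\<^sup>2 \<le> 0" using LIMSEQ_inverse_real_of_nat
    by (intro LIMSEQ_le_const[of "\<lambda>n. 1 / real (Suc n)"]) (auto simp: inverse_eq_divide)
  then show ?thesis by (simp add: c_def)
qed

lemma clock_rectangles_independent:
  fixes J K :: "'d::finite edge set"
  assumes J: "finite J" "J \<subseteq> lattice_edges" "\<And>e. e \<in> J \<Longrightarrow> A e \<in> sets borel"
    and K: "finite K" "K \<subseteq> lattice_edges" "\<And>e. e \<in> K \<Longrightarrow> B e \<in> sets borel" and "J \<inter> K = {}"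
  shows "measure clock_measure
      ({U \<in> space clock_measure. \<forall>e\<in>J. U e \<in> A e} \<inter> {U \<in> space clock_measure. \<forall>e\<in>K. U e \<in> B e}) =
    measure clock_measure {U \<in> space clock_measure. \<forall>e\<in>J. U e \<in> A e} *
    measure clock_measure {U \<in> space clock_measure. \<forall>e\<in>K. U e \<in> B e}"
proof -
  interpret C: prob_space "clock_measure :: ('d edge \<Rightarrow> real) measure" by (rule prob_space_clock)
  define D where "D e = (if e \<in> J then A e else B e)" for e
  have D: "D e = A e" if "e \<in> J" for e using that by (simp add: D_def)
  have D': "D e = B e" if "e \<in> K" for e using that \<open>J \<inter> K = {}\<close> by (auto simp: D_def)
  have "{U \<in> space clock_measure. \<forall>e\<in>J. U e \<in> A e} \<inter> {U \<in> space clock_measure. \<forall>e\<in>K. U e \<in> B e} =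
      {U \<in> space clock_measure. \<forall>e\<in>J \<union> K. U e \<in> D e}"
    by (intro set_eqI, simp add: ball_Un D D') blast
  also have "emeasure clock_measure \<dots> = (\<Prod>e\<in>J \<union> K. emeasure unif (D e))"
    using J K D D' by (intro clock_rectangle(2)) auto
  also have "\<dots> = (\<Prod>e\<in>J. emeasure unif (D e)) * (\<Prod>e\<in>K. emeasure unif (D e))"
    using J K \<open>J \<inter> K = {}\<close> by (intro prod.union_disjoint)
  also have "(\<Prod>e\<in>J. emeasure unif (D e)) = (\<Prod>e\<in>J. emeasure unif (A e))" using D by (intro prod.cong) auto
  also have "(\<Prod>e\<in>K. emeasure unif (D e)) = (\<Prod>e\<in>K. emeasure unif (B e))" using D' by (intro prod.cong) auto
  also have "(\<Prod>e\<in>J. emeasure unif (A e)) * (\<Prod>e\<in>K. emeasure unif (B e)) =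
      emeasure clock_measure {U \<in> space clock_measure. \<forall>e\<in>J. U e \<in> A e} *
      emeasure clock_measure {U \<in> space clock_measure. \<forall>e\<in>K. U e \<in> B e}"
    using J K by (simp only: clock_rectangle(2))
  finally show ?thesis by (simp add: measure_def enn2real_mult)
qed

text \<open>Far translates of a rectangle are pairwise independent, and an invariant event
  \<open>S\<close> has the same covariance with each of them; by \<open>constant_covariance\<close>
  it is 0. So \<open>S\<close> is independent of every rectangle, hence of itself.\<close>

lemma clock_zero_one:
  fixes A :: "('d::finite edge \<Rightarrow> real) \<Rightarrow> bool"
  assumes meas: "Measurable.pred clock_measure A" and inv: "\<And>x U. A (shift_clocks x U) \<longleftrightarrow> A U"
  shows "(AE U in clock_measure. A U) \<or> (AE U in clock_measure. \<not> A U)"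
proof -
  interpret C: prob_space "clock_measure :: ('d edge \<Rightarrow> real) measure" by (rule prob_space_clock)
  define S where "S = {U \<in> space clock_measure. A U}"
  have S: "S \<in> sets clock_measure" using meas by (auto simp: S_def)
  have indep: "C.prob (S \<inter> R) = C.prob S * C.prob R"
    if J: "finite J" "J \<subseteq> lattice_edges" "\<And>e. e \<in> J \<Longrightarrow> X e \<in> sets borel"
      and R: "R = {U \<in> space clock_measure. \<forall>e\<in>J. U e \<in> X e}" for J X R
  proof -
    have "finite (\<Union>J)" using J(1,2) lattice_edge_finite by (intro finite_Union) auto
    then obtain m where m: "\<Union>J \<subseteq> cube m" by (rule finite_subset_cube)
    \<comment> \<open>A cube of radius m has 2m + 1 points per side, so its translates by different
      multiples of this are disjoint.\<close>
    define v :: "nat \<Rightarrow> int ^ 'd" where "v i = (\<chi> _. int i * (2 * int m + 1))" for i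
    define K where "K i = (`) ((+) (v i)) ` J" for i
    define Y where "Y i e = X ((+) (- v i) ` e)" for i e
    define B where "B i = {U \<in> space clock_measure. \<forall>e\<in>K i. U e \<in> Y i e}" for i
    have K: "finite (K i)" "K i \<subseteq> lattice_edges" "e \<in> K i \<Longrightarrow> Y i e \<in> sets borel" for i e
      using J by (auto simp: K_def Y_def translate_lattice_edge image_image)
    have R_meas: "Measurable.pred clock_measure (\<lambda>U. \<forall>e\<in>J. U e \<in> X e)"
      using clock_rectangle(1)[OF J] by (simp add: pred_def)
    have B_shift: "B i = {U \<in> space clock_measure. \<forall>e\<in>J. shift_clocks (v i) U e \<in> X e}" for i
      using J(2) by (auto simp: B_def K_def Y_def shift_clocks_def image_image subset_eq)
    have disj: "K i \<inter> K j = {}" if "i \<noteq> j" for i j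
    proof (rule ccontr)
      assume "K i \<inter> K j \<noteq> {}"
      then obtain e f where e: "e \<in> J" "f \<in> J" "(+) (v i) ` e = (+) (v j) ` f"
        by (auto simp: K_def)
      have "e \<noteq> {}" using e(1) J(2) lattice_edge_finite[of e] by auto
      then obtain y where "y \<in> e" by auto
      then have "v i + y \<in> (+) (v j) ` f" using e(3) by auto
      with \<open>y \<in> e\<close> obtain z where yz: "y \<in> e" "z \<in> f" "v i + y = v j + z" by auto
      have "y \<in> cube m" "z \<in> cube m" using yz e m by auto
      \<comment> \<open>\<open>undefined\<close> stands for some coordinate; the \<open>v i\<close>
        have all coordinates equal.\<close>
      then have le: "\<bar>y $ undefined\<bar> \<le> int m" "\<bar>z $ undefined\<bar> \<le> int m" by (simp_all add: cube_def)
      have "int i * (2 * int m + 1) + y $ undefined = int j * (2 * int m + 1) + z $ undefined"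
        using arg_cong[OF yz(3), of "\<lambda>w. w $ undefined"] by (simp add: v_def)
      then have "(int i - int j) * (2 * int m + 1) = z $ undefined - y $ undefined"
        unfolding left_diff_distrib by linarith
      then have upper: "\<bar>(int i - int j) * (2 * int m + 1)\<bar> \<le> 2 * int m" using le by linarith
      have "1 \<le> \<bar>int i - int j\<bar>" using that by simp
      then have "1 * (2 * int m + 1) \<le> \<bar>int i - int j\<bar> * (2 * int m + 1)" by (intro mult_right_mono) auto
      also have "\<dots> = \<bar>(int i - int j) * (2 * int m + 1)\<bar>" by (simp add: abs_mult)
      also note upper
      finally show False by simp
    qed
    have prob_B: "C.prob (B i) = C.prob R" for i
      unfolding B_shift R by (rule measure_shift[OF R_meas])
    have prob_SB: "C.prob (S \<inter> B i) = C.prob (S \<inter> R)" for i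
    proof -
      have "S \<inter> B i = {U \<in> space clock_measure. A (shift_clocks (v i) U) \<and> (\<forall>e\<in>J. shift_clocks (v i) U e \<in> X e)}"
        by (auto simp: S_def B_shift inv)
      moreover have "S \<inter> R = {U \<in> space clock_measure. A U \<and> (\<forall>e\<in>J. U e \<in> X e)}"
        by (auto simp: S_def R)
      moreover have "Measurable.pred clock_measure (\<lambda>U. A U \<and> (\<forall>e\<in>J. U e \<in> X e))"
        by (intro pred_intros_logic meas R_meas)
      ultimately show ?thesis using measure_shift[of "\<lambda>U. A U \<and> (\<forall>e\<in>J. U e \<in> X e)" "v i"] by simp
    qed
    show ?thesis
    proof (rule C.constant_covariance[OF S, of B])
      show "B i \<in> sets clock_measure" for i unfolding B_def by (rule clock_rectangle(1)[OF K])
      show "C.prob (B i) = C.prob R" for i by (rule prob_B)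
      show "C.prob (S \<inter> B i) = C.prob (S \<inter> R)" for i by (rule prob_SB)
      show "C.prob (B i \<inter> B j) = C.prob R * C.prob R" if "i \<noteq> j" for i j
      proof -
        have "C.prob (B i \<inter> B j) = C.prob (B i) * C.prob (B j)"
          unfolding B_def by (rule clock_rectangles_independent[OF K K disj[OF that]])
        then show ?thesis by (simp add: prob_B)
      qed
    qed
  qed
  \<comment> \<open>The two measures agree on rectangles, hence everywhere; evaluated at
    \<open>S\<close> this reads P(S) = P(S)^2.\<close>
  have "density clock_measure (indicator S) = scale_measure (emeasure clock_measure S) clock_measure"
  proof (rule measure_eqI_PiM_infinite[where I = "lattice_edges :: 'd edge set" and M = "\<lambda>_. unif"])
    fix X :: "'d edge \<Rightarrow> real set" and J :: "'d edge set"
    assume J: "finite J" "J \<subseteq> lattice_edges" "\<And>i. i \<in> J \<Longrightarrow> X i \<in> sets unif"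
    let ?R = "{U \<in> space clock_measure. \<forall>e\<in>J. U e \<in> X e}"
    have eq: "prod_emb lattice_edges (\<lambda>_. unif) J (Pi\<^sub>E J X) = ?R"
      using J(2) by (auto simp: prod_emb_def space_clock PiE_iff extensional_def)
    have R: "?R \<in> sets clock_measure" using J by (intro clock_rectangle(1)) auto
    have "C.prob (S \<inter> ?R) = C.prob S * C.prob ?R" using J by (intro indep[of J X]) auto
    then have "emeasure clock_measure (S \<inter> ?R) = emeasure clock_measure S * emeasure clock_measure ?R"
      by (simp add: C.emeasure_eq_measure ennreal_mult)
    then show "emeasure (density clock_measure (indicator S)) (prod_emb lattice_edges (\<lambda>_. unif) J (Pi\<^sub>E J X)) =
        emeasure (scale_measure (emeasure clock_measure S) clock_measure)
          (prod_emb lattice_edges (\<lambda>_. unif) J (Pi\<^sub>E J X))"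
      unfolding eq using S R by (simp add: emeasure_restricted)
  next
    show "finite_measure (density clock_measure (indicator S))"
      using S by (intro finite_measureI) (simp add: emeasure_restricted C.emeasure_eq_measure)
  qed (simp_all add: clock_measure_def)
  then have "emeasure (density clock_measure (indicator S)) S =
      emeasure (scale_measure (emeasure clock_measure S) clock_measure) S"
    by simp
  then have "C.prob S = C.prob S * C.prob S"
    using S by (simp add: emeasure_restricted C.emeasure_eq_measure flip: ennreal_mult)
  then have "C.prob S = 0 \<or> C.prob S = 1" by auto
  then show ?thesis
  proof
    assume "C.prob S = 0"
    then have "S \<in> null_sets clock_measure" using S by (intro null_setsI) (simp add: C.emeasure_eq_measure)
    then have "AE U in clock_measure. \<not> A U" by (rule AE_I') (auto simp: S_def)
    then show ?thesis ..
  next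
    assume "C.prob S = 1"
    then have "AE U in clock_measure. U \<in> S" using S C.prob_eq_1 by simp
    then have "AE U in clock_measure. A U" by (rule AE_mp) (auto simp: S_def)
    then show ?thesis ..
  qed
qed

subsection \<open>Uniqueness\<close>

definition several_infinite :: "nat \<Rightarrow> 'd::finite edge set \<Rightarrow> bool" where
  "several_infinite m \<omega> \<longleftrightarrow> (\<exists>x :: nat \<Rightarrow> int ^ 'd. (\<forall>i<m. infinite (cluster \<omega> {} (x i))) \<and>
     (\<forall>i<m. \<forall>j<m. i \<noteq> j \<longrightarrow> x j \<notin> cluster \<omega> {} (x i)))"

text \<open>The cube contains a vertex of each of the \<open>m\<close> clusters, so each of them has
  an infinite piece outside that hangs on the cube by an edge from \<open>a i\<close> to
  \<open>s i\<close>; the tripod joins the \<open>s i\<close>, whence \<open>m \<le> 3\<close>. Both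
  the cut and the joined configuration are provided, as merging two clusters refers to both.\<close>

lemma star_exists:
  fixes \<omega> :: "'d::finite edge set"
  assumes \<omega>: "\<omega> \<subseteq> lattice_edges" "\<And>u. card (nbrs \<omega> u) \<le> k"
    and m: "0 < m" "m \<le> 3" "m \<le> k" "2 \<le> k" and several: "several_infinite m \<omega>"
  obtains \<Lambda> a M c where "star \<omega> \<Lambda> k {..<m} a M c"
    "\<forall>i<m. infinite (cluster \<omega> \<Lambda> (a i))"
    "local_variant k \<omega> (star.base \<omega> \<Lambda>)" "local_variant k \<omega> (star.joined \<omega> \<Lambda> {..<m} a M c)"
proof -
  obtain x :: "nat \<Rightarrow> int ^ 'd" where inf: "\<And>i. i < m \<Longrightarrow> infinite (cluster \<omega> {} (x i))"
    and sep: "\<And>i j. i < m \<Longrightarrow> j < m \<Longrightarrow> i \<noteq> j \<Longrightarrow> x j \<notin> cluster \<omega> {} (x i)"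
    using several unfolding several_infinite_def by blast
  obtain n where n: "x ` {..<m} \<subseteq> cube n" using finite_subset_cube[of "x ` {..<m}"] by auto
  define \<Lambda> where "\<Lambda> = (cube n :: (int ^ 'd) set)"
  have "\<exists>a s. a \<notin> \<Lambda> \<and> s \<in> \<Lambda> \<and> {a, s} \<in> \<omega> \<and> a \<in> cluster \<omega> {} (x i) \<and> infinite (cluster \<omega> \<Lambda> a)"
    if "i < m" for i
  proof -
    have "x i \<in> \<Lambda>" using n that by (auto simp: \<Lambda>_def)
    then show ?thesis
      using infinite_cluster_split[of \<omega> \<Lambda> "x i"] finite_nbrs[OF \<omega>(1)] inf[OF that] by (metis \<Lambda>_def finite_cube)
  qed
  then obtain a s where as: "\<And>i. i < m \<Longrightarrow> a i \<notin> \<Lambda>" "\<And>i. i < m \<Longrightarrow> s i \<in> \<Lambda>" "\<And>i. i < m \<Longrightarrow> {a i, s i} \<in> \<omega>"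
    "\<And>i. i < m \<Longrightarrow> a i \<in> cluster \<omega> {} (x i)" "\<And>i. i < m \<Longrightarrow> infinite (cluster \<omega> \<Lambda> (a i))"
    by metis
  \<comment> \<open>For m = 2 there is no third entry point; repeating \<open>s 0\<close> lets the
    tripod serve this case too.\<close>
  define y where "y i = (if i < m then s i else s 0)" for i
  have y: "y i \<in> \<Lambda>" for i using as(2) m(1) by (simp add: y_def)
  obtain c M\<^sub>1 M\<^sub>2 M\<^sub>3 where tri: "c \<in> \<Lambda>"
    "set M\<^sub>1 \<union> set M\<^sub>2 \<union> set M\<^sub>3 \<subseteq> \<Lambda> - {c}" "distinct (M\<^sub>1 @ M\<^sub>2 @ M\<^sub>3)"
    "hd (M\<^sub>1 @ [c]) = y 0" "hd (M\<^sub>2 @ [c]) = y 1" "hd (M\<^sub>3 @ [c]) = y 2"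
    "successively (\<lambda>u v. {u, v} \<in> lattice_edges) (M\<^sub>1 @ [c])"
    "successively (\<lambda>u v. {u, v} \<in> lattice_edges) (M\<^sub>2 @ [c])"
    "successively (\<lambda>u v. {u, v} \<in> lattice_edges) (M\<^sub>3 @ [c])"
    using tripod_exists[of \<Lambda> lattice_edges "y 0" "y 1" "y 2"] cube_connected y unfolding \<Lambda>_def by metis
  define M where "M i = (if i = 0 then M\<^sub>1 else if i = 1 then M\<^sub>2 else M\<^sub>3)" for i :: nat
  have three: "i = 0 \<or> i = 1 \<or> i = 2" if "i < m" for i using that m(2) by linarith
  have hd_M: "hd (M i @ [c]) = y i" and succ_M: "successively (\<lambda>u v. {u, v} \<in> lattice_edges) (M i @ [c])"
    if "i < m" for i
    using three[OF that] tri by (auto simp: M_def)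
  have star: "star \<omega> \<Lambda> k {..<m} a M c"
  proof
    show "set (M i) \<subseteq> \<Lambda> - {c}" for i using tri(2) by (auto simp: M_def)
    show "distinct (M i)" for i using tri(3) by (auto simp: M_def)
    show "set (M i) \<inter> set (M j) = {}" if "i \<in> {..<m}" "j \<in> {..<m}" "i \<noteq> j" for i j
      using three[of i] three[of j] that tri(3) by (auto simp: M_def)
    show "\<exists>s\<in>\<Lambda>. {a i, s} \<in> \<omega>" if "i \<in> {..<m}" for i using as(2,3) that by blast
    show "a j \<notin> cluster \<omega> \<Lambda> (a i)" if ij: "i \<in> {..<m}" "j \<in> {..<m}" "i \<noteq> j" for i j
    proof
      assume "a j \<in> cluster \<omega> \<Lambda> (a i)"
      then have "a j \<in> cluster \<omega> {} (a i)" using cluster_mono[of \<omega> \<omega> "{}" \<Lambda> "a i"] by auto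
      then have "a j \<in> cluster \<omega> {} (x i)" using as(4)[of i] ij cluster_trans by (metis lessThan_iff)
      then have "x j \<in> cluster \<omega> {} (x i)" using as(4)[of j] ij cluster_trans cluster_sym by (metis lessThan_iff)
      then show False using sep ij by simp
    qed
  qed (use as tri m \<omega> finite_nbrs[OF \<omega>(1)] in \<open>auto simp: \<Lambda>_def\<close>)
  interpret star \<omega> \<Lambda> k "{..<m}" a M c by (rule star)
  have "\<omega> - base \<subseteq> {e \<in> lattice_edges. e \<inter> \<Lambda> \<noteq> {}}" using \<omega>(1) by (auto simp: base_def)
  then have fin: "finite (\<omega> - base)"
    using finite_lattice_edges_meeting[of \<Lambda>] fin_\<Lambda> finite_subset by blast
  have card_base: "card (nbrs base u) \<le> k" for u
    using card_mono[OF deg(1) nbrs_base(1), of u] deg(2)[of u] by linarith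
  have base: "local_variant k \<omega> base"
    unfolding local_variant_def
  proof (intro conjI allI)
    have *: "base - \<omega> = {}" by (auto simp: base_def)
    show "finite (base - \<omega>)" unfolding * by simp
  qed (use fin \<omega>(1) card_base in \<open>auto simp: base_def\<close>)
  have "path_edges (arm i) \<subseteq> lattice_edges" if "i < m" for i
  proof -
    have "{a i, hd (M i @ [c])} \<in> lattice_edges"
      using as(3)[OF that] \<omega>(1) hd_M[OF that] that by (auto simp: y_def)
    then show ?thesis using succ_M[OF that]
      unfolding path_edges_subset_iff arm_def by (cases "M i") auto
  qed
  then have "joined \<subseteq> lattice_edges" using \<omega>(1) by (auto simp: joined_def base_def)
  moreover have "finite (\<omega> - joined)" using fin base_joined by (meson Diff_mono finite_subset order_refl)
  moreover have "joined - \<omega> \<subseteq> (\<Union>i\<in>{..<m}. path_edges (arm i))" by (auto simp: joined_def base_def)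
  then have "finite (joined - \<omega>)" by (rule finite_subset) (simp add: finite_path_edges)
  ultimately have "local_variant k \<omega> joined"
    using card_nbrs_joined by (simp add: local_variant_def)
  with star _ base show thesis by (rule that) (use as(5) in simp)
qed

lemma several_infinite_2_iff:
  "several_infinite 2 \<omega> \<longleftrightarrow> (\<exists>x y. infinite (cluster \<omega> {} x) \<and> infinite (cluster \<omega> {} y) \<and> y \<notin> cluster \<omega> {} x)"
proof
  assume "several_infinite 2 \<omega>"
  then obtain x :: "nat \<Rightarrow> int ^ 'a" where "\<forall>i<2. infinite (cluster \<omega> {} (x i))" "\<forall>i<2. \<forall>j<2. i \<noteq> j \<longrightarrow> x j \<notin> cluster \<omega> {} (x i)"
    unfolding several_infinite_def by blast
  then have "infinite (cluster \<omega> {} (x 0))" "infinite (cluster \<omega> {} (x 1))" "x 1 \<notin> cluster \<omega> {} (x 0)"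
    by (metis pos2 one_less_numeral_iff semiring_norm(76) zero_neq_one)+
  then show "\<exists>x y. infinite (cluster \<omega> {} x) \<and> infinite (cluster \<omega> {} y) \<and> y \<notin> cluster \<omega> {} x" by blast
next
  assume "\<exists>x y. infinite (cluster \<omega> {} x) \<and> infinite (cluster \<omega> {} y) \<and> y \<notin> cluster \<omega> {} x"
  then obtain x y where xy: "infinite (cluster \<omega> {} x)" "infinite (cluster \<omega> {} y)" "y \<notin> cluster \<omega> {} x" by blast
  then have "x \<notin> cluster \<omega> {} y" using cluster_sym by metis
  with xy show "several_infinite 2 \<omega>"
    unfolding several_infinite_def
    by (intro exI[of _ "\<lambda>i. if i = 0 then x else y"]) (auto simp: less_2_cases_iff)
qed

lemma num_infinite_clusters_le_1:
  fixes \<omega> :: "'d::finite edge set"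
  assumes "\<not> several_infinite 2 \<omega>"
  shows "num_infinite_clusters \<omega> \<in> {0, 1}"
proof -
  define \<C> where "\<C> = {C \<in> open_clusters \<omega>. infinite C}"
  have adj: "{(x, y). {x, y} \<in> \<omega>} = adj \<omega> {}" by (simp add: adj_def)
  have cl: "\<exists>x. C = cluster \<omega> {} x" if "C \<in> open_clusters \<omega>" for C
    using that by (auto simp: open_clusters_def quotient_def adj cluster_def)
  have "C = D" if "C \<in> \<C>" "D \<in> \<C>" for C D
  proof -
    obtain x y where xy: "C = cluster \<omega> {} x" "D = cluster \<omega> {} y"
      using cl[of C] cl[of D] \<open>C \<in> \<C>\<close> \<open>D \<in> \<C>\<close> by (auto simp: \<C>_def)
    then have "y \<in> cluster \<omega> {} x"
      using \<open>C \<in> \<C>\<close> \<open>D \<in> \<C>\<close> assms unfolding several_infinite_2_iff \<C>_def by blast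
    then show ?thesis using xy cluster_eq[of y \<omega> "{}" x] by simp
  qed
  then have "\<C> = {} \<or> (\<exists>C. \<C> = {C})" by blast
  then show ?thesis
    unfolding num_infinite_clusters_def Let_def \<C>_def[symmetric]
    by (auto simp: zero_enat_def one_enat_def)
qed

section \<open>The case k \<le> 2: no infinite cluster\<close>

lemma AE_no_leaf:
  assumes "k \<le> 2"
  shows "AE U in clock_measure. \<forall>x :: int ^ 'd::finite.
    \<not> (infinite (cluster (config k t U) {} x) \<and> card (nbrs (config k t U) x) \<le> 1)"
proof (rule AE_none_if_few)
  fix x :: "int ^ 'd"
  \<comment> \<open>For measurability, the degree bound becomes a statement with countable
    quantifiers.\<close>
  have "card (nbrs (config k t U) x) \<le> 1 \<longleftrightarrow>
      (\<forall>y z. {y, x} \<in> config k t U \<and> {z, x} \<in> config k t U \<longrightarrow> y = z)" for U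
    using card_le_Suc0_iff_eq[OF finite_nbrs[OF config_subset[of k t U]], of x]
    by (auto simp: nbrs_def)
  then show "Measurable.pred clock_measure
      (\<lambda>U. infinite (cluster (config k t U) {} x) \<and> card (nbrs (config k t U) x) \<le> 1)"
    by simp
  show "infinite (cluster (config k t U) {} x) \<and> card (nbrs (config k t U) x) \<le> 1 \<longleftrightarrow>
      infinite (cluster (config k t (shift_clocks x U)) {} 0) \<and> card (nbrs (config k t (shift_clocks x U)) 0) \<le> 1" for U
    by (simp add: config_shift infinite_cluster_translate nbrs_translate)
next
  fix n
  show "AE U in clock_measure.
      card {x \<in> cube n :: (int ^ 'd) set. infinite (cluster (config k t U) {} x) \<and> card (nbrs (config k t U) x) \<le> 1}
      \<le> card (cube (Suc n) - cube n :: (int ^ 'd) set)"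
    using AE_regular
  proof eventually_elim
    fix U :: "'d edge \<Rightarrow> real" assume U: "regular U"
    show "card {x \<in> cube n :: (int ^ 'd) set. infinite (cluster (config k t U) {} x) \<and> card (nbrs (config k t U) x) \<le> 1}
      \<le> card (cube (Suc n) - cube n :: (int ^ 'd) set)"
    proof (rule card_leaves_le)
      show "finite (nbrs (config k t U) u) \<and> card (nbrs (config k t U) u) \<le> 2" for u
        using stable_degree[OF U stable_config[OF U], of k t u] assms by simp
      show "v \<in> cube (Suc n)" if "u \<in> cube n" "{u, v} \<in> config k t U" for u v
        using cube_boundary[OF that(1)] that(2) config_subset[of k t U] by auto
    qed (auto intro: cube_mono[THEN subsetD, of n "Suc n"])
  qed
qed

text \<open>Some neighbour \<open>a\<close> of \<open>x\<close> lies in an infinite piece that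
  remains when \<open>x\<close> is isolated. It loses one of its at most two edges and so becomes an
  endpoint, against \<open>AE_no_leaf\<close>. Removing edges keeps the degree bound, so this is a
  local variant.\<close>

lemma AE_no_infinite_cluster:
  assumes k: "k \<le> 2" and t: "0 < t" "t < 1"
  shows "AE U in clock_measure. \<forall>x :: int ^ 'd::finite. finite (cluster (config k t U) {} x)"
  using AE_local_variant[OF AE_regular AE_no_leaf[OF k] t] AE_regular
proof eventually_elim
  fix U :: "'d edge \<Rightarrow> real"
  let ?\<omega> = "config k t U"
  assume leaf: "\<forall>\<omega>'. local_variant k ?\<omega> \<omega>' \<longrightarrow> (\<forall>x. \<not> (infinite (cluster \<omega>' {} x) \<and> card (nbrs \<omega>' x) \<le> 1))"
    and U: "regular U"
  note deg = stable_degree[OF U stable_config[OF U], of k t]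
  show "\<forall>x. finite (cluster ?\<omega> {} x)"
  proof (rule allI, rule ccontr)
    fix x assume "infinite (cluster ?\<omega> {} x)"
    then obtain a s where a: "a \<notin> {x}" "s \<in> {x}" "{a, s} \<in> ?\<omega>" "infinite (cluster ?\<omega> {x} a)"
      using infinite_cluster_split[of ?\<omega> "{x}" x] deg(1) by (metis finite.emptyI finite.insertI singletonI)
    define \<omega>' where "\<omega>' = {e \<in> ?\<omega>. x \<notin> e}"
    have "nbrs \<omega>' u \<subseteq> nbrs ?\<omega> u" for u by (auto simp: nbrs_def \<omega>'_def)
    then have card: "card (nbrs \<omega>' u) \<le> k" for u
      using card_mono[OF deg(1)] deg(2) order_trans by metis
    have "?\<omega> - \<omega>' \<subseteq> {e \<in> lattice_edges. e \<inter> {x} \<noteq> {}}" using config_subset[of k t U] by (auto simp: \<omega>'_def)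
    then have "finite (?\<omega> - \<omega>')" using finite_lattice_edges_meeting[of "{x}"] finite_subset by auto
    moreover have "\<omega>' \<subseteq> ?\<omega>" by (auto simp: \<omega>'_def)
    then have "finite (\<omega>' - ?\<omega>)" "\<omega>' \<subseteq> lattice_edges"
      using config_subset[of k t U] by (metis Diff_eq_empty_iff finite.emptyI, blast)
    ultimately have var: "local_variant k ?\<omega> \<omega>'"
      using card by (simp add: local_variant_def)
    have "adj \<omega>' {} = adj ?\<omega> {x}" by (auto simp: adj_def \<omega>'_def)
    then have "cluster \<omega>' {} a = cluster ?\<omega> {x} a" by (simp add: cluster_def)
    moreover have "nbrs \<omega>' a \<subseteq> nbrs ?\<omega> a - {x}" by (auto simp: nbrs_def \<omega>'_def)
    then have "card (nbrs \<omega>' a) \<le> card (nbrs ?\<omega> a - {x})" using deg(1) by (intro card_mono) auto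
    moreover have "x \<in> nbrs ?\<omega> a" using a by (simp add: nbrs_def insert_commute)
    then have "card (nbrs ?\<omega> a - {x}) = card (nbrs ?\<omega> a) - 1" using deg(1) by simp
    ultimately show False using leaf[rule_format, OF var, of a] a(4) deg(2)[of a] k by simp
  qed
qed

section \<open>The case k \<ge> 3: at most one infinite cluster\<close>

lemma trifurcation_translate: "trifurcation (translate x \<omega>) 0 \<longleftrightarrow> trifurcation \<omega> (x :: 'v::ab_group_add)"
proof -
  let ?P = "\<lambda>b\<^sub>1 b\<^sub>2 b\<^sub>3. {x, b\<^sub>1} \<in> \<omega> \<and> {x, b\<^sub>2} \<in> \<omega> \<and> {x, b\<^sub>3} \<in> \<omega> \<and>
     infinite (cluster \<omega> {x} b\<^sub>1) \<and> infinite (cluster \<omega> {x} b\<^sub>2) \<and> infinite (cluster \<omega> {x} b\<^sub>3) \<and>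
     b\<^sub>2 \<notin> cluster \<omega> {x} b\<^sub>1 \<and> b\<^sub>3 \<notin> cluster \<omega> {x} b\<^sub>1 \<and> b\<^sub>3 \<notin> cluster \<omega> {x} b\<^sub>2"
  have "trifurcation (translate x \<omega>) 0 \<longleftrightarrow> (\<exists>a\<^sub>1 a\<^sub>2 a\<^sub>3. ?P (x + a\<^sub>1) (x + a\<^sub>2) (x + a\<^sub>3))"
    unfolding trifurcation_def cluster_translate infinite_cluster_translate by (simp add: translate_def)
  also have "\<dots> \<longleftrightarrow> (\<exists>b\<^sub>1 b\<^sub>2 b\<^sub>3. ?P b\<^sub>1 b\<^sub>2 b\<^sub>3)"
  proof
    assume "\<exists>b\<^sub>1 b\<^sub>2 b\<^sub>3. ?P b\<^sub>1 b\<^sub>2 b\<^sub>3"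
    then obtain b\<^sub>1 b\<^sub>2 b\<^sub>3 where "?P b\<^sub>1 b\<^sub>2 b\<^sub>3" by blast
    then have "?P (x + (b\<^sub>1 - x)) (x + (b\<^sub>2 - x)) (x + (b\<^sub>3 - x))" by simp
    then show "\<exists>a\<^sub>1 a\<^sub>2 a\<^sub>3. ?P (x + a\<^sub>1) (x + a\<^sub>2) (x + a\<^sub>3)" by blast
  qed blast
  finally show ?thesis unfolding trifurcation_def .
qed

lemma AE_no_trifurcation:
  "AE U in clock_measure. \<forall>x :: int ^ 'd::finite. \<not> trifurcation (config k t U) x"
proof (rule AE_none_if_few)
  fix x :: "int ^ 'd"
  show "Measurable.pred clock_measure (\<lambda>U. trifurcation (config k t U) x)"
    unfolding trifurcation_def by measurable
  show "trifurcation (config k t U) x \<longleftrightarrow> trifurcation (config k t (shift_clocks x U)) 0" for U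
    by (simp add: config_shift trifurcation_translate)
next
  fix n
  have "card {x \<in> cube n :: (int ^ 'd) set. trifurcation (config k t U) x} \<le> card (cube (Suc n) - cube n :: (int ^ 'd) set)"
    for U :: "'d edge \<Rightarrow> real"
  proof (rule card_trifurcations_le)
    show "v \<in> cube (Suc n)" if "u \<in> cube n" "{u, v} \<in> config k t U" for u v
      using cube_boundary[OF that(1)] that(2) config_subset[of k t U] by auto
  qed auto
  then show "AE U in clock_measure.
      card {x \<in> cube n :: (int ^ 'd) set. trifurcation (config k t U) x} \<le> card (cube (Suc n) - cube n :: (int ^ 'd) set)" by simp
qed

lemma AE_no_three:
  assumes k: "3 \<le> k" and t: "0 < t" "t < 1"
  shows "AE U in clock_measure. \<not> several_infinite 3 (config k t U :: 'd::finite edge set)"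
  using AE_local_variant[OF AE_regular AE_no_trifurcation t] AE_regular
proof eventually_elim
  fix U :: "'d edge \<Rightarrow> real"
  let ?\<omega> = "config k t U"
  assume no: "\<forall>\<omega>'. local_variant k ?\<omega> \<omega>' \<longrightarrow> (\<forall>x. \<not> trifurcation \<omega>' x)" and U: "regular U"
  show "\<not> several_infinite 3 ?\<omega>"
  proof
    assume three: "several_infinite 3 ?\<omega>"
    have k': "0 < (3 :: nat)" "3 \<le> (3 :: nat)" "3 \<le> k" "2 \<le> k" using k by auto
    obtain \<Lambda> a M c where star: "star ?\<omega> \<Lambda> k {..<3} a M c"
      and inf: "\<forall>i<3. infinite (cluster ?\<omega> \<Lambda> (a i))"
      and var: "local_variant k ?\<omega> (star.base ?\<omega> \<Lambda>)" "local_variant k ?\<omega> (star.joined ?\<omega> \<Lambda> {..<3} a M c)"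
      using star_exists[OF config_subset stable_degree(2)[OF U stable_config[OF U]] k' three] .
    interpret star ?\<omega> \<Lambda> k "{..<3}" a M c by (rule star)
    have "trifurcation joined c" using inf by (intro trifurcation_joined) auto
    then show False using no var by blast
  qed
qed

text \<open>By the zero-one law the only case to refute is that two infinite clusters are almost
  sure. Then every local variant has two as well, in particular \<open>joined\<close>, although
  there every infinite cluster contains \<open>c\<close>.\<close>

lemma AE_at_most_one:
  assumes k: "3 \<le> k" and t: "0 < t" "t < 1"
  shows "AE U in clock_measure. \<not> several_infinite 2 (config k t U :: 'd::finite edge set)"
proof -
  interpret C: prob_space "clock_measure :: ('d edge \<Rightarrow> real) measure" by (rule prob_space_clock)
  have "Measurable.pred clock_measure (\<lambda>U. several_infinite 2 (config k t U :: 'd edge set))"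
    unfolding several_infinite_2_iff by measurable
  moreover have "several_infinite 2 (config k t (shift_clocks x U)) \<longleftrightarrow> several_infinite 2 (config k t U)"
    for x and U :: "'d edge \<Rightarrow> real"
  proof -
    have ex: "(\<exists>y. P (x + y)) \<longleftrightarrow> (\<exists>y. P y)" for P
      by (metis add_diff_cancel_left' diff_add_cancel add.commute)
    show ?thesis
      unfolding several_infinite_2_iff config_shift cluster_translate infinite_cluster_translate image_empty
      using ex[of "\<lambda>y. \<exists>z. infinite (cluster (config k t U) {} y) \<and>
          infinite (cluster (config k t U) {} (x + z)) \<and> x + z \<notin> cluster (config k t U) {} y"]
        ex[of "\<lambda>z. infinite (cluster (config k t U) {} y) \<and>
          infinite (cluster (config k t U) {} z) \<and> z \<notin> cluster (config k t U) {} y" for y]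
      by simp
  qed
  ultimately consider "AE U in clock_measure. several_infinite 2 (config k t U :: 'd edge set)"
    | "AE U in clock_measure. \<not> several_infinite 2 (config k t U :: 'd edge set)"
    using clock_zero_one[of "\<lambda>U. several_infinite 2 (config k t U :: 'd edge set)"] by blast
  then show ?thesis
  proof cases
    case 1
    have "AE U in (clock_measure :: ('d edge \<Rightarrow> real) measure). False"
      using 1 AE_local_variant[OF AE_regular 1 t] AE_local_variant[OF AE_regular AE_no_three[OF k t] t] AE_regular
    proof eventually_elim
      fix U :: "'d edge \<Rightarrow> real"
      let ?\<omega> = "config k t U"
      assume two: "several_infinite 2 ?\<omega>" and all2: "\<forall>\<omega>'. local_variant k ?\<omega> \<omega>' \<longrightarrow> several_infinite 2 \<omega>'"
        and no3: "\<forall>\<omega>'. local_variant k ?\<omega> \<omega>' \<longrightarrow> \<not> several_infinite 3 \<omega>'" and U: "regular U"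
      have k': "0 < (2 :: nat)" "2 \<le> (3 :: nat)" "2 \<le> k" "2 \<le> k" using k by auto
      obtain \<Lambda> a M c where star: "star ?\<omega> \<Lambda> k {..<2} a M c"
        and inf: "\<forall>i<2. infinite (cluster ?\<omega> \<Lambda> (a i))"
        and var: "local_variant k ?\<omega> (star.base ?\<omega> \<Lambda>)" "local_variant k ?\<omega> (star.joined ?\<omega> \<Lambda> {..<2} a M c)"
        using star_exists[OF config_subset stable_degree(2)[OF U stable_config[OF U]] k' two] .
      interpret star ?\<omega> \<Lambda> k "{..<2}" a M c by (rule star)
      \<comment> \<open>Cutting leaves no infinite cluster besides those of the two feet: a further
        one would make three in \<open>base\<close>, which is itself a local variant.\<close>
      have only: "\<exists>i\<in>{..<2}. a i \<in> cluster base {} y" if y: "infinite (cluster base {} y)" for y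
      proof (rule ccontr)
        assume none: "\<not> ?thesis"
        define z where "z i = (if i < 2 then a i else y)" for i :: nat
        have "several_infinite 3 base"
          unfolding several_infinite_def
        proof (intro exI[of _ z] conjI allI impI)
          show "infinite (cluster base {} (z i))" for i
            using inf y by (simp add: z_def cluster_base)
          show "z j \<notin> cluster base {} (z i)" if "i < 3" "j < 3" "i \<noteq> j" for i j
          proof (cases "i < 2 \<and> j < 2")
            case True then show ?thesis using separated[of i j] that by (simp add: z_def cluster_base)
          next
            case False
            with that have "i < 2 \<and> \<not> j < 2 \<or> j < 2 \<and> \<not> i < 2" by presburger
            then consider "i < 2" "z j = y" "z i = a i" | "j < 2" "z i = y" "z j = a j"
              by (auto simp: z_def)
            then show ?thesis
            proof cases
              case 1 then show ?thesis using none cluster_sym[of y base "{}" "a i"] by auto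
            next
              case 2 then show ?thesis using none by auto
            qed
          qed
        qed
        with no3 var(1) show False by blast
      qed
      obtain y z where yz: "infinite (cluster joined {} y)" "infinite (cluster joined {} z)" "z \<notin> cluster joined {} y"
        using all2 var(2) unfolding several_infinite_2_iff by blast
      have "c \<in> cluster joined {} y" "c \<in> cluster joined {} z"
        using infinite_clusters_joined[OF only] yz by blast+
      then show False using yz(3) cluster_sym cluster_trans by metis
    qed
    then show ?thesis by simp
  qed
qed

theorem theorem1:
  fixes k :: nat and t :: real
  assumes "1 \<le> k" and "k \<le> 2 * CARD('d)"
    and "0 \<le> t" and "t < 1"
  shows "AE U in (clock_measure :: ('d::finite edge \<Rightarrow> real) measure).
           num_infinite_clusters (cdp_config k U t) \<in> {0, 1}"
proof -
  have "AE U in clock_measure. \<not> several_infinite 2 (config k t U :: 'd edge set)"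
  proof (cases "t = 0 \<or> k \<le> 2")
    case True
    have "AE U in clock_measure. \<forall>x. finite (cluster (config k t U :: 'd edge set) {} x)"
    proof (cases "t = 0")
      \<comment> \<open>There is no room to move a clock into \<open>{0<..t}\<close> here, but as
        clocks are positive, no edge is open yet.\<close>
      case True
      show ?thesis
        using AE_regular
      proof eventually_elim
        fix U :: "'d edge \<Rightarrow> real" assume U: "regular U"
        have "config k t U = {}"
          using stable_config[OF U, of k t] U True unfolding stable_def regular_def by force
        moreover have "cluster {} {} x = {x}" for x :: "int ^ 'd"
          using cluster_closed[of x "{x}" "{}" "{}"] by auto
        ultimately show "\<forall>x. finite (cluster (config k t U) {} x)" by simp
      qed
    next
      case False
      with True assms show ?thesis by (intro AE_no_infinite_cluster) auto
    qed
    then show ?thesis by eventually_elim (auto simp: several_infinite_2_iff)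
  next
    case False
    with assms show ?thesis by (intro AE_at_most_one) auto
  qed
  with AE_regular show ?thesis
  proof eventually_elim
    fix U :: "'d edge \<Rightarrow> real"
    assume "regular U" "\<not> several_infinite 2 (config k t U)"
    then show "num_infinite_clusters (cdp_config k U t) \<in> {0, 1}"
      using cdp_config_eq[of U k t] num_infinite_clusters_le_1 assms by metis
  qed
qed

end
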